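(* The following decision problem is undecidable. Input: a finite algebra $\mathbf{A}$ with finitely many basic operations (given by its operation tables). Question: does $\mathbf{4} \in \mathrm{typ}\{V(\mathbf{A})\}$ hold, where $V(\mathbf{A})$ is the (finitely generated, locally finite) variety generated by $\mathbf{A}$?
   Context: $V(\mathbf{A})$ denotes the variety $HSP(\mathbf{A})$ generated by $\mathbf{A}$. Types are those of tame congruence theory (Hobby–McKenzie): every prime quotient (covering pair) $\alpha \prec \beta$ in the congruence lattice of a finite algebra has a type in $\{\mathbf{1},\mathbf{2},\mathbf{3},\mathbf{4},\mathbf{5}\}$ (unary, affine, Boolean, lattice, semilattice respectively); thus type $\mathbf{4}$ is the lattice type. For a locally finite variety $\mathcal{V}$, $\mathrm{typ}\{\mathcal{V}\}$ is the set of all types of prime quotients $\langle\alpha,\beta\rangle$ in $\mathrm{Con}(\mathbf{C})$, as $\mathbf{C}$ ranges over the finite algebras of $\mathcal{V}$. "Undecidable" means that no algorithm (Turing machine) gives the correct answer on every input. *)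

theory Defs
  imports "HOL-Algebra.Module" "HOL-Algebra.Bij"
begin

section \<open>Algebras in the sense of universal algebra\<close>

text \<open>
  The set \<open>symbs\<close> of operation symbols may be infinite: induced algebras have all
  polynomials of the ambient algebra as basic operations.  An operation of rank \<open>n\<close>
  takes lists of length \<open>n\<close>; its values outside \<open>tuples n (univ A)\<close> are irrelevant.
\<close>

record ('i, 'a) alg =
  univ :: "'a set"
  symbs :: "'i set"
  rank :: "'i \<Rightarrow> nat"
  interp :: "'i \<Rightarrow> 'a list \<Rightarrow> 'a"

definition tuples :: "nat \<Rightarrow> 'a set \<Rightarrow> 'a list set" where
  "tuples n U = {xs. length xs = n \<and> set xs \<subseteq> U}"

definition closed_under :: "('i, 'a) alg \<Rightarrow> 'a set \<Rightarrow> bool" where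
  "closed_under A U \<longleftrightarrow> (\<forall>s\<in>symbs A. \<forall>xs\<in>tuples (rank A s) U. interp A s xs \<in> U)"

definition is_alg :: "('i, 'a) alg \<Rightarrow> bool" where
  "is_alg A \<longleftrightarrow> univ A \<noteq> {} \<and> closed_under A (univ A)"

definition subuniverse :: "('i, 'a) alg \<Rightarrow> 'a set \<Rightarrow> bool" where
  "subuniverse A U \<longleftrightarrow> U \<noteq> {} \<and> U \<subseteq> univ A \<and> closed_under A U"

definition subalg :: "('i, 'a) alg \<Rightarrow> 'a set \<Rightarrow> ('i, 'a) alg" where
  "subalg A U = \<lparr>univ = U, symbs = symbs A, rank = rank A, interp = interp A\<rparr>"

definition power_alg :: "'k set \<Rightarrow> ('i, 'a) alg \<Rightarrow> ('i, 'k \<Rightarrow> 'a) alg" where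
  "power_alg I A = \<lparr>univ = I \<rightarrow>\<^sub>E univ A, symbs = symbs A, rank = rank A,
     interp = (\<lambda>s fs. \<lambda>k\<in>I. interp A s (map (\<lambda>f. f k) fs))\<rparr>"

definition surj_hom :: "('i, 'a) alg \<Rightarrow> ('i, 'b) alg \<Rightarrow> ('a \<Rightarrow> 'b) \<Rightarrow> bool" where
  "surj_hom A B h \<longleftrightarrow> symbs B = symbs A \<and> (\<forall>s\<in>symbs A. rank B s = rank A s) \<and>
     h ` univ A = univ B \<and>
     (\<forall>s\<in>symbs A. \<forall>xs\<in>tuples (rank A s) (univ A). h (interp A s xs) = interp B s (map h xs))"

definition hsp_over :: "'k set \<Rightarrow> ('i, 'a) alg \<Rightarrow> ('i, 'b) alg \<Rightarrow> bool" where
  "hsp_over I A B \<longleftrightarrow> is_alg B \<and>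
     (\<exists>U h. subuniverse (power_alg I A) U \<and> surj_hom (subalg (power_alg I A) U) B h)"

text \<open>
  The variety \<open>HSP(A)\<close>, with powers indexed by sets of natural numbers.  For a finite
  algebra \<open>A\<close> this bound on the exponent loses no finite member of the variety, by the lemma
  \<open>finite_hsp_over_nat\<close> below; only finite members are used here.
\<close>

definition HSP :: "('i, 'a) alg \<Rightarrow> ('i, 'b) alg set" where
  "HSP A = {B. \<exists>I::nat set. hsp_over I A B}"

lemma finite_hsp_over_nat:
  fixes I :: "'k set" and A :: "('i, 'a) alg" and B :: "('i, 'b) alg"
  assumes finA: "finite (univ A)" and finB: "finite (univ B)" and B: "hsp_over I A B"
  shows "B \<in> HSP A"
proof -
  obtain U h where isB: "is_alg B" and U: "subuniverse (power_alg I A) U"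
    and h: "surj_hom (subalg (power_alg I A) U) B h"
    using B unfolding hsp_over_def by blast
  have hU: "h ` U = univ B" using h by (simp add: surj_hom_def subalg_def)
  have sB: "symbs B = symbs A" and rB: "\<And>s. s \<in> symbs A \<Longrightarrow> rank B s = rank A s"
    using h by (auto simp: surj_hom_def subalg_def power_alg_def)
  have hop: "h (\<lambda>k\<in>I. interp A s (map (\<lambda>f. f k) fs)) = interp B s (map h fs)"
    if "s \<in> symbs A" "fs \<in> tuples (rank A s) U" for s fs
    using h that by (simp add: surj_hom_def subalg_def power_alg_def)
  have Ucl: "(\<lambda>k\<in>I. interp A s (map (\<lambda>f. f k) fs)) \<in> U"
    if "s \<in> symbs A" "fs \<in> tuples (rank A s) U" for s fs
    using U that by (auto simp: subuniverse_def closed_under_def power_alg_def)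
  have Usub: "U \<subseteq> I \<rightarrow>\<^sub>E univ A"
    using U by (auto simp: subuniverse_def power_alg_def)
  obtain C where C: "C \<subseteq> U" "finite C" "h ` C = univ B"
    using finB hU by (metis finite_subset_image subset_refl)
  define r where "r i = (\<lambda>c\<in>C. c i)" for i
  have "r ` I \<subseteq> C \<rightarrow>\<^sub>E univ A" using C(1) Usub by (fastforce simp: r_def)
  then have finr: "finite (r ` I)" using finite_PiE[OF C(2)] finA finite_subset by metis
  then obtain J where J: "J \<subseteq> I" "finite J" "r ` J = r ` I" by (metis finite_subset_image subset_refl)
  obtain g :: "'k \<Rightarrow> nat" where g: "inj_on g J"
    using finite_imp_inj_to_nat_seg[OF J(2)] by blast
  define N where "N = g ` J"
  define e where "e = inv_into J g"
  have eJ: "e n \<in> J" if "n \<in> N" for n using that by (auto simp: e_def N_def g)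
  have eg: "e (g j) = j" if "j \<in> J" for j using that g by (simp add: e_def)
  define T where "T = {f \<in> U. \<forall>i\<in>I. \<forall>j\<in>I. r i = r j \<longrightarrow> f i = f j}"
  have TU: "T \<subseteq> U" unfolding T_def by blast
  have TD: "f i = f j" if "f \<in> T" "i \<in> I" "j \<in> I" "r i = r j" for f i j
    using that unfolding T_def by blast
  have CT: "C \<subseteq> T"
  proof
    fix c assume c: "c \<in> C"
    have "c i = c j" if "r i = r j" for i j using fun_cong[OF that, of c] c by (simp add: r_def)
    then show "c \<in> T" using c C(1) unfolding T_def by blast
  qed
  define p where "p f = (\<lambda>n\<in>N. f (e n))" for f :: "'k \<Rightarrow> 'a"
  have pinj: "inj_on p T"
  proof (rule inj_onI)
    fix f f' assume f: "f \<in> T" "f' \<in> T" and eq: "p f = p f'"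
    have J_eq: "f j = f' j" if "j \<in> J" for j
      using fun_cong[OF eq, of "g j"] that eg by (auto simp: p_def N_def)
    have "f i = f' i" if i: "i \<in> I" for i
    proof -
      obtain j where j: "j \<in> J" "r j = r i" using i J(3) by (metis imageE imageI)
      have "f i = f j" "f' i = f' j" using TD[of _ i j] f i j J(1) by auto
      then show ?thesis using J_eq[OF j(1)] by simp
    qed
    then show "f = f'" using f TU Usub by (intro PiE_ext[of f I "\<lambda>_. univ A" f']) auto
  qed
  have Top: "(\<lambda>k\<in>I. interp A s (map (\<lambda>f. f k) fs)) \<in> T"
    if s: "s \<in> symbs A" and fs: "fs \<in> tuples (rank A s) T" for s fs
  proof -
    have "fs \<in> tuples (rank A s) U" using fs TU by (auto simp: tuples_def)
    then have U': "(\<lambda>k\<in>I. interp A s (map (\<lambda>f. f k) fs)) \<in> U" by (rule Ucl[OF s])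
    have eq: "map (\<lambda>f. f i) fs = map (\<lambda>f. f j) fs" if ij: "i \<in> I" "j \<in> I" "r i = r j" for i j
      unfolding map_eq_conv
    proof
      fix f assume "f \<in> set fs"
      then have "f \<in> T" using fs by (auto simp: tuples_def)
      then show "f i = f j" using ij by (rule TD)
    qed
    have "(\<lambda>k\<in>I. interp A s (map (\<lambda>f. f k) fs)) i = (\<lambda>k\<in>I. interp A s (map (\<lambda>f. f k) fs)) j"
      if "i \<in> I" "j \<in> I" "r i = r j" for i j
      using eq[OF that] that by (simp del: map_eq_conv)
    with U' show ?thesis unfolding T_def by blast
  qed
  have pop: "p (\<lambda>k\<in>I. interp A s (map (\<lambda>f. f k) fs)) = (\<lambda>n\<in>N. interp A s (map (\<lambda>f. f n) (map p fs)))"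
    for s fs
  proof (rule ext)
    fix n
    show "p (\<lambda>k\<in>I. interp A s (map (\<lambda>f. f k) fs)) n = (\<lambda>n\<in>N. interp A s (map (\<lambda>f. f n) (map p fs))) n"
      using eJ[of n] J(1) by (auto simp: p_def o_def)
  qed
  define q where "q = inv_into T p"
  have qp: "q (p f) = f" if "f \<in> T" for f using that pinj by (simp add: q_def)
  have lift: "\<exists>fs \<in> tuples n T. xs = map p fs" if "xs \<in> tuples n (p ` T)" for n xs
  proof (rule bexI)
    show "xs = map p (map q xs)"
    proof (rule nth_equalityI)
      fix k assume "k < length xs"
      then have "xs ! k \<in> p ` T" using that nth_mem[of k xs] by (auto simp: tuples_def)
      then show "xs ! k = map p (map q xs) ! k" using \<open>k < length xs\<close>
        by (simp add: q_def f_inv_into_f)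
    qed simp
    show "map q xs \<in> tuples n T"
    proof -
      have "q x \<in> T" if "x \<in> p ` T" for x using that qp by auto
      then show ?thesis using that by (auto simp: tuples_def)
    qed
  qed
  have "subuniverse (power_alg N A) (p ` T)"
  proof -
    have "p f \<in> N \<rightarrow>\<^sub>E univ A" if "f \<in> T" for f
    proof -
      have "f \<in> I \<rightarrow>\<^sub>E univ A" using that TU Usub by auto
      then have "f (e n) \<in> univ A" if "n \<in> N" for n using eJ[OF that] J(1) PiE_mem by fast
      then show ?thesis by (simp add: p_def)
    qed
    moreover have "T \<noteq> {}" using CT C(3) isB by (auto simp: is_alg_def)
    moreover have "(\<lambda>n\<in>N. interp A s (map (\<lambda>f. f n) xs)) \<in> p ` T"
      if s: "s \<in> symbs A" and xs: "xs \<in> tuples (rank A s) (p ` T)" for s xs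
    proof -
      obtain fs where fs: "fs \<in> tuples (rank A s) T" and xsp: "xs = map p fs"
        using lift[OF xs] by blast
      show ?thesis unfolding xsp pop[symmetric] using Top[OF s fs] by (rule imageI)
    qed
    ultimately show ?thesis by (auto simp: subuniverse_def closed_under_def power_alg_def)
  qed
  moreover have "surj_hom (subalg (power_alg N A) (p ` T)) B (h \<circ> q)"
  proof -
    have "(h \<circ> q) ` p ` T = h ` T" using qp by (simp add: image_image)
    also have "h ` T = univ B"
    proof
      show "h ` T \<subseteq> univ B" using TU hU by blast
      show "univ B \<subseteq> h ` T" using CT C(3) by blast
    qed
    finally have im: "(h \<circ> q) ` p ` T = univ B" .
    have "(h \<circ> q) (\<lambda>n\<in>N. interp A s (map (\<lambda>f. f n) xs)) = interp B s (map (h \<circ> q) xs)"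
      if s: "s \<in> symbs A" and xs: "xs \<in> tuples (rank A s) (p ` T)" for s xs
    proof -
      obtain fs where fs: "fs \<in> tuples (rank A s) T" and xsp: "xs = map p fs"
        using lift[OF xs] by blast
      have "(\<lambda>n\<in>N. interp A s (map (\<lambda>f. f n) xs)) = p (\<lambda>k\<in>I. interp A s (map (\<lambda>f. f k) fs))"
        unfolding xsp by (rule pop[symmetric])
      then have "(h \<circ> q) (\<lambda>n\<in>N. interp A s (map (\<lambda>f. f n) xs))
          = h (\<lambda>k\<in>I. interp A s (map (\<lambda>f. f k) fs))"
        using qp[OF Top[OF s fs]] by simp
      also have "\<dots> = interp B s (map h fs)"
        using fs TU by (intro hop[OF s]) (auto simp: tuples_def)
      also have "map h fs = map (h \<circ> q) xs"
        using fs qp by (auto simp: xsp tuples_def)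
      finally show ?thesis .
    qed
    then show ?thesis using im sB rB by (simp add: surj_hom_def subalg_def power_alg_def)
  qed
  ultimately have "hsp_over N A B" using isB unfolding hsp_over_def by blast
  then show ?thesis unfolding HSP_def by blast
qed

section \<open>Congruences and polynomial operations\<close>

definition Con :: "('i, 'a) alg \<Rightarrow> ('a \<times> 'a) set set" where
  "Con A = {\<theta>. equiv (univ A) \<theta> \<and>
     (\<forall>s\<in>symbs A. \<forall>xs\<in>tuples (rank A s) (univ A). \<forall>ys\<in>tuples (rank A s) (univ A).
        list_all2 (\<lambda>x y. (x, y) \<in> \<theta>) xs ys \<longrightarrow> (interp A s xs, interp A s ys) \<in> \<theta>)}"

definition prime_quotient :: "('i, 'a) alg \<Rightarrow> ('a \<times> 'a) set \<Rightarrow> ('a \<times> 'a) set \<Rightarrow> bool" where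
  "prime_quotient A \<alpha> \<beta> \<longleftrightarrow> \<alpha> \<in> Con A \<and> \<beta> \<in> Con A \<and> \<alpha> \<subset> \<beta> \<and>
     \<not> (\<exists>\<gamma>\<in>Con A. \<alpha> \<subset> \<gamma> \<and> \<gamma> \<subset> \<beta>)"

definition quotient_alg :: "('i, 'a) alg \<Rightarrow> ('a \<times> 'a) set \<Rightarrow> ('i, 'a set) alg" where
  "quotient_alg A \<theta> = \<lparr>univ = univ A // \<theta>, symbs = symbs A, rank = rank A,
     interp = (\<lambda>s Xs. \<theta> `` {interp A s (map (\<lambda>X. SOME x. x \<in> X) Xs)})\<rparr>"

text \<open>
  Polynomial operations are kept extensional (undefined outside the tuples of the
  universe), so that clones can be compared as sets of functions.
\<close>

inductive_set Pol :: "('i, 'a) alg \<Rightarrow> nat \<Rightarrow> ('a list \<Rightarrow> 'a) set"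
  for A :: "('i, 'a) alg" and n :: nat where
  proj: "k < n \<Longrightarrow> (\<lambda>xs\<in>tuples n (univ A). xs ! k) \<in> Pol A n"
| const: "c \<in> univ A \<Longrightarrow> (\<lambda>xs\<in>tuples n (univ A). c) \<in> Pol A n"
| app: "s \<in> symbs A \<Longrightarrow> length gs = rank A s \<Longrightarrow> \<forall>g\<in>set gs. g \<in> Pol A n \<Longrightarrow>
    (\<lambda>xs\<in>tuples n (univ A). interp A s (map (\<lambda>g. g xs) gs)) \<in> Pol A n"

definition poly_equivalent :: "('i, 'a) alg \<Rightarrow> ('j, 'a) alg \<Rightarrow> bool" where
  "poly_equivalent A B \<longleftrightarrow> univ A = univ B \<and> (\<forall>n. Pol A n = Pol B n)"

text \<open>The induced algebra \<open>A|\<^sub>N\<close>; each basic operation is its own symbol, tagged by its rank.\<close>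

definition induced_alg :: "('i, 'a) alg \<Rightarrow> 'a set \<Rightarrow> (nat \<times> ('a list \<Rightarrow> 'a), 'a) alg" where
  "induced_alg A N = \<lparr>univ = N,
     symbs = {(n, restrict f (tuples n N)) | n f. f \<in> Pol A n \<and> (\<forall>xs\<in>tuples n N. f xs \<in> N)},
     rank = fst, interp = snd\<rparr>"

section \<open>Tame congruence theory\<close>

definition U_sets :: "('i, 'a) alg \<Rightarrow> ('a \<times> 'a) set \<Rightarrow> ('a \<times> 'a) set \<Rightarrow> 'a set set" where
  "U_sets A \<alpha> \<beta> = {(\<lambda>x. f [x]) ` univ A | f. f \<in> Pol A 1 \<and>
     (\<exists>(x, y)\<in>\<beta>. (f [x], f [y]) \<notin> \<alpha>)}"

definition minimal_sets :: "('i, 'a) alg \<Rightarrow> ('a \<times> 'a) set \<Rightarrow> ('a \<times> 'a) set \<Rightarrow> 'a set set" where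
  "minimal_sets A \<alpha> \<beta> = {U \<in> U_sets A \<alpha> \<beta>. \<forall>V\<in>U_sets A \<alpha> \<beta>. V \<subseteq> U \<longrightarrow> V = U}"

definition traces :: "('i, 'a) alg \<Rightarrow> ('a \<times> 'a) set \<Rightarrow> ('a \<times> 'a) set \<Rightarrow> 'a set set" where
  "traces A \<alpha> \<beta> = {N. \<exists>U\<in>minimal_sets A \<alpha> \<beta>. \<exists>x\<in>U. N = U \<inter> \<beta> `` {x} \<and> \<not> N \<times> N \<subseteq> \<alpha>}"

datatype tct_type =
    Type1_unary | Type2_affine | Type3_boolean | Type4_lattice | Type5_semilattice

definition perm_alg :: "'a set \<Rightarrow> ('a \<Rightarrow> 'a) set \<Rightarrow> ('a \<Rightarrow> 'a, 'a) alg" where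
  "perm_alg M G = \<lparr>univ = M, symbs = G, rank = (\<lambda>_. 1), interp = (\<lambda>g xs. g (hd xs))\<rparr>"

text \<open>A vector space with addition (symbol \<open>None\<close>) and multiplication by each scalar.\<close>

definition vector_space_alg :: "('k, 'm) ring_scheme \<Rightarrow> ('k, 'a, 'n) module_scheme \<Rightarrow> ('k option, 'a) alg"
  where
  "vector_space_alg K V = \<lparr>univ = carrier V, symbs = insert None (Some ` carrier K),
     rank = (\<lambda>s. case s of None \<Rightarrow> 2 | Some _ \<Rightarrow> 1),
     interp = (\<lambda>s xs. case s of None \<Rightarrow> (xs ! 0) \<oplus>\<^bsub>V\<^esub> (xs ! 1) | Some c \<Rightarrow> c \<odot>\<^bsub>V\<^esub> (xs ! 0))\<rparr>"

datatype two_symb = Meet | Join | Compl | Bot | Top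

text \<open>The reduct to \<open>S\<close> of the Boolean algebra \<open>{z < u}\<close>.\<close>

definition two_elt_alg :: "two_symb set \<Rightarrow> 'a \<Rightarrow> 'a \<Rightarrow> (two_symb, 'a) alg" where
  "two_elt_alg S z u = \<lparr>univ = {z, u}, symbs = S,
     rank = (\<lambda>s. case s of Meet \<Rightarrow> 2 | Join \<Rightarrow> 2 | Compl \<Rightarrow> 1 | Bot \<Rightarrow> 0 | Top \<Rightarrow> 0),
     interp = (\<lambda>s xs. case s of
         Meet \<Rightarrow> if xs ! 0 = u \<and> xs ! 1 = u then u else z
       | Join \<Rightarrow> if xs ! 0 = z \<and> xs ! 1 = z then z else u
       | Compl \<Rightarrow> if xs ! 0 = z then u else z
       | Bot \<Rightarrow> z
       | Top \<Rightarrow> u)\<rparr>"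

text \<open>
  The types of minimal algebras.  Every finite field has an isomorphic copy on a set of
  natural numbers, so scalars of type \<open>nat\<close> suffice.
\<close>

fun minimal_alg_type :: "('i, 'a) alg \<Rightarrow> tct_type \<Rightarrow> bool" where
  "minimal_alg_type M Type1_unary \<longleftrightarrow>
     (\<exists>G. subgroup G (BijGroup (univ M)) \<and> poly_equivalent M (perm_alg (univ M) G))"
| "minimal_alg_type M Type2_affine \<longleftrightarrow>
     (\<exists>(K :: nat ring) (V :: (nat, 'a) module). field K \<and> finite (carrier K) \<and> module K V \<and>
        poly_equivalent M (vector_space_alg K V))"
| "minimal_alg_type M Type3_boolean \<longleftrightarrow>
     (\<exists>z u. z \<noteq> u \<and> poly_equivalent M (two_elt_alg {Meet, Join, Compl, Bot, Top} z u))"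
| "minimal_alg_type M Type4_lattice \<longleftrightarrow>
     (\<exists>z u. z \<noteq> u \<and> poly_equivalent M (two_elt_alg {Meet, Join} z u))"
| "minimal_alg_type M Type5_semilattice \<longleftrightarrow>
     (\<exists>z u. z \<noteq> u \<and> poly_equivalent M (two_elt_alg {Meet} z u))"

text \<open>
  The type of a prime quotient is that of \<open>(A|\<^sub>N)/(\<alpha>|\<^sub>N)\<close> for a trace \<open>N\<close>.  By tame congruence
  theory traces exist and all give the same type.
\<close>

definition has_quotient_type :: "('i, 'a) alg \<Rightarrow> ('a \<times> 'a) set \<Rightarrow> ('a \<times> 'a) set \<Rightarrow> tct_type \<Rightarrow> bool" where
  "has_quotient_type A \<alpha> \<beta> t \<longleftrightarrow>
     (\<exists>N\<in>traces A \<alpha> \<beta>. minimal_alg_type (quotient_alg (induced_alg A N) (\<alpha> \<inter> N \<times> N)) t)"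

definition typ_class :: "('i, 'a) alg set \<Rightarrow> tct_type set" where
  "typ_class \<V> = {t. \<exists>C\<in>\<V>. \<exists>\<alpha> \<beta>. finite (univ C) \<and> prime_quotient C \<alpha> \<beta> \<and> has_quotient_type C \<alpha> \<beta> t}"

text \<open>
  \<open>typ{V(A)}\<close>.  Every finite algebra has an isomorphic copy whose universe is a set of natural
  numbers, so it suffices to let \<open>C\<close> range over the members of \<open>V(A)\<close> of that kind.
\<close>

definition typ_variety :: "('i, 'a) alg \<Rightarrow> tct_type set" where
  "typ_variety A = typ_class (HSP A :: ('i, nat) alg set)"

section \<open>Finite algebras given by operation tables\<close>

text \<open>
  A presentation \<open>(n, [(k\<^sub>0, t\<^sub>0), \<dots>])\<close> stands for the algebra with universe \<open>{0, \<dots>, n - 1}\<close> whose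
  \<open>i\<close>th basic operation has rank \<open>k\<^sub>i\<close> and lists its values, in lexicographic order of the
  arguments, in the table \<open>t\<^sub>i\<close> of length \<open>n ^ k\<^sub>i\<close>.
\<close>

type_synonym presentation = "nat \<times> (nat \<times> nat list) list"

definition table_index :: "nat \<Rightarrow> nat list \<Rightarrow> nat" where
  "table_index n xs = foldl (\<lambda>a x. a * n + x) 0 xs"

fun valid_presentation :: "presentation \<Rightarrow> bool" where
  "valid_presentation (n, ts) \<longleftrightarrow>
     n > 0 \<and> (\<forall>(k, t)\<in>set ts. length t = n ^ k \<and> (\<forall>y\<in>set t. y < n))"

fun table_alg :: "presentation \<Rightarrow> (nat, nat) alg" where
  "table_alg (n, ts) = \<lparr>univ = {..<n}, symbs = {..<length ts}, rank = (\<lambda>i. fst (ts ! i)),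
     interp = (\<lambda>i xs. snd (ts ! i) ! table_index n xs)\<rparr>"

lemma table_index_less:
  assumes "set xs \<subseteq> {..<n}" shows "table_index n xs < n ^ length xs"
  using assms
proof (induction xs rule: rev_induct)
  case (snoc x xs)
  then have "table_index n xs + 1 \<le> n ^ length xs" and "x < n" by auto
  then have "(table_index n xs + 1) * n \<le> n ^ length xs * n" by (intro mult_right_mono) auto
  then show ?case using \<open>x < n\<close> by (simp add: table_index_def algebra_simps)
qed (simp add: table_index_def)

lemma is_alg_table_alg:
  assumes "valid_presentation P" shows "is_alg (table_alg P)"
proof -
  obtain n ts where P: "P = (n, ts)" by force
  have "snd (ts ! i) ! table_index n xs < n"
    if "i < length ts" "length xs = fst (ts ! i)" "set xs \<subseteq> {..<n}" for i xs
  proof -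
    have "ts ! i \<in> set ts" using that by simp
    then have "length (snd (ts ! i)) = n ^ fst (ts ! i)" "\<forall>y\<in>set (snd (ts ! i)). y < n"
      using assms by (auto simp: P case_prod_beta)
    then show ?thesis using table_index_less[OF that(3)] that(2) nth_mem by metis
  qed
  then show ?thesis using assms
    by (auto simp: P is_alg_def closed_under_def tuples_def lessThan_empty_iff)
qed

text \<open>Inputs are words over \<open>{1, 2}\<close>: numbers in unary, each terminated by the letter \<open>2\<close>.\<close>

definition unary :: "nat \<Rightarrow> nat list" where
  "unary x = replicate x 1 @ [2]"

fun encode :: "presentation \<Rightarrow> nat list" where
  "encode (n, ts) = concat (map unary (n # concat (map (\<lambda>(k, t). k # t) ts)))"

lemma unary_append_eq: "unary x @ v = unary y @ w \<Longrightarrow> x = y \<and> v = w"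
proof (induction x arbitrary: y)
  case 0 then show ?case by (cases y) (auto simp: unary_def)
next
  case (Suc x) then show ?case by (cases y) (auto simp: unary_def)
qed

lemma concat_unary_inj: "concat (map unary xs) = concat (map unary ys) \<Longrightarrow> xs = ys"
proof (induction xs arbitrary: ys)
  case Nil then show ?case by (cases ys) (auto simp: unary_def)
next
  case (Cons x xs)
  note IH = Cons.IH and prems = Cons.prems
  show ?case
  proof (cases ys)
    case Nil then show ?thesis using prems by (simp add: unary_def)
  next
    case (Cons y zs)
    have "x = y \<and> concat (map unary xs) = concat (map unary zs)"
      using prems Cons by (intro unary_append_eq) simp
    then show ?thesis using IH Cons by simp
  qed
qed

lemma inj_on_encode: "inj_on encode {P. valid_presentation P}"
proof -
  have tables: "ts = ts'"
    if "concat (map (\<lambda>(k, t). k # t) ts) = concat (map (\<lambda>(k, t). k # t) ts')"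
      "\<forall>(k, t)\<in>set ts. length t = n ^ k" "\<forall>(k, t)\<in>set ts'. length t = n ^ k"
    for n :: nat and ts ts' :: "(nat \<times> nat list) list"
    using that
  proof (induction ts arbitrary: ts')
    case Nil then show ?case by (cases ts') auto
  next
    case (Cons a ts) then show ?case by (cases ts') auto
  qed
  show ?thesis
  proof (rule inj_onI)
    fix P Q assume *: "P \<in> {P. valid_presentation P}" "Q \<in> {P. valid_presentation P}"
      "encode P = encode Q"
    obtain n ts m us where PQ: "P = (n, ts)" "Q = (m, us)" by (metis surj_pair)
    have "n # concat (map (\<lambda>(k, t). k # t) ts) = m # concat (map (\<lambda>(k, t). k # t) us)"
      using * concat_unary_inj by (metis PQ encode.simps)
    then show "P = Q" using * tables[of ts us n] by (auto simp: PQ)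
  qed
qed

section \<open>Turing machines\<close>

text \<open>
  Deterministic machines with one two-way infinite tape.  States and tape symbols are natural
  numbers; only finitely many occur in a program, which is a finite list of instructions
  \<open>((state, scanned symbol), (new state, written symbol, move))\<close>.  The first instruction whose
  left-hand side matches is executed; the machine halts when there is none.  Symbol \<open>0\<close> is the blank.
\<close>

datatype move = Move_left | Stay | Move_right

type_synonym tm = "((nat \<times> nat) \<times> (nat \<times> nat \<times> move)) list"

type_synonym config = "nat \<times> int \<times> (int \<Rightarrow> nat)"

fun offset :: "move \<Rightarrow> int" where
  "offset Move_left = - 1"
| "offset Stay = 0"
| "offset Move_right = 1"

fun tm_step :: "tm \<Rightarrow> config \<Rightarrow> config option" where
  "tm_step M (q, p, T) = (case map_of M (q, T p) of
      None \<Rightarrow> None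
    | Some (q', s, d) \<Rightarrow> Some (q', p + offset d, T(p := s)))"

definition start_state :: nat where "start_state = 0"
definition accept_state :: nat where "accept_state = 1"
definition reject_state :: nat where "reject_state = 2"

definition initial_config :: "nat list \<Rightarrow> config" where
  "initial_config w =
     (start_state, 0, \<lambda>i. if 0 \<le> i \<and> i < int (length w) then w ! nat i else 0)"

definition halts_in :: "tm \<Rightarrow> nat list \<Rightarrow> nat \<Rightarrow> bool" where
  "halts_in M w q \<longleftrightarrow> (\<exists>p T. (initial_config w, (q, p, T)) \<in> {(c, c'). tm_step M c = Some c'}\<^sup>* \<and>
     tm_step M (q, p, T) = None)"

text \<open>
  The problem, for instances \<open>x \<in> D\<close> written as words \<open>enc x\<close>, whether \<open>Q x\<close> holds.  Nothing is
  required of the machine on words that are not codes of instances.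
\<close>

definition decides :: "tm \<Rightarrow> ('x \<Rightarrow> nat list) \<Rightarrow> 'x set \<Rightarrow> ('x \<Rightarrow> bool) \<Rightarrow> bool" where
  "decides M enc D Q \<longleftrightarrow>
     (\<forall>x\<in>D. halts_in M (enc x) (if Q x then accept_state else reject_state))"

definition undecidable :: "('x \<Rightarrow> nat list) \<Rightarrow> 'x set \<Rightarrow> ('x \<Rightarrow> bool) \<Rightarrow> bool" where
  "undecidable enc D Q \<longleftrightarrow> \<not> (\<exists>M. decides M enc D Q)"

end

theory Submission
  imports Defs
begin

text \<open>
  A unit machine acts on any number \<open>k\<close> of units at once; each step changes a symbol on every unit and
  treats one unit differently from all others.  It is coded by an algebra whose powers hold the units as
  coordinates.  One operation writes a lattice term in truth values onto a coordinate, and the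
  result becomes readable only after exactly one gate has met it; another operation exchanges two
  given tuples, but only on coordinates whose symbol is used up.  If for some \<open>k\<close> no run uses up
  all \<open>k\<close> units, the exchange is inert in a suitable quotient of a subpower, which then has the
  type of a lattice.  If for every \<open>k\<close> some run uses up all units, every trace on which
  the polynomials could be those of a lattice admits a polynomial that exchanges its two classes,
  which is not monotone.  So type \<open>4\<close> occurs iff the runs are bounded.

  A counter machine whose counters are numbers of units is a unit machine, and its runs are bounded iff it
  stops.  Given a Turing machine that decides the problem, let a counter machine first load its own code,
  compute from it the tables of its own algebra, run the Turing machine on them, and stop iff the
  answer is that type \<open>4\<close> does not occur: the answer is wrong.
\<close>

text \<open>The quotient that carries a trace is arbitrary, so nothing is computed in it. Its meet
  polynomial is lifted to the subpower and watched at the four argument pairs formed from two tuples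
  \<open>z\<close>, \<open>u\<close>. Once varying values contain no gates, both arguments can be
  mixed only by the writing operations. That is why a written value is not readable at once: it must
  pass gates first, so it acquires a history, and exactly one touching gate per live coordinate
  turns the gates of any history, whatever their number, into units. The exchange refers to two
  prescribed tuples instead of negating, because the tuples may agree or be dead in places, where
  negation would not interchange them. In the other direction the gates of a suitable subpower are
  exactly the \<open>k\<close> units of runs that cannot be completed. The self-reference needs no
  recursion theorem: the loading states are not part of the coded program but are read off from the
  pair \<open>(e, b)\<close>, so \<open>e\<close> codes a fixed program and the length of the loader
  causes no circularity.\<close>

lemma Pol_mem:
  assumes "f \<in> Pol A n" "is_alg A" "xs \<in> tuples n (univ A)"
  shows "f xs \<in> univ A"
  using assms
proof (induction f rule: Pol.induct)
  case (app s gs)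
  have "map (\<lambda>g. g xs) gs \<in> tuples (rank A s) (univ A)"
    using app by (auto simp: tuples_def)
  then have "interp A s (map (\<lambda>g. g xs) gs) \<in> univ A"
    using app by (auto simp: is_alg_def closed_under_def)
  then show ?case using app.prems by simp
qed (auto simp: tuples_def)

lemma Pol_ext:
  assumes "f \<in> Pol A n"
  shows "restrict f (tuples n (univ A)) = f"
  using assms by (induction rule: Pol.induct) auto

lemma Pol_comp:
  assumes "f \<in> Pol A k" "is_alg A" "length gs = k" "\<forall>g\<in>set gs. g \<in> Pol A n"
  shows "(\<lambda>xs\<in>tuples n (univ A). f (map (\<lambda>g. g xs) gs)) \<in> Pol A n"
  using assms(1)
proof (induction f rule: Pol.induct)
  have tup: "map (\<lambda>g. g xs) gs \<in> tuples k (univ A)" if "xs \<in> tuples n (univ A)" for xs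
    using that assms(3,4) Pol_mem[OF _ assms(2) that] by (auto simp: tuples_def)
  {
    case (proj j)
    have "(\<lambda>xs\<in>tuples n (univ A). (\<lambda>xs\<in>tuples k (univ A). xs ! j) (map (\<lambda>g. g xs) gs))
        = restrict (gs ! j) (tuples n (univ A))"
      using tup proj assms(3) by (intro restrict_ext) auto
    then show ?case using Pol_ext[of "gs ! j" A n] assms proj by simp
  next
    case (const c)
    have "(\<lambda>xs\<in>tuples n (univ A). (\<lambda>xs\<in>tuples k (univ A). c) (map (\<lambda>g. g xs) gs))
        = (\<lambda>xs\<in>tuples n (univ A). c)"
      using tup by (intro restrict_ext) auto
    then show ?case using Pol.const[OF const] by (simp only:)
  next
    case (app s fs)
    let ?hs = "map (\<lambda>f. \<lambda>xs\<in>tuples n (univ A). f (map (\<lambda>g. g xs) gs)) fs"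
    have "(\<lambda>xs\<in>tuples n (univ A). (\<lambda>xs\<in>tuples k (univ A). interp A s (map (\<lambda>g. g xs) fs)) (map (\<lambda>g. g xs) gs))
       = (\<lambda>xs\<in>tuples n (univ A). interp A s (map (\<lambda>h. h xs) ?hs))"
      using tup by (intro restrict_ext) (auto simp: o_def)
    moreover have "(\<lambda>xs\<in>tuples n (univ A). interp A s (map (\<lambda>h. h xs) ?hs)) \<in> Pol A n"
      using app by (intro Pol.app) (auto simp del: restrict_apply)
    ultimately show ?case by (simp only:)
  }
qed

lemma Pol_congruence:
  assumes "f \<in> Pol A n" "is_alg A" "\<theta> \<in> Con A" "xs \<in> tuples n (univ A)" "ys \<in> tuples n (univ A)"
    "list_all2 (\<lambda>x y. (x, y) \<in> \<theta>) xs ys"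
  shows "(f xs, f ys) \<in> \<theta>"
  using assms(1)
proof (induction f rule: Pol.induct)
  case (proj k)
  then show ?case using assms by (auto simp: list_all2_conv_all_nth tuples_def)
next
  case (const c)
  then show ?case using assms by (auto simp: Con_def equiv_def refl_on_def)
next
  case (app s gs)
  have "map (\<lambda>g. g zs) gs \<in> tuples (rank A s) (univ A)" if "zs \<in> tuples n (univ A)" for zs
    using app that Pol_mem[OF _ assms(2)] by (auto simp: tuples_def)
  moreover have "list_all2 (\<lambda>x y. (x, y) \<in> \<theta>) (map (\<lambda>g. g xs) gs) (map (\<lambda>g. g ys) gs)"
    using app by (auto simp: list_all2_conv_all_nth)
  ultimately show ?case using assms(3-5) app by (simp add: Con_def)
qed

text \<open>The values that polynomials take along a family of argument lists indexed by \<open>'p\<close>: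
  the subalgebra of the power \<open>A\<^sup>p\<close> generated by \<open>X\<close> and the diagonal.\<close>

inductive_set Vals :: "('i, 'a) alg \<Rightarrow> ('p \<Rightarrow> 'a) set \<Rightarrow> ('p \<Rightarrow> 'a) set"
  for A :: "('i, 'a) alg" and X :: "('p \<Rightarrow> 'a) set" where
  gen: "\<phi> \<in> X \<Longrightarrow> \<phi> \<in> Vals A X"
| const: "c \<in> univ A \<Longrightarrow> (\<lambda>_. c) \<in> Vals A X"
| app: "s \<in> symbs A \<Longrightarrow> length fs = rank A s \<Longrightarrow> \<forall>f\<in>set fs. f \<in> Vals A X \<Longrightarrow>
    (\<lambda>p. interp A s (map (\<lambda>f. f p) fs)) \<in> Vals A X"

lemma Vals_mem:
  assumes "\<phi> \<in> Vals A X" "is_alg A" "\<forall>x\<in>X. \<forall>p. x p \<in> univ A"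
  shows "\<phi> p \<in> univ A"
  using assms
proof (induction rule: Vals.induct)
  case (app s fs)
  have "map (\<lambda>f. f p) fs \<in> tuples (rank A s) (univ A)"
    using app by (auto simp: tuples_def)
  then show ?case using app by (auto simp: is_alg_def closed_under_def)
qed auto

lemma Vals_of_Pol:
  assumes "f \<in> Pol A n" "is_alg A" "length xs = n" "\<forall>x\<in>set xs. \<forall>p. x p \<in> univ A"
  shows "(\<lambda>p. f (map (\<lambda>x. x p) xs)) \<in> Vals A (set xs)"
  using assms(1)
proof (induction f rule: Pol.induct)
  have tup: "map (\<lambda>x. x p) xs \<in> tuples n (univ A)" for p
    using assms by (auto simp: tuples_def)
  {
    case (proj k)
    then show ?case using tup assms by (auto intro!: Vals.gen)
  next
    case (const c)
    then show ?case using tup by (auto intro!: Vals.const)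
  next
    case (app s gs)
    have "(\<lambda>p. interp A s (map (\<lambda>f. f p) (map (\<lambda>g p. g (map (\<lambda>x. x p) xs)) gs))) \<in> Vals A (set xs)"
      by (rule Vals.app) (use app in auto)
    then show ?case using tup by (simp add: o_def)
  }
qed

lemma Pol_of_Vals:
  assumes "\<phi> \<in> Vals A (set xs)" "\<forall>x\<in>set xs. \<forall>p. x p \<in> univ A"
  shows "\<exists>f\<in>Pol A (length xs). \<forall>p. \<phi> p = f (map (\<lambda>x. x p) xs)"
  using assms(1)
proof (induction rule: Vals.induct)
  have tup: "map (\<lambda>x. x p) xs \<in> tuples (length xs) (univ A)" for p
    using assms by (auto simp: tuples_def)
  {
    case (gen \<phi>)
    then obtain k where "k < length xs" "\<phi> = xs ! k" by (auto simp: in_set_conv_nth)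
    then show ?case using tup by (intro bexI[OF _ Pol.proj[of k]]) auto
  next
    case (const c)
    then show ?case using tup by (intro bexI[OF _ Pol.const[of c]]) auto
  next
    case (app s fs)
    then obtain F where F: "\<forall>f\<in>set fs. F f \<in> Pol A (length xs) \<and> (\<forall>p. f p = F f (map (\<lambda>x. x p) xs))"
      by metis
    then have "(\<lambda>ys\<in>tuples (length xs) (univ A). interp A s (map (\<lambda>g. g ys) (map F fs))) \<in> Pol A (length xs)"
      using app by (intro Pol.app) auto
    moreover have "map (\<lambda>f. f p) fs = map (\<lambda>f. F f (map (\<lambda>x. x p) xs)) fs" for p
      using F by auto
    ultimately show ?case using tup by (intro bexI) (auto simp: o_def simp del: map_eq_conv)
  }
qed

lemma Vals_Vals:
  assumes "\<phi> \<in> Vals A Y" "Y \<subseteq> Vals A X"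
  shows "\<phi> \<in> Vals A X"
  using assms by (induction rule: Vals.induct) (auto intro: Vals.intros)

lemma Vals_reindex:
  assumes "\<phi> \<in> Vals A X" "\<forall>x\<in>X. x \<circ> r \<in> Y"
  shows "\<phi> \<circ> r \<in> Vals A Y"
  using assms
proof (induction rule: Vals.induct)
  case (app s fs)
  have "(\<lambda>p. interp A s (map (\<lambda>f. f p) (map (\<lambda>f. f \<circ> r) fs))) \<in> Vals A Y"
    by (rule Vals.app) (use app in \<open>auto simp: o_def\<close>)
  then show ?case by (simp add: o_def)
qed (auto intro: Vals.gen simp: o_def Vals.const)

text \<open>Carries an exchange found in the subpower down to a polynomial of its quotient.\<close>

lemma Vals_hom_image:
  assumes "\<phi> \<in> Vals B X" "surj_hom B C h" "is_alg B" "\<forall>x\<in>X. \<forall>p. x p \<in> univ B"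
  shows "h \<circ> \<phi> \<in> Vals C ((\<lambda>x. h \<circ> x) ` X)"
  using assms(1)
proof (induction rule: Vals.induct)
  case (const c)
  then have "h c \<in> univ C" using assms(2) by (auto simp: surj_hom_def)
  then show ?case using Vals.const by (simp add: o_def)
next
  case (app s fs)
  have "map (\<lambda>f. f p) fs \<in> tuples (rank B s) (univ B)" for p
    using app Vals_mem[OF _ assms(3,4)] by (auto simp: tuples_def)
  then have "h (interp B s (map (\<lambda>f. f p) fs)) = interp C s (map (\<lambda>f. f p) (map (\<lambda>f. h \<circ> f) fs))" for p
    using assms(2) app by (simp add: surj_hom_def o_def)
  moreover have "(\<lambda>p. interp C s (map (\<lambda>f. f p) (map (\<lambda>f. h \<circ> f) fs))) \<in> Vals C ((\<lambda>x. h \<circ> x) ` X)"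
    by (rule Vals.app) (use app assms(2) in \<open>auto simp: surj_hom_def o_def\<close>)
  ultimately show ?case by (simp add: o_def)
qed (auto intro: Vals.gen)

text \<open>Constants of \<open>C\<close> have preimages because \<open>h\<close> is onto, so a
  polynomial of the quotient is traced back operation by operation. This brings the meet of a trace
  up to the subpower.\<close>

lemma Vals_hom_lift:
  assumes "\<psi> \<in> Vals C ((\<lambda>x. h \<circ> x) ` X)" "surj_hom B C h" "is_alg B" "\<forall>x\<in>X. \<forall>p. x p \<in> univ B"
  shows "\<exists>\<phi>\<in>Vals B X. \<psi> = h \<circ> \<phi>"
  using assms(1)
proof (induction rule: Vals.induct)
  case (gen \<psi>)
  then show ?case by (auto intro: Vals.gen)
next
  case (const c)
  then obtain b where "b \<in> univ B" "c = h b" using assms(2) unfolding surj_hom_def by blast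
  then show ?case by (intro bexI[OF _ Vals.const[of b]]) auto
next
  case (app s fs)
  have sB: "s \<in> symbs B" "rank C s = rank B s" using app(1) assms(2) by (auto simp: surj_hom_def)
  obtain F where F: "\<forall>f\<in>set fs. F f \<in> Vals B X \<and> f = h \<circ> F f"
    using app by metis
  have "(\<lambda>p. interp B s (map (\<lambda>f. f p) (map F fs))) \<in> Vals B X"
    by (rule Vals.app) (use F sB app in auto)
  moreover have "interp C s (map (\<lambda>f. f p) fs) = h (interp B s (map (\<lambda>f. f p) (map F fs)))" for p
  proof -
    have "map (\<lambda>f. f p) (map F fs) \<in> tuples (rank B s) (univ B)"
      using F app sB Vals_mem[OF _ assms(3,4)] by (auto simp: tuples_def)
    then have "h (interp B s (map (\<lambda>f. f p) (map F fs))) = interp C s (map h (map (\<lambda>f. f p) (map F fs)))"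
      using assms(2) sB by (simp add: surj_hom_def)
    also have "map h (map (\<lambda>f. f p) (map F fs)) = map (\<lambda>f. f p) fs"
      using F by (auto simp: fun_eq_iff)
    finally show ?thesis by simp
  qed
  ultimately show ?case by (auto simp: fun_eq_iff)
qed

lemma is_alg_subpower:
  assumes "subuniverse (power_alg I A) U"
  shows "is_alg (subalg (power_alg I A) U)"
  using assms by (auto simp: is_alg_def subuniverse_def subalg_def closed_under_def)

section \<open>Minimal sets\<close>

text \<open>The composite of two polynomials that do not collapse \<open>\<beta>\<close> into \<open>\<alpha>\<close> can be bridged by a third;
  otherwise the pairs that \<open>f\<close> always collapses would form a congruence strictly between.\<close>

lemma prime_quotient_bridge:
  assumes alg: "is_alg A" and pq: "prime_quotient A \<alpha> \<beta>" and f: "f \<in> Pol A 1"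
    and xy: "(x, y) \<in> \<beta>" "(f [x], f [y]) \<notin> \<alpha>" and uv: "(u, v) \<in> \<beta>" "(u, v) \<notin> \<alpha>"
  shows "\<exists>g\<in>Pol A 1. (f [g [u]], f [g [v]]) \<notin> \<alpha>"
proof (rule ccontr)
  assume none: "\<not> ?thesis"
  \<comment> \<open>The pairs of \<beta> that \<open>f\<close> after a unary polynomial never
    separates modulo \<alpha>. It contains \<open>(u, v)\<close> if no bridge exists, and it omits
    \<open>(x, y)\<close> because of the identity polynomial.\<close>
  define \<mu> where "\<mu> = {(a, b) \<in> \<beta>. \<forall>g\<in>Pol A 1. (f [g [a]], f [g [b]]) \<in> \<alpha>}"
  have con: "\<alpha> \<in> Con A" "\<beta> \<in> Con A" and ab: "\<alpha> \<subset> \<beta>" using pq by (auto simp: prime_quotient_def)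
  have eqa: "equiv (univ A) \<alpha>" and eqb: "equiv (univ A) \<beta>" using con by (auto simp: Con_def)
  have bU: "\<beta> \<subseteq> univ A \<times> univ A" using eqb unfolding equiv_def by blast
  have t1: "[a] \<in> tuples 1 (univ A)" if "a \<in> univ A" for a using that by (auto simp: tuples_def)
  have gmem: "g [a] \<in> univ A" if "g \<in> Pol A 1" "a \<in> univ A" for g a
    using Pol_mem[OF that(1) alg t1[OF that(2)]] .
  have "\<alpha> \<subseteq> \<mu>"
  proof clarify
    fix a b assume "(a, b) \<in> \<alpha>"
    moreover have "(f [g [a]], f [g [b]]) \<in> \<alpha>" if "g \<in> Pol A 1" for g
    proof -
      have "a \<in> univ A" "b \<in> univ A" using bU ab \<open>(a, b) \<in> \<alpha>\<close> by auto
      moreover have "(g [a], g [b]) \<in> \<alpha>"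
        using Pol_congruence[OF that alg con(1)] t1 calculation \<open>(a, b) \<in> \<alpha>\<close> by auto
      ultimately show ?thesis
        using Pol_congruence[OF f alg con(1)] t1 gmem that by auto
    qed
    ultimately show "(a, b) \<in> \<mu>" using ab by (auto simp: \<mu>_def)
  qed
  moreover have "\<mu> \<in> Con A"
    unfolding Con_def
  proof (intro CollectI conjI ballI impI)
    show "equiv (univ A) \<mu>"
    proof (rule equivI)
      show "\<mu> \<subseteq> univ A \<times> univ A" using bU by (auto simp: \<mu>_def)
      show "refl_on (univ A) \<mu>"
        using eqa eqb f gmem Pol_mem[OF f alg t1]
        by (auto simp: refl_on_def \<mu>_def equiv_def)
      show "sym \<mu>" using eqa eqb by (auto simp: sym_def \<mu>_def equiv_def)
      show "trans \<mu>"
      proof (rule transI)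
        fix a b c assume "(a, b) \<in> \<mu>" "(b, c) \<in> \<mu>"
        then show "(a, c) \<in> \<mu>" using eqa eqb unfolding \<mu>_def equiv_def trans_def by blast
      qed
    qed
  next
    fix s xs ys
    assume s: "s \<in> symbs A" and xs: "xs \<in> tuples (rank A s) (univ A)"
      and ys: "ys \<in> tuples (rank A s) (univ A)" and l: "list_all2 (\<lambda>x y. (x, y) \<in> \<mu>) xs ys"
    have len: "length xs = rank A s" "length ys = rank A s" using xs ys by (auto simp: tuples_def)
    \<comment> \<open>Arguments are changed one at a time, so that each single change is the action
      of a unary polynomial.\<close>
    define w where "w j = take j ys @ drop j xs" for j
    have wt: "w j \<in> tuples (rank A s) (univ A)" for j
      using xs ys set_take_subset[of j ys] set_drop_subset[of j xs]
      by (auto simp: w_def tuples_def)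
    have ints: "interp A s zs \<in> univ A" if "zs \<in> tuples (rank A s) (univ A)" for zs
      using alg s that by (auto simp: is_alg_def closed_under_def)
    have "(f [g [interp A s xs]], f [g [interp A s ys]]) \<in> \<alpha>" if g: "g \<in> Pol A 1" for g
    proof -
      have "(f [g [interp A s (w 0)]], f [g [interp A s (w j)]]) \<in> \<alpha>" if "j \<le> rank A s" for j
        using that
      proof (induction j)
        case 0
        then show ?case using eqa Pol_mem[OF f alg t1] gmem[OF g] ints[OF wt] by (auto simp: equiv_def refl_on_def)
      next
        case (Suc j)
        define G where "G i = (if i < j then (\<lambda>zs\<in>tuples 1 (univ A). ys ! i) else if i = j then
            (\<lambda>zs\<in>tuples 1 (univ A). zs ! 0) else (\<lambda>zs\<in>tuples 1 (univ A). xs ! i))" for i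
        have Gp: "G i \<in> Pol A 1" if "i < rank A s" for i
          using that len xs ys unfolding G_def tuples_def[of "rank A s"]
          by (auto intro!: Pol.const Pol.proj)
        define h where "h = (\<lambda>zs\<in>tuples 1 (univ A). interp A s (map (\<lambda>g. g zs) (map G [0..<rank A s])))"
        have hP: "h \<in> Pol A 1" unfolding h_def using s Gp by (intro Pol.app) auto
        have jl: "j < rank A s" using Suc by simp
        have xj: "xs ! j \<in> univ A" "ys ! j \<in> univ A" using jl len xs ys by (auto simp: tuples_def)
        have "map (\<lambda>g. g [xs ! j]) (map G [0..<rank A s]) = w j"
          using jl len t1[OF xj(1)] by (intro nth_equalityI) (auto simp: w_def G_def nth_append min_def)
        then have h1: "h [xs ! j] = interp A s (w j)" using t1[OF xj(1)] by (simp add: h_def)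
        have "map (\<lambda>g. g [ys ! j]) (map G [0..<rank A s]) = w (Suc j)"
          using jl len t1[OF xj(2)]
          by (intro nth_equalityI) (auto simp: w_def G_def nth_append min_def less_Suc_eq)
        then have h2: "h [ys ! j] = interp A s (w (Suc j))" using t1[OF xj(2)] by (simp add: h_def)
        have "(xs ! j, ys ! j) \<in> \<mu>" using l jl len by (auto simp: list_all2_conv_all_nth)
        moreover have "(\<lambda>zs\<in>tuples 1 (univ A). g (map (\<lambda>g. g zs) [h])) \<in> Pol A 1"
          using Pol_comp[OF g alg, of "[h]" 1] hP by simp
        ultimately have "(f [(\<lambda>zs\<in>tuples 1 (univ A). g (map (\<lambda>g. g zs) [h])) [xs ! j]],
            f [(\<lambda>zs\<in>tuples 1 (univ A). g (map (\<lambda>g. g zs) [h])) [ys ! j]]) \<in> \<alpha>"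
          unfolding \<mu>_def by blast
        then have "(f [g [interp A s (w j)]], f [g [interp A s (w (Suc j))]]) \<in> \<alpha>"
          using h1 h2 t1[OF xj(1)] t1[OF xj(2)] by simp
        then show ?case using Suc eqa unfolding equiv_def trans_def by (meson Suc_leD)
      qed
      from this[of "rank A s"] show ?thesis by (simp add: w_def len)
    qed
    moreover have "(interp A s xs, interp A s ys) \<in> \<beta>"
    proof -
      have "list_all2 (\<lambda>x y. (x, y) \<in> \<beta>) xs ys"
        using l by (rule list_all2_mono) (auto simp: \<mu>_def)
      then show ?thesis using con(2) s xs ys by (auto simp: Con_def)
    qed
    ultimately show "(interp A s xs, interp A s ys) \<in> \<mu>" by (auto simp: \<mu>_def)
  qed
  moreover have "(u, v) \<in> \<mu>" using none uv by (auto simp: \<mu>_def)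
  moreover have "(x, y) \<notin> \<mu>"
  proof
    assume "(x, y) \<in> \<mu>"
    moreover have "(\<lambda>xs\<in>tuples 1 (univ A). xs ! 0) \<in> Pol A 1" by (rule Pol.proj) simp
    ultimately have "(f [(\<lambda>xs\<in>tuples 1 (univ A). xs ! 0) [x]], f [(\<lambda>xs\<in>tuples 1 (univ A). xs ! 0) [y]]) \<in> \<alpha>"
      unfolding \<mu>_def by blast
    moreover have "x \<in> univ A" "y \<in> univ A" using xy(1) bU by auto
    ultimately show False using xy(2) t1 by simp
  qed
  moreover have "\<mu> \<subseteq> \<beta>" by (auto simp: \<mu>_def)
  ultimately show False using pq uv xy(1) unfolding prime_quotient_def by blast
qed

text \<open>Two different powers of \<open>k\<close> agree on \<open>U\<close> by the pigeonhole
  principle, and injectivity allows the smaller one to be cancelled.\<close>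

lemma finite_surj_funpow_id:
  assumes "finite U" "k ` U = U"
  shows "\<exists>m>0. \<forall>x\<in>U. (k ^^ m) x = x"
proof -
  have inj: "inj_on k U" using assms by (simp add: finite_surj_inj)
  have closed: "(k ^^ i) x \<in> U" if "x \<in> U" for i x
    using that assms(2) by (induction i) auto
  have inj_pow: "inj_on (k ^^ i) U" for i
  proof (induction i)
    case (Suc i)
    show ?case
      using Suc inj closed unfolding inj_on_def by simp
  qed simp
  let ?r = "\<lambda>i::nat. restrict (k ^^ i) U"
  have "range ?r \<subseteq> U \<rightarrow>\<^sub>E U" using closed by auto
  then have "finite (range ?r)" using finite_PiE[OF assms(1)] assms(1) finite_subset by metis
  then have "\<not> inj ?r" using finite_imageD infinite_UNIV_nat by blast
  then obtain i j where ij: "i < j" "?r i = ?r j"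
    unfolding inj_def by (metis linorder_neqE_nat)
  have "(k ^^ (j - i)) x = x" if "x \<in> U" for x
  proof -
    have "(k ^^ i) ((k ^^ (j - i)) x) = (k ^^ j) x"
      using ij(1) by (metis add_diff_inverse_nat comp_apply funpow_add less_or_eq_imp_le not_le)
    also have "\<dots> = (k ^^ i) x" using fun_cong[OF ij(2), of x] that by simp
    finally show ?thesis using inj_pow[of i] closed that by (auto simp: inj_on_def)
  qed
  then show ?thesis using ij(1) by (intro exI[of _ "j - i"]) auto
qed

text \<open>Let \<open>f\<close> have image \<open>U\<close>. The bridge supplies \<open>g\<close>
  such that \<open>f g f\<close> still separates, so by minimality \<open>f g\<close> permutes
  \<open>U\<close>; a power of \<open>f g\<close> that fixes \<open>U\<close> pointwise is the
  retraction.\<close>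

lemma minimal_set_idempotent:
  assumes alg: "is_alg A" and fin: "finite (univ A)" and pq: "prime_quotient A \<alpha> \<beta>"
    and U: "U \<in> minimal_sets A \<alpha> \<beta>"
  shows "\<exists>e\<in>Pol A 1. (\<forall>x\<in>univ A. e [x] \<in> U) \<and> (\<forall>x\<in>U. e [x] = x)"
proof -
  have t1: "[a] \<in> tuples 1 (univ A)" if "a \<in> univ A" for a using that by (auto simp: tuples_def)
  obtain f x y where f: "f \<in> Pol A 1" "U = (\<lambda>x. f [x]) ` univ A" "(x, y) \<in> \<beta>" "(f [x], f [y]) \<notin> \<alpha>"
    using U by (auto simp: minimal_sets_def U_sets_def)
  have con: "\<beta> \<in> Con A" using pq by (auto simp: prime_quotient_def)
  then have xyA: "x \<in> univ A" "y \<in> univ A" using f(3) by (auto simp: Con_def equiv_def)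
  have "(f [x], f [y]) \<in> \<beta>"
    using Pol_congruence[OF f(1) alg con t1 t1] xyA f(3) by simp
  from prime_quotient_bridge[OF alg pq f(1,3,4) this f(4)]
  obtain g where g: "g \<in> Pol A 1" "(f [g [f [x]]], f [g [f [y]]]) \<notin> \<alpha>" by blast
  define k where "k = (\<lambda>x. f [g [x]])"
  have comp: "(\<lambda>xs\<in>tuples 1 (univ A). b [c xs]) \<in> Pol A 1" if "b \<in> Pol A 1" "c \<in> Pol A 1" for b c
    using Pol_comp[OF that(1) alg, of "[c]" 1] that(2) by simp
  have mem: "b [a] \<in> univ A" if "b \<in> Pol A 1" "a \<in> univ A" for a b
    using Pol_mem[OF that(1) alg t1[OF that(2)]] .
  have UA: "U \<subseteq> univ A" using f mem by auto
  have kU: "k a \<in> U" if "a \<in> univ A" for a using that f(2) mem[OF g(1)] by (auto simp: k_def)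
  have kP: "\<exists>h\<in>Pol A 1. \<forall>a\<in>univ A. h [a] = (k ^^ m) a" for m
  proof (induction m)
    case 0
    show ?case using t1 by (intro bexI[OF _ Pol.proj[of 0]]) auto
  next
    case (Suc m)
    then obtain h where h: "h \<in> Pol A 1" "\<forall>a\<in>univ A. h [a] = (k ^^ m) a" by blast
    show ?case
      using h t1 mem by (intro bexI[OF _ comp[OF f(1) comp[OF g(1) h(1)]]]) (auto simp: k_def)
  qed
  have "(\<lambda>x. f [g [f [x]]]) ` univ A \<in> U_sets A \<alpha> \<beta>"
  proof -
    let ?h = "\<lambda>xs\<in>tuples 1 (univ A). f [(\<lambda>xs\<in>tuples 1 (univ A). g [f xs]) xs]"
    have "?h \<in> Pol A 1" using comp f(1) g(1) by blast
    moreover have "?h [a] = f [g [f [a]]]" if "a \<in> univ A" for a using t1[OF that] by simp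
    moreover from this have "(\<lambda>x. f [g [f [x]]]) ` univ A = (\<lambda>x. ?h [x]) ` univ A"
      by (intro image_cong) simp_all
    moreover have "\<exists>(x, y)\<in>\<beta>. (?h [x], ?h [y]) \<notin> \<alpha>"
      using f(3) g(2) xyA calculation(2) by (intro bexI[of _ "(x, y)"]) auto
    ultimately show ?thesis unfolding U_sets_def by blast
  qed
  moreover have "(\<lambda>x. f [g [f [x]]]) ` univ A \<subseteq> U" using f g mem by auto
  ultimately have "(\<lambda>x. f [g [f [x]]]) ` univ A = U" using U by (auto simp: minimal_sets_def)
  then have "k ` U = U" using f(2) by (auto simp: k_def image_image)
  moreover have "finite U" using UA fin finite_subset by blast
  ultimately obtain m where m: "m > 0" "\<forall>x\<in>U. (k ^^ m) x = x" using finite_surj_funpow_id by blast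
  obtain e where e: "e \<in> Pol A 1" "\<forall>a\<in>univ A. e [a] = (k ^^ m) a" using kP by blast
  have "(k ^^ i) a \<in> univ A" if "a \<in> univ A" for i a
    using that kU UA by (induction i) auto
  then have "(k ^^ m) a \<in> U" if "a \<in> univ A" for a
    using that kU m(1) by (cases m) auto
  then show ?thesis using e m UA by (intro bexI[OF _ e(1)]) auto
qed

text \<open>Meet, join and constants are monotone. This is the only property of lattice polynomials
  that excludes an exchange of the two elements.\<close>

lemma Pol_two_elt_mono:
  assumes "F \<in> Pol (two_elt_alg {Meet, Join} z u) n" "z \<noteq> u"
    "Xs \<in> tuples n {z, u}" "Ys \<in> tuples n {z, u}" "\<forall>i<n. Xs ! i = u \<longrightarrow> Ys ! i = u" "F Xs = u"
  shows "F Ys = u"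
  using assms
proof (induction F rule: Pol.induct)
  case (app s gs)
  have t: "Xs \<in> tuples n (univ (two_elt_alg {Meet, Join} z u))" "Ys \<in> tuples n (univ (two_elt_alg {Meet, Join} z u))"
    using app.prems by (auto simp: two_elt_alg_def)
  have alg: "is_alg (two_elt_alg {Meet, Join} z u)"
    by (auto simp: is_alg_def two_elt_alg_def closed_under_def)
  have gz: "g Zs = z \<or> g Zs = u" if "g \<in> set gs" "Zs \<in> {Xs, Ys}" for g Zs
    using Pol_mem[OF _ alg, of g n Zs] that app t by (auto simp: two_elt_alg_def)
  have "s = Meet \<or> s = Join" "length gs = 2" using app by (auto simp: two_elt_alg_def)
  then obtain g h where gs: "gs = [g, h]" by (auto simp: length_Suc_conv numeral_2_eq_2)
  show ?case using \<open>s = Meet \<or> s = Join\<close> app gz t unfolding gs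
    by (auto simp: two_elt_alg_def split: if_splits)
qed (auto simp: two_elt_alg_def tuples_def)

text \<open>Collects what a refutation of type 4 works with: \<open>a\<close> and \<open>b\<close>
  represent bottom and top of a trace, \<open>p\<close> is a meet on it, and an exchange is
  impossible. The polynomial \<open>r\<close> of the last clause may lead out of \<open>N\<close>;
  the retraction onto the minimal set brings it back.\<close>

lemma type4_obstruction:
  assumes alg: "is_alg C" and fin: "finite (univ C)" and pq: "prime_quotient C \<alpha> \<beta>"
    and ty: "has_quotient_type C \<alpha> \<beta> Type4_lattice"
  obtains N a b p where "N \<subseteq> univ C" "p \<in> Pol C 2" "\<And>x y. x \<in> N \<Longrightarrow> y \<in> N \<Longrightarrow> p [x, y] \<in> N"
    "a \<in> N" "b \<in> N" "(a, b) \<notin> \<alpha>" "\<And>x. x \<in> N \<Longrightarrow> (x, a) \<in> \<alpha> \<or> (x, b) \<in> \<alpha>"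
    "\<And>x y. x \<in> N \<Longrightarrow> y \<in> N \<Longrightarrow> (p [x, y], if (x, b) \<in> \<alpha> \<and> (y, b) \<in> \<alpha> then b else a) \<in> \<alpha>"
    "\<And>r x y. r \<in> Pol C 1 \<Longrightarrow> x \<in> N \<Longrightarrow> y \<in> N \<Longrightarrow> (x, a) \<in> \<alpha> \<Longrightarrow> (y, b) \<in> \<alpha> \<Longrightarrow>
      (r [x], b) \<in> \<alpha> \<Longrightarrow> (r [y], a) \<in> \<alpha> \<Longrightarrow> False"
proof -
  obtain N where N: "N \<in> traces C \<alpha> \<beta>"
    and mt: "minimal_alg_type (quotient_alg (induced_alg C N) (\<alpha> \<inter> N \<times> N)) Type4_lattice"
    using ty by (auto simp: has_quotient_type_def)
  obtain U x0 where U: "U \<in> minimal_sets C \<alpha> \<beta>" "x0 \<in> U" "N = U \<inter> \<beta> `` {x0}"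
    using N by (auto simp: traces_def)
  obtain e where e: "e \<in> Pol C 1" "\<forall>x\<in>univ C. e [x] \<in> U" "\<forall>x\<in>U. e [x] = x"
    using minimal_set_idempotent[OF alg fin pq U(1)] by blast
  have con: "\<alpha> \<in> Con C" "\<beta> \<in> Con C" and ab: "\<alpha> \<subset> \<beta>" using pq by (auto simp: prime_quotient_def)
  have eqa: "equiv (univ C) \<alpha>" and eqb: "equiv (univ C) \<beta>" using con by (auto simp: Con_def)
  have NC: "N \<subseteq> univ C" using U eqb by (auto simp: equiv_def)
  define \<theta> where "\<theta> = \<alpha> \<inter> N \<times> N"
  have eqt: "equiv N \<theta>"
  proof (rule equivI)
    show "\<theta> \<subseteq> N \<times> N" by (auto simp: \<theta>_def)
    show "refl_on N \<theta>" using eqa NC by (auto simp: \<theta>_def equiv_def refl_on_def)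
    show "sym \<theta>" using eqa unfolding \<theta>_def equiv_def sym_def by blast
    show "trans \<theta>" using eqa unfolding \<theta>_def equiv_def trans_def by blast
  qed
  define cls where "cls x = \<theta> `` {x}" for x
  define Q where "Q = quotient_alg (induced_alg C N) \<theta>"
  obtain z u where zu: "z \<noteq> u" and pe: "poly_equivalent Q (two_elt_alg {Meet, Join} z u)"
    using mt unfolding Q_def \<theta>_def by auto
  have uQ: "univ Q = N // \<theta>" by (simp add: Q_def quotient_alg_def induced_alg_def)
  then have Nq: "N // \<theta> = {z, u}" using pe by (simp add: poly_equivalent_def two_elt_alg_def)
  have PolQ: "Pol Q n = Pol (two_elt_alg {Meet, Join} z u) n" for n
    using pe by (simp add: poly_equivalent_def)
  have "z \<in> N // \<theta>" "u \<in> N // \<theta>" using Nq by auto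
  then obtain a b where a: "a \<in> N" "cls a = z" and b: "b \<in> N" "cls b = u"
    unfolding quotient_def cls_def by auto
  have cls_eq: "cls x = cls y \<longleftrightarrow> (x, y) \<in> \<alpha>" if "x \<in> N" "y \<in> N" for x y
    using eq_equiv_class_iff[OF eqt that] that by (auto simp: cls_def \<theta>_def)
  have clsQ: "cls x \<in> N // \<theta>" if "x \<in> N" for x using that by (auto simp: cls_def quotient_def)
  \<comment> \<open>The quotient algebra computes with representatives picked by
    \<open>SOME\<close>; these stay in \<open>N\<close> and in the same \<alpha>-class.\<close>
  have some: "(SOME y. y \<in> cls x) \<in> N \<and> ((SOME y. y \<in> cls x), x) \<in> \<alpha>" if "x \<in> N" for x
  proof -
    have "x \<in> cls x" using that eqt by (auto simp: cls_def equiv_def refl_on_def)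
    then have "(SOME y. y \<in> cls x) \<in> cls x" by (rule someI)
    then show ?thesis using eqa by (auto simp: cls_def \<theta>_def equiv_def sym_def)
  qed
  have tupN: "xs \<in> tuples n (univ C)" if "xs \<in> tuples n N" for xs n
    using that NC by (auto simp: tuples_def)
  have tupQ: "map cls xs \<in> tuples n (univ Q)" if "xs \<in> tuples n N" for xs n
    using that clsQ uQ by (auto simp: tuples_def)
  \<comment> \<open>Polynomials of the quotient are induced by polynomials of \<open>C\<close> that
    preserve \<open>N\<close>.\<close>
  have rep: "\<exists>f\<in>Pol C n. \<forall>xs\<in>tuples n N. f xs \<in> N \<and> F (map cls xs) = cls (f xs)"
    if "F \<in> Pol Q n" for F n
    using that
  proof (induction F rule: Pol.induct)
    case (proj k)
    have "xs ! k \<in> N \<and> map cls xs ! k = cls (xs ! k)" if "xs \<in> tuples n N" for xs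
      using that proj by (auto simp: tuples_def dest: nth_mem)
    then show ?case using tupN tupQ by (intro bexI[OF _ Pol.proj[OF proj]]) simp
  next
    case (const c)
    then obtain d where d: "d \<in> N" "c = cls d" unfolding uQ quotient_def cls_def by auto
    then have "d \<in> univ C" using NC by blast
    then show ?case using d tupN tupQ by (intro bexI[OF _ Pol.const[of d]]) simp_all
  next
    case (app s gs)
    then obtain k f where f: "s = (k, restrict f (tuples k N))" "f \<in> Pol C k" "\<forall>xs\<in>tuples k N. f xs \<in> N"
      by (auto simp: Q_def quotient_alg_def induced_alg_def)
    have len: "length gs = k" using app f by (simp add: Q_def quotient_alg_def induced_alg_def)
    obtain G where G: "\<forall>g\<in>set gs. G g \<in> Pol C n \<and> (\<forall>xs\<in>tuples n N. G g xs \<in> N \<and> g (map cls xs) = cls (G g xs))"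
      using app by metis
    let ?F = "\<lambda>xs\<in>tuples n (univ C). f (map (\<lambda>g. g xs) (map G gs))"
    have "?F \<in> Pol C n" using Pol_comp[OF f(2) alg, of "map G gs" n] G len by auto
    moreover have "?F xs \<in> N \<and> (\<lambda>xs\<in>tuples n (univ Q). interp Q s (map (\<lambda>g. g xs) gs)) (map cls xs) = cls (?F xs)"
      if xs: "xs \<in> tuples n N" for xs
    proof -
      let ?ys = "map (\<lambda>g. G g xs) gs" and ?zs = "map (\<lambda>g. SOME y. y \<in> cls (G g xs)) gs"
      have ys: "?ys \<in> tuples k N" using G xs len by (auto simp: tuples_def)
      have zs: "?zs \<in> tuples k N" using G xs len some by (auto simp: tuples_def)
      have "interp Q s (map (\<lambda>g. g (map cls xs)) gs) = cls (f ?zs)"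
      proof -
        have e: "map (\<lambda>X. SOME x. x \<in> X) (map (\<lambda>g. g (map cls xs)) gs) = ?zs" using G xs by simp
        have "interp Q s Ys = cls (restrict f (tuples k N) (map (\<lambda>X. SOME x. x \<in> X) Ys))" for Ys
          by (simp add: Q_def quotient_alg_def induced_alg_def f(1) cls_def)
        then show ?thesis using e zs by (simp only: restrict_apply if_True)
      qed
      moreover have "(f ?zs, f ?ys) \<in> \<alpha>"
      proof (rule Pol_congruence[OF f(2) alg con(1) tupN[OF zs] tupN[OF ys]])
        have "((SOME y. y \<in> cls (G g xs)), G g xs) \<in> \<alpha>" if "g \<in> set gs" for g
          using some G xs that by blast
        then show "list_all2 (\<lambda>x y. (x, y) \<in> \<alpha>) ?zs ?ys"
          unfolding list_all2_conv_all_nth by simp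
      qed
      then have "cls (f ?zs) = cls (f ?ys)" using cls_eq f(3) ys zs by blast
      ultimately show ?thesis using xs tupN tupQ f(3) ys by (simp add: o_def)
    qed
    ultimately show ?case by blast
  qed
  have tup2: "[x, y] \<in> tuples 2 V \<longleftrightarrow> x \<in> V \<and> y \<in> V" for x y :: 'c and V by (auto simp: tuples_def)
  have "\<exists>F\<in>Pol Q 2. \<forall>X\<in>{z, u}. \<forall>Y\<in>{z, u}. F [X, Y] = (if X = u \<and> Y = u then u else z)"
  proof -
    let ?T = "two_elt_alg {Meet, Join} z u"
    let ?pr = "\<lambda>k. \<lambda>xs\<in>tuples 2 (univ ?T). xs ! k"
    have "(\<lambda>xs\<in>tuples 2 (univ ?T). interp ?T Meet (map (\<lambda>g. g xs) [?pr 0, ?pr 1])) \<in> Pol ?T 2"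
    proof (rule Pol.app)
      show "Meet \<in> symbs ?T" "length [?pr 0, ?pr 1] = rank ?T Meet" by (simp_all add: two_elt_alg_def)
      show "\<forall>g\<in>set [?pr 0, ?pr 1]. g \<in> Pol ?T 2" by (auto intro: Pol.proj)
    qed
    then show ?thesis unfolding PolQ
      by (intro bexI) (auto simp: two_elt_alg_def tuples_def)
  qed
  then obtain F where F: "F \<in> Pol Q 2" "\<And>X Y. X \<in> {z, u} \<Longrightarrow> Y \<in> {z, u} \<Longrightarrow> F [X, Y] = (if X = u \<and> Y = u then u else z)"
    by blast
  obtain p where p: "p \<in> Pol C 2" "\<forall>xs\<in>tuples 2 N. p xs \<in> N \<and> F (map cls xs) = cls (p xs)"
    using rep[OF F(1)] by blast
  have pN: "p [x, y] \<in> N" "cls (p [x, y]) = F [cls x, cls y]" if "x \<in> N" "y \<in> N" for x y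
    using p(2) that bspec[OF p(2), of "[x, y]"] by (auto simp: tuples_def)
  have clszu: "cls x \<in> {z, u}" if "x \<in> N" for x using clsQ[OF that] Nq by simp
  show thesis
  proof (rule that[OF NC p(1) pN(1) a(1) b(1)])
    show "(a, b) \<notin> \<alpha>" using cls_eq[OF a(1) b(1)] a b zu by simp
    show ab': "(x, a) \<in> \<alpha> \<or> (x, b) \<in> \<alpha>" if "x \<in> N" for x
      using clszu[OF that] cls_eq[OF that] a b by auto
    show "(p [x, y], if (x, b) \<in> \<alpha> \<and> (y, b) \<in> \<alpha> then b else a) \<in> \<alpha>" if xy: "x \<in> N" "y \<in> N" for x y
    proof -
      have "cls (p [x, y]) = cls (if (x, b) \<in> \<alpha> \<and> (y, b) \<in> \<alpha> then b else a)"
        using pN(2)[OF xy] F(2)[OF clszu[OF xy(1)] clszu[OF xy(2)]] cls_eq[OF xy(1) b(1)] cls_eq[OF xy(2) b(1)] a b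
        by auto
      then show ?thesis using cls_eq[OF pN(1)[OF xy] a(1)] cls_eq[OF pN(1)[OF xy] b(1)]
        by (auto split: if_splits)
    qed
    fix r x y
    assume r: "r \<in> Pol C 1" and xy: "x \<in> N" "y \<in> N" "(x, a) \<in> \<alpha>" "(y, b) \<in> \<alpha>"
      and rx: "(r [x], b) \<in> \<alpha>" and ry: "(r [y], a) \<in> \<alpha>"
    have t1: "[c] \<in> tuples 1 (univ C)" if "c \<in> univ C" for c using that by (auto simp: tuples_def)
    let ?k = "\<lambda>xs\<in>tuples 1 (univ C). e [r xs]"
    have kP: "?k \<in> Pol C 1" using Pol_comp[OF e(1) alg, of "[r]" 1] r by simp
    have tr: "(c, d) \<in> \<alpha> \<Longrightarrow> (d, c') \<in> \<alpha> \<Longrightarrow> (c, c') \<in> \<alpha>" and sy: "(c, d) \<in> \<alpha> \<Longrightarrow> (d, c) \<in> \<alpha>" for c d c'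
      using eqa unfolding equiv_def trans_def sym_def by blast+
    have con1: "(g [c], g [d]) \<in> \<alpha>" if "g \<in> Pol C 1" "(c, d) \<in> \<alpha>" for g c d
      using Pol_congruence[OF that(1) alg con(1), of "[c]" "[d]"] that(2) eqa t1 by (auto simp: equiv_def)
    have eab: "e [a] = a" "e [b] = b" using e(3) a b U by auto
    have kx: "(e [r [c]], b) \<in> \<alpha>" if "(c, a) \<in> \<alpha>" for c
      using con1[OF e(1) tr[OF con1[OF r tr[OF that sy[OF xy(3)]]] rx]] eab by simp
    have ky: "(e [r [c]], a) \<in> \<alpha>" if "(c, b) \<in> \<alpha>" for c
      using con1[OF e(1) tr[OF con1[OF r tr[OF that sy[OF xy(4)]]] ry]] eab by simp
    \<comment> \<open>The value lies in the minimal set and is \<alpha>-related to \<open>a\<close>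
      or \<open>b\<close>, hence it stays in the \<beta>-class that cuts out
      \<open>N\<close>.\<close>
    have ker: "e [r [c]] \<in> N" if c: "c \<in> N" for c
    proof -
      have cC: "c \<in> univ C" using c NC by auto
      have "e [r [c]] \<in> U" using e(2) Pol_mem[OF r alg t1[OF cC]] by auto
      moreover have "(e [r [c]], b) \<in> \<beta> \<or> (e [r [c]], a) \<in> \<beta>" using kx ky ab' c ab by blast
      then have "(x0, e [r [c]]) \<in> \<beta>" using a(1) b(1) U(3) eqb
        unfolding equiv_def trans_def sym_def by blast
      ultimately show ?thesis using U by simp
    qed
    let ?s = "(1::nat, restrict ?k (tuples 1 N))"
    let ?F = "\<lambda>Xs\<in>tuples 1 (univ Q). interp Q ?s (map (\<lambda>g. g Xs) [\<lambda>Xs\<in>tuples 1 (univ Q). Xs ! 0])"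
    have kN: "\<forall>xs\<in>tuples 1 N. ?k xs \<in> N"
    proof
      fix xs assume "xs \<in> tuples 1 N"
      then obtain c where "xs = [c]" "c \<in> N" by (auto simp: tuples_def length_Suc_conv)
      then show "?k xs \<in> N" using ker t1 NC by auto
    qed
    have "?F \<in> Pol Q 1"
    proof (rule Pol.app)
      have "symbs Q = {(n, restrict f (tuples n N)) | n f. f \<in> Pol C n \<and> (\<forall>xs\<in>tuples n N. f xs \<in> N)}"
        by (simp add: Q_def quotient_alg_def induced_alg_def)
      then show "?s \<in> symbs Q" using kP kN by blast
      show "length [\<lambda>Xs\<in>tuples 1 (univ Q). Xs ! 0] = rank Q ?s"
        by (simp add: Q_def quotient_alg_def induced_alg_def)
    qed (auto intro: Pol.proj)
    then have FT: "?F \<in> Pol (two_elt_alg {Meet, Join} z u) 1" by (simp only: PolQ)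
    have Fv: "?F [cls c] = cls (e [r [c]])" if c: "c \<in> N" for c
    proof -
      let ?d = "SOME y. y \<in> cls c"
      have d: "?d \<in> N" "(?d, c) \<in> \<alpha>" using some[OF c] by auto
      have "?F [cls c] = cls (e [r [?d]])"
      proof -
        have "[cls c] \<in> tuples 1 (univ Q)" "[?d] \<in> tuples 1 N" "[?d] \<in> tuples 1 (univ C)"
          using clsQ[OF c] d(1) NC uQ by (auto simp: tuples_def)
        then show ?thesis by (simp add: Q_def quotient_alg_def induced_alg_def cls_def)
      qed
      also have "\<dots> = cls (e [r [c]])"
        using cls_eq[OF ker[OF d(1)] ker[OF c]] con1[OF e(1) con1[OF r d(2)]] by simp
      finally show ?thesis .
    qed
    have aa: "(a, a) \<in> \<alpha>" "(b, b) \<in> \<alpha>" using eqa a b NC by (auto simp: equiv_def refl_on_def)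
    have "?F [z] = u" using Fv[OF a(1)] a b kx[OF aa(1)] cls_eq[OF ker[OF a(1)] b(1)] by simp
    moreover have "?F [u] = z" using Fv[OF b(1)] a b ky[OF aa(2)] cls_eq[OF ker[OF b(1)] a(1)] by simp
    \<comment> \<open>Monotonicity: since \<open>z\<close> already goes to the top \<open>u\<close>,
      so must \<open>u\<close>.\<close>
    moreover have "?F [u] = u"
      by (rule Pol_two_elt_mono[OF FT zu, of "[z]"]) (use calculation zu in \<open>auto simp: tuples_def\<close>)
    ultimately show False using zu by simp
  qed
qed

section \<open>The algebra of a unit machine\<close>

text \<open>Elements: \<open>0\<close> is the dead value; \<open>1\<close> and \<open>2\<close> say whether a gate touches the coordinate or
  leaves it alone; \<open>3, 4\<close> are the truth values false and true; \<open>5, 6\<close> are truth values waiting for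
  a gate, \<open>7, 8\<close> truth values that have met one.  From \<open>9\<close> on come the symbols of the machine.\<close>

definition u_op :: "nat \<Rightarrow> nat" where
  "u_op y = (if y = 1 \<or> y = 2 then 9 else if y = 7 then 3 else if y = 8 then 4 else 0)"

text \<open>Both moves act on symbols, but only move 0 lets truth values live. A truth value dies
  when it is touched twice, so that at a surviving coordinate the gates touch like distinct
  units.\<close>

definition f_op :: "(nat \<Rightarrow> nat \<Rightarrow> nat \<Rightarrow> nat) \<Rightarrow> nat \<Rightarrow> nat \<Rightarrow> nat \<Rightarrow> nat" where
  "f_op d k y g =
     (if 9 \<le> y then if g = 1 \<or> g = 2 then d k g y else 0
      else if k = 0 \<and> 5 \<le> y \<and> g = 2 then y
      else if k = 0 \<and> (y = 5 \<or> y = 6) \<and> g = 1 then y + 2 else 0)"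

text \<open>A single term for both lattice operations: meet for false \<open>w\<close>, join of
  \<open>x\<close> and \<open>w\<close> for true \<open>y\<close>. The output is waiting, so it
  cannot be fed into another term before it has met a gate.\<close>

definition s_op :: "nat \<Rightarrow> nat \<Rightarrow> nat \<Rightarrow> nat" where
  "s_op x y w = (if {x, y, w} \<subseteq> {3, 4} then if w = 4 \<or> x = 4 \<and> y = 4 then 6 else 5 else 0)"

text \<open>Whatever is not a readable truth value counts as dead. Hence in the first three
  arguments of \<open>c_op\<close> a waiting value may be replaced by the dead constant.\<close>

definition tv :: "nat \<Rightarrow> nat" where
  "tv y = (if y = 3 \<or> y = 4 then y else 0)"

text \<open>An exchange of two prescribed values, one of which may be dead, so any two ready tuples
  can be interchanged. Adding 2 turns 3 and 4 into the waiting values 5 and 6, which subjects the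
  result to the gates just as after \<open>s_op\<close>.\<close>

definition c_op :: "(nat \<Rightarrow> bool) \<Rightarrow> nat \<Rightarrow> nat \<Rightarrow> nat \<Rightarrow> nat \<Rightarrow> nat" where
  "c_op w x a b h =
     (if 9 \<le> h \<and> w h then
        let v = (if tv x = tv a then tv b else if tv x = tv b then tv a else 0)
        in if v = 0 then 0 else v + 2
      else 0)"

definition mach_op :: "(nat \<Rightarrow> nat \<Rightarrow> nat \<Rightarrow> nat) \<Rightarrow> (nat \<Rightarrow> bool) \<Rightarrow> nat \<Rightarrow> nat list \<Rightarrow> nat" where
  "mach_op d w s xs =
     (if s = 0 then u_op (xs ! 0)
      else if s = 1 then f_op d 0 (xs ! 0) (xs ! 1)
      else if s = 2 then f_op d 1 (xs ! 0) (xs ! 1)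
      else if s = 3 then s_op (xs ! 0) (xs ! 1) (xs ! 2)
      else c_op w (xs ! 0) (xs ! 1) (xs ! 2) (xs ! 3))"

definition digits :: "nat \<Rightarrow> nat \<Rightarrow> nat \<Rightarrow> nat list" where
  "digits n k i = map (\<lambda>j. i div n ^ (k - 1 - j) mod n) [0..<k]"

definition mach_rank :: "nat \<Rightarrow> nat" where
  "mach_rank s = [1, 2, 2, 3, 4] ! s"

definition mach_pres :: "nat \<Rightarrow> (nat \<Rightarrow> nat \<Rightarrow> nat \<Rightarrow> nat) \<Rightarrow> (nat \<Rightarrow> bool) \<Rightarrow> presentation" where
  "mach_pres n d w = (n, map (\<lambda>s. (mach_rank s,
     map (\<lambda>i. mach_op d w s (digits n (mach_rank s) i)) [0..<n ^ mach_rank s])) [0..<5])"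

lemma u_op_values: "u_op y \<in> {0, 3, 4, 9}"
  by (simp add: u_op_def)

lemma s_op_values: "s_op x y v \<in> {0, 5, 6}"
  by (simp add: s_op_def)

lemma tv_values: "tv y \<in> {0, 3, 4}"
  by (simp add: tv_def)

lemma c_op_values: "c_op w x a b h \<in> {0, 5, 6}"
  using tv_values[of a] tv_values[of b] by (auto simp: c_op_def Let_def)

lemma table_index_append:
  "table_index n (xs @ ys) = table_index n xs * n ^ length ys + table_index n ys"
proof (induction ys rule: rev_induct)
  case (snoc y ys)
  then show ?case by (simp add: table_index_def algebra_simps flip: append_assoc)
qed (simp add: table_index_def)

lemma digits_table_index:
  assumes "set xs \<subseteq> {..<n}"
  shows "digits n (length xs) (table_index n xs) = xs"
proof (rule nth_equalityI)
  fix j assume "j < length (digits n (length xs) (table_index n xs))"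
  then have j: "j < length xs" by (simp add: digits_def)
  let ?e = "length xs - 1 - j"
  have "xs = take j xs @ [xs ! j] @ drop (Suc j) xs" using j id_take_nth_drop[of j xs] by simp
  then have "table_index n xs = table_index n (take j xs @ [xs ! j] @ drop (Suc j) xs)" by simp
  also have "\<dots> = (table_index n (take j xs) * n + xs ! j) * n ^ ?e + table_index n (drop (Suc j) xs)"
    using j unfolding table_index_append by (simp add: table_index_def algebra_simps)
  finally have eq: "table_index n xs = (table_index n (take j xs) * n + xs ! j) * n ^ ?e + table_index n (drop (Suc j) xs)" .
  have "set (drop (Suc j) xs) \<subseteq> {..<n}" using assms set_drop_subset by fastforce
  then have "table_index n (drop (Suc j) xs) < n ^ ?e"
    using table_index_less[of "drop (Suc j) xs" n] by simp
  moreover have "(a * m + r) div m = a" if "r < m" for a m r :: nat using that by simp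
  ultimately have "table_index n xs div n ^ ?e = table_index n (take j xs) * n + xs ! j"
    unfolding eq by blast
  moreover have "xs ! j < n" using assms j nth_mem by blast
  ultimately show "digits n (length xs) (table_index n xs) ! j = xs ! j"
    using j by (simp add: digits_def)
qed (simp add: digits_def)

lemma digits_less: "0 < n \<Longrightarrow> set (digits n k i) \<subseteq> {..<n}"
  by (auto simp: digits_def)

text \<open>The index \<open>k\<close> chooses between two moves, \<open>g = 1\<close> marks the
  touched unit and \<open>g = 2\<close> all others. The value 0 means that the unit forbids the
  move.\<close>

locale unit_machine =
  fixes n :: nat and d :: "nat \<Rightarrow> nat \<Rightarrow> nat \<Rightarrow> nat" and w :: "nat \<Rightarrow> bool"
  assumes n9: "9 < n"
    and d_range: "\<And>k g y. k < 2 \<Longrightarrow> g = 1 \<or> g = 2 \<Longrightarrow> 9 \<le> y \<Longrightarrow> y < n \<Longrightarrow>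
      d k g y = 0 \<or> 9 \<le> d k g y \<and> d k g y < n"
begin

definition A :: "(nat, nat) alg" where "A = table_alg (mach_pres n d w)"

lemma mach_rank_simps [simp]:
  "mach_rank 0 = 1" "mach_rank (Suc 0) = 2" "mach_rank 2 = 2" "mach_rank 3 = 3" "mach_rank 4 = 4"
  by (simp_all add: mach_rank_def eval_nat_numeral)

lemma less_5: "s < 5 \<longleftrightarrow> s = 0 \<or> s = 1 \<or> s = 2 \<or> s = 3 \<or> s = (4::nat)"
  by auto

lemma f_op_less: "k < 2 \<Longrightarrow> y < n \<Longrightarrow> f_op d k y g < n"
  using d_range[of k g y] n9 by (auto simp: f_op_def)

lemma mach_op_less:
  assumes "s < 5" "length xs = mach_rank s" "set xs \<subseteq> {..<n}"
  shows "mach_op d w s xs < n"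
proof -
  have "0 < length xs" using assms(1,2) by (auto simp: less_5)
  then have "xs ! 0 < n" using assms(3) nth_mem[of 0 xs] by blast
  then show ?thesis
    using assms(1) n9 f_op_less[of 0 "xs ! 0"] f_op_less[of 1 "xs ! 0"] u_op_values[of "xs ! 0"]
      s_op_values[of "xs ! 0" "xs ! 1" "xs ! 2"] c_op_values[of w "xs ! 0" "xs ! 1" "xs ! 2" "xs ! 3"]
    unfolding mach_op_def by (auto simp del: One_nat_def)
qed

lemma valid_mach_pres: "valid_presentation (mach_pres n d w)"
proof -
  have "mach_op d w s (digits n (mach_rank s) i) < n" if "s < 5" for s i
    using that n9 by (intro mach_op_less digits_less) (auto simp: digits_def)
  then show ?thesis using n9 by (auto simp: mach_pres_def)
qed

lemma A_simps [simp]: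
  "univ A = {..<n}" "symbs A = {..<5}" "s < 5 \<Longrightarrow> rank A s = mach_rank s"
  by (simp_all add: A_def mach_pres_def)

lemma interp_A [simp]:
  assumes "s < 5" "xs \<in> tuples (mach_rank s) {..<n}"
  shows "interp A s xs = mach_op d w s xs"
proof -
  have "table_index n xs < n ^ mach_rank s" "length xs = mach_rank s" "set xs \<subseteq> {..<n}"
    using table_index_less[of xs n] assms by (auto simp: tuples_def)
  then show ?thesis using assms(1) digits_table_index[of xs n]
    by (simp add: A_def mach_pres_def)
qed

text \<open>The touched unit and the move are free choices; wrong ones are blocked by a unit that
  answers 0. The symbol 9 is the one that \<open>u_op\<close> makes out of gates. Values at
  arguments from \<open>k\<close> on are meaningless.\<close>

inductive_set reach :: "nat \<Rightarrow> (nat \<Rightarrow> nat) set" for k where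
  init: "(\<lambda>_. 9) \<in> reach k"
| step: "x \<in> reach k \<Longrightarrow> j < k \<Longrightarrow> q < 2 \<Longrightarrow> \<forall>i<k. d q (if i = j then 1 else 2) (x i) \<noteq> 0 \<Longrightarrow>
    (\<lambda>i. d q (if i = j then 1 else 2) (x i)) \<in> reach k"

lemma reach_range: "x \<in> reach k \<Longrightarrow> i < k \<Longrightarrow> 9 \<le> x i \<and> x i < n"
proof (induction arbitrary: i rule: reach.induct)
  case (step x j q)
  then show ?case using d_range[of q "if i = j then 1 else 2" "x i"] by force
qed (use n9 in auto)

end

locale subpower = unit_machine +
  fixes I :: "nat set" and U :: "(nat \<Rightarrow> nat) set"
  assumes subU: "subuniverse (power_alg I A) U"
begin

definition B where "B = subalg (power_alg I A) U"

lemma is_alg_B: "is_alg B"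
  unfolding B_def by (rule is_alg_subpower[OF subU])

lemma B_simps [simp]: "univ B = U" "symbs B = {..<5}" "s < 5 \<Longrightarrow> rank B s = mach_rank s"
  by (simp_all add: B_def subalg_def power_alg_def)

lemma U_less: "f \<in> U \<Longrightarrow> i \<in> I \<Longrightarrow> f i < n"
  using subU by (auto simp: subuniverse_def power_alg_def)

lemma U_ext: "f \<in> U \<Longrightarrow> g \<in> U \<Longrightarrow> (\<And>i. i \<in> I \<Longrightarrow> f i = g i) \<Longrightarrow> f = g"
  using subU by (intro PiE_ext[of f I "\<lambda>_. {..<n}" g]) (auto simp: subuniverse_def power_alg_def)

lemma interp_B:
  assumes "s < 5" "fs \<in> tuples (mach_rank s) U"
  shows "interp B s fs = (\<lambda>i\<in>I. mach_op d w s (map (\<lambda>f. f i) fs))"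
proof -
  have "map (\<lambda>f. f i) fs \<in> tuples (mach_rank s) {..<n}" if "i \<in> I" for i
    using assms(2) that U_less by (auto simp: tuples_def)
  then show ?thesis using assms(1) by (auto simp: B_def subalg_def power_alg_def)
qed

lemma op_U:
  assumes "s < 5" "fs \<in> tuples (mach_rank s) U"
  shows "(\<lambda>i\<in>I. mach_op d w s (map (\<lambda>f. f i) fs)) \<in> U"
proof -
  have "interp B s fs \<in> U" using is_alg_B assms by (simp add: is_alg_def closed_under_def)
  then show ?thesis using interp_B[OF assms] by simp
qed

lemma op_U_simps:
  "f \<in> U \<Longrightarrow> (\<lambda>i\<in>I. u_op (f i)) \<in> U"
  "q < 2 \<Longrightarrow> f \<in> U \<Longrightarrow> g \<in> U \<Longrightarrow> (\<lambda>i\<in>I. f_op d q (f i) (g i)) \<in> U"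
  "f \<in> U \<Longrightarrow> g \<in> U \<Longrightarrow> h \<in> U \<Longrightarrow> (\<lambda>i\<in>I. s_op (f i) (g i) (h i)) \<in> U"
  "f \<in> U \<Longrightarrow> g \<in> U \<Longrightarrow> h \<in> U \<Longrightarrow> k \<in> U \<Longrightarrow> (\<lambda>i\<in>I. c_op w (f i) (g i) (h i) (k i)) \<in> U"
proof -
  show "f \<in> U \<Longrightarrow> (\<lambda>i\<in>I. u_op (f i)) \<in> U"
    using op_U[of 0 "[f]"] by (simp add: tuples_def mach_op_def)
  show "q < 2 \<Longrightarrow> f \<in> U \<Longrightarrow> g \<in> U \<Longrightarrow> (\<lambda>i\<in>I. f_op d q (f i) (g i)) \<in> U"
    using op_U[of 1 "[f, g]"] op_U[of 2 "[f, g]"] by (auto simp: tuples_def mach_op_def less_2_cases_iff)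
  show "f \<in> U \<Longrightarrow> g \<in> U \<Longrightarrow> h \<in> U \<Longrightarrow> (\<lambda>i\<in>I. s_op (f i) (g i) (h i)) \<in> U"
    using op_U[of 3 "[f, g, h]"] by (simp add: tuples_def mach_op_def)
  show "f \<in> U \<Longrightarrow> g \<in> U \<Longrightarrow> h \<in> U \<Longrightarrow> k \<in> U \<Longrightarrow> (\<lambda>i\<in>I. c_op w (f i) (g i) (h i) (k i)) \<in> U"
    using op_U[of 4 "[f, g, h, k]"] by (simp add: tuples_def mach_op_def)
qed

lemma Vals_U:
  assumes "\<phi> \<in> Vals B X" "\<forall>x\<in>X. \<forall>p. x p \<in> U" shows "\<phi> p \<in> U"
  using Vals_mem[OF assms(1) is_alg_B, of p] assms(2) by simp

lemma Vals_op:
  assumes "s < 5" "length fs = mach_rank s" "\<forall>f\<in>set fs. f \<in> Vals B X" "\<forall>x\<in>X. \<forall>p. x p \<in> U"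
  shows "(\<lambda>p. interp B s (map (\<lambda>f. f p) fs)) = (\<lambda>p. \<lambda>i\<in>I. mach_op d w s (map (\<lambda>f. f p i) fs))"
proof
  fix p
  have "map (\<lambda>f. f p) fs \<in> tuples (mach_rank s) U"
    using assms Vals_U[OF _ assms(4)] by (auto simp: tuples_def)
  then show "interp B s (map (\<lambda>f. f p) fs) = (\<lambda>i\<in>I. mach_op d w s (map (\<lambda>f. f p i) fs))"
    using interp_B[OF assms(1)] by (simp add: o_def)
qed

lemma Vals_ops:
  assumes X: "\<forall>x\<in>X. \<forall>p. x p \<in> U"
  shows "f \<in> Vals B X \<Longrightarrow> (\<lambda>p. \<lambda>i\<in>I. u_op (f p i)) \<in> Vals B X"
    "q < 2 \<Longrightarrow> f \<in> Vals B X \<Longrightarrow> g \<in> Vals B X \<Longrightarrow> (\<lambda>p. \<lambda>i\<in>I. f_op d q (f p i) (g p i)) \<in> Vals B X"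
    "f \<in> Vals B X \<Longrightarrow> g \<in> Vals B X \<Longrightarrow> h \<in> Vals B X \<Longrightarrow>
      (\<lambda>p. \<lambda>i\<in>I. s_op (f p i) (g p i) (h p i)) \<in> Vals B X"
    "f \<in> Vals B X \<Longrightarrow> g \<in> Vals B X \<Longrightarrow> h \<in> Vals B X \<Longrightarrow> k \<in> Vals B X \<Longrightarrow>
      (\<lambda>p. \<lambda>i\<in>I. c_op w (f p i) (g p i) (h p i) (k p i)) \<in> Vals B X"
proof -
  have *: "(\<lambda>p. \<lambda>i\<in>I. mach_op d w s (map (\<lambda>f. f p i) fs)) \<in> Vals B X"
    if "s < 5" "length fs = mach_rank s" "\<forall>f\<in>set fs. f \<in> Vals B X" for s fs
    using Vals.app[of s B fs X] that Vals_op[OF that X] by simp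
  show "f \<in> Vals B X \<Longrightarrow> (\<lambda>p. \<lambda>i\<in>I. u_op (f p i)) \<in> Vals B X"
    using *[of 0 "[f]"] by (simp add: mach_op_def)
  show "q < 2 \<Longrightarrow> f \<in> Vals B X \<Longrightarrow> g \<in> Vals B X \<Longrightarrow> (\<lambda>p. \<lambda>i\<in>I. f_op d q (f p i) (g p i)) \<in> Vals B X"
    using *[of 1 "[f, g]"] *[of 2 "[f, g]"] by (auto simp: mach_op_def less_2_cases_iff)
  show "f \<in> Vals B X \<Longrightarrow> g \<in> Vals B X \<Longrightarrow> h \<in> Vals B X \<Longrightarrow>
      (\<lambda>p. \<lambda>i\<in>I. s_op (f p i) (g p i) (h p i)) \<in> Vals B X"
    using *[of 3 "[f, g, h]"] by (simp add: mach_op_def)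
  show "f \<in> Vals B X \<Longrightarrow> g \<in> Vals B X \<Longrightarrow> h \<in> Vals B X \<Longrightarrow> k \<in> Vals B X \<Longrightarrow>
      (\<lambda>p. \<lambda>i\<in>I. c_op w (f p i) (g p i) (h p i) (k p i)) \<in> Vals B X"
    using *[of 4 "[f, g, h, k]"] by (simp add: mach_op_def)
qed

lemma Vals_ops_induct [consumes 2, case_names gen const u_op f_op s_op c_op]:
  assumes \<phi>: "\<phi> \<in> Vals B X" and X: "\<forall>x\<in>X. \<forall>p. x p \<in> U"
    and gen: "\<And>f. f \<in> X \<Longrightarrow> P f" and const: "\<And>c. c \<in> U \<Longrightarrow> P (\<lambda>_. c)"
    and u: "\<And>f. f \<in> Vals B X \<Longrightarrow> P f \<Longrightarrow> P (\<lambda>p. \<lambda>i\<in>I. u_op (f p i))"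
    and f: "\<And>q f g. q < 2 \<Longrightarrow> f \<in> Vals B X \<Longrightarrow> g \<in> Vals B X \<Longrightarrow> P f \<Longrightarrow> P g \<Longrightarrow>
      P (\<lambda>p. \<lambda>i\<in>I. f_op d q (f p i) (g p i))"
    and s: "\<And>f g h. f \<in> Vals B X \<Longrightarrow> g \<in> Vals B X \<Longrightarrow> h \<in> Vals B X \<Longrightarrow> P f \<Longrightarrow> P g \<Longrightarrow> P h \<Longrightarrow>
      P (\<lambda>p. \<lambda>i\<in>I. s_op (f p i) (g p i) (h p i))"
    and c: "\<And>f g h k. f \<in> Vals B X \<Longrightarrow> g \<in> Vals B X \<Longrightarrow> h \<in> Vals B X \<Longrightarrow> k \<in> Vals B X \<Longrightarrow>
      P f \<Longrightarrow> P g \<Longrightarrow> P h \<Longrightarrow> P k \<Longrightarrow> P (\<lambda>p. \<lambda>i\<in>I. c_op w (f p i) (g p i) (h p i) (k p i))"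
  shows "P \<phi>"
  using \<phi>
proof (induction rule: Vals.induct)
  case (app r fs)
  have r: "r < 5" "length fs = mach_rank r" and fs: "\<forall>f\<in>set fs. f \<in> Vals B X" using app by auto
  have eq: "(\<lambda>p. interp B r (map (\<lambda>f. f p) fs)) = (\<lambda>p. \<lambda>i\<in>I. mach_op d w r (map (\<lambda>f. f p i) fs))"
    using Vals_op[OF r fs X] .
  have nth: "fs ! j \<in> Vals B X" "P (fs ! j)" if "j < length fs" for j using app that by auto
  have m: "map (\<lambda>f. f p i) fs ! j = (fs ! j) p i" if "j < length fs" for j p i using that by simp
  consider "r = 0" | "r = 1" | "r = 2" | "r = 3" | "r = 4" using r(1) by (auto simp: less_5)
  then show ?case
  proof cases
    case 1
    then show ?thesis using u[of "fs ! 0"] nth r m unfolding eq by (simp add: mach_op_def)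
  next
    case 2
    then show ?thesis using f[of 0 "fs ! 0" "fs ! 1"] nth r m unfolding eq by (simp add: mach_op_def)
  next
    case 3
    then show ?thesis using f[of 1 "fs ! 0" "fs ! 1"] nth r m unfolding eq by (simp add: mach_op_def)
  next
    case 4
    then show ?thesis using s[of "fs ! 0" "fs ! 1" "fs ! 2"] nth r m unfolding eq by (simp add: mach_op_def)
  next
    case 5
    then show ?thesis using c[of "fs ! 0" "fs ! 1" "fs ! 2" "fs ! 3"] nth r m unfolding eq
      by (simp add: mach_op_def)
  qed
qed (use gen const in auto)

end

section \<open>No lattice type when every run fills up\<close>

text \<open>A point \<open>(s, t)\<close> stands for the two arguments of a binary polynomial,
  \<open>False\<close> for \<open>z\<close> and \<open>True\<close> for \<open>u\<close>. A meet is
  neither \<open>xonly\<close> nor \<open>yonly\<close>.\<close>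

definition xonly :: "(bool \<times> bool \<Rightarrow> 'a) \<Rightarrow> bool" where
  "xonly f \<longleftrightarrow> (\<forall>s t t'. f (s, t) = f (s, t'))"

definition yonly :: "(bool \<times> bool \<Rightarrow> 'a) \<Rightarrow> bool" where
  "yonly f \<longleftrightarrow> (\<forall>s s' t. f (s, t) = f (s', t))"

context subpower
begin

definition inert :: "(nat \<Rightarrow> nat) list \<Rightarrow> nat \<Rightarrow> bool" where
  "inert gs i \<longleftrightarrow> (\<forall>g\<in>set gs. g i = 2)"

text \<open>The position \<open>j\<close> is the unit carried by coordinate \<open>i\<close>.
  Several coordinates may carry the same unit.\<close>

definition once_at :: "(nat \<Rightarrow> nat) list \<Rightarrow> nat \<Rightarrow> nat \<Rightarrow> bool" where
  "once_at gs i j \<longleftrightarrow> (\<forall>l<length gs. (gs ! l) i = (if l = j then 1 else 2))"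

definition once :: "(nat \<Rightarrow> nat) list \<Rightarrow> nat \<Rightarrow> bool" where
  "once gs i \<longleftrightarrow> (\<exists>j<length gs. once_at gs i j)"

text \<open>A history of \<open>Y\<close>: the gates that have been applied since the truth values in the
  tuples of \<open>Y\<close> were last written.  A finished truth value has met exactly one of them, so on the
  coordinates that are alive the gates behave like the units of the machine.\<close>

definition exact :: "(nat \<Rightarrow> nat) list \<Rightarrow> (nat \<Rightarrow> nat) set \<Rightarrow> bool" where
  "exact gs Y \<longleftrightarrow> set gs \<subseteq> U \<and> (\<forall>y\<in>Y. \<forall>i\<in>I.
     y i = 0 \<or> y i \<in> {5, 6} \<and> inert gs i \<or> y i \<in> {3, 4, 7, 8} \<and> once gs i)"

definition ready :: "(nat \<Rightarrow> nat) \<Rightarrow> bool" where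
  "ready y \<longleftrightarrow> (\<forall>i\<in>I. y i \<in> {0, 3, 4})"

definition pending :: "(nat \<Rightarrow> nat) \<Rightarrow> bool" where
  "pending y \<longleftrightarrow> (\<forall>i\<in>I. y i \<in> {0, 5, 6, 7, 8})"

definition fills :: bool where
  "fills \<longleftrightarrow> (\<forall>k>0. \<exists>x\<in>reach k. \<forall>i<k. w (x i))"

lemma exactD:
  assumes "exact gs Y" "y \<in> Y" "i \<in> I"
  shows "y i = 0 \<or> y i \<in> {5, 6} \<and> inert gs i \<or> y i \<in> {3, 4, 7, 8} \<and> once gs i"
  using assms(1)[unfolded exact_def, THEN conjunct2, THEN bspec, OF assms(2), THEN bspec, OF assms(3)] .

lemma exactI:
  assumes "set gs \<subseteq> U" "\<And>y i. y \<in> Y \<Longrightarrow> i \<in> I \<Longrightarrow>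
    y i = 0 \<or> y i \<in> {5, 6} \<and> inert gs i \<or> y i \<in> {3, 4, 7, 8} \<and> once gs i"
  shows "exact gs Y"
  unfolding exact_def using assms by (intro conjI ballI)

lemma exact_gates: "exact gs Y \<Longrightarrow> set gs \<subseteq> U"
  by (simp add: exact_def)

lemma exact_mono: "exact gs Y \<Longrightarrow> Y' \<subseteq> Y \<Longrightarrow> exact gs Y'"
  by (rule exactI[OF exact_gates]) (auto dest!: exactD subsetD)

lemma exact_low:
  assumes "exact gs Y" "y \<in> Y" "i \<in> I" shows "y i \<in> {0, 3, 4, 5, 6, 7, 8}"
  using exactD[OF assms] by auto

lemma once_atD: "once_at gs i j \<Longrightarrow> l < length gs \<Longrightarrow> (gs ! l) i = (if l = j then 1 else 2)"
  by (simp add: once_at_def)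

lemma inert_snoc: "inert (gs @ [c]) i \<longleftrightarrow> inert gs i \<and> c i = 2"
  by (auto simp: inert_def)

lemma inert_nth: "inert gs i \<longleftrightarrow> (\<forall>l<length gs. (gs ! l) i = 2)"
  unfolding inert_def all_set_conv_all_nth ..

lemma once_at_snoc:
  "once_at (gs @ [c]) i j \<longleftrightarrow> once_at gs i j \<and> c i = (if j = length gs then 1 else 2)"
  by (auto simp: once_at_def nth_append less_Suc_eq)

lemma once_snoc: "once (gs @ [c]) i \<longleftrightarrow> inert gs i \<and> c i = 1 \<or> once gs i \<and> c i = 2"
proof -
  have "once_at (gs @ [c]) i (length gs) \<longleftrightarrow> inert gs i \<and> c i = 1"
    unfolding once_at_snoc by (simp add: once_at_def inert_nth)
  moreover have "(\<exists>j<length gs. once_at (gs @ [c]) i j) \<longleftrightarrow> once gs i \<and> c i = 2"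
    unfolding once_at_snoc once_def by (metis less_irrefl)
  moreover have "once (gs @ [c]) i \<longleftrightarrow>
      once_at (gs @ [c]) i (length gs) \<or> (\<exists>j<length gs. once_at (gs @ [c]) i j)"
    unfolding once_def length_append_singleton by (metis less_Suc_eq)
  ultimately show ?thesis by simp
qed

text \<open>Each coordinate of \<open>L\<close> follows the unit whose gate touches it:
  \<open>u_op\<close> on any gate starts the run, and a move touching unit \<open>j\<close> is
  \<open>f_op\<close> with gate \<open>j\<close>, which on \<open>L\<close> is 1 exactly at the
  coordinates carrying that unit.\<close>

lemma gate_run:
  assumes gs: "set gs \<subseteq> U" "gs \<noteq> []" and L: "L \<subseteq> I" "\<forall>i\<in>L. once gs i" and x: "x \<in> reach (length gs)"
  shows "\<exists>c\<in>U. \<forall>i\<in>L. \<forall>j<length gs. (gs ! j) i = 1 \<longrightarrow> c i = x j"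
  using x
proof (induction rule: reach.induct)
  case init
  have g0: "gs ! 0 \<in> U" using gs by auto
  have "(gs ! 0) i = 1 \<or> (gs ! 0) i = 2" if "i \<in> L" for i
  proof -
    have "once gs i" using L(2) that by blast
    then obtain j where j: "j < length gs" "once_at gs i j" by (auto simp: once_def)
    have "0 < length gs" using gs(2) by simp
    from once_atD[OF j(2) this] show ?thesis by simp
  qed
  then show ?case using L(1) by (intro bexI[OF _ op_U_simps(1)[OF g0]]) (auto simp: u_op_def)
next
  case (step x j q)
  then obtain c where c: "c \<in> U" "\<forall>i\<in>L. \<forall>j<length gs. (gs ! j) i = 1 \<longrightarrow> c i = x j" by blast
  have gj: "gs ! j \<in> U" using gs step by auto
  have "f_op d q (c i) ((gs ! j) i) = d q (if l = j then 1 else 2) (x l)"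
    if "i \<in> L" "l < length gs" "(gs ! l) i = 1" for i l
  proof -
    have "once gs i" using L(2) \<open>i \<in> L\<close> by blast
    then obtain m where m: "once_at gs i m" by (auto simp: once_def)
    have "m = l"
    proof (rule ccontr)
      assume "m \<noteq> l"
      then have "(gs ! l) i = 2" using once_atD[OF m that(2)] by simp
      then show False unfolding that(3) by simp
    qed
    then have "(gs ! j) i = (if l = j then 1 else 2)" using once_atD[OF m step.hyps(2)] by auto
    moreover have "c i = x l" using c(2) that by blast
    moreover have "9 \<le> x l" using reach_range[OF step.hyps(1)] that by simp
    ultimately show ?thesis by (simp add: f_op_def)
  qed
  then show ?case using L(1) by (intro bexI[OF _ op_U_simps(2)[OF step.hyps(3) c(1) gj]]) auto
qed

text \<open>Passing through a whole history finishes a freshly written value wherever exactly one of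
  the gates touches.\<close>

lemma f_op_chain:
  "inert gs i \<Longrightarrow> y \<in> {5, 6} \<Longrightarrow> foldl (\<lambda>y g. f_op d 0 y (g i)) y gs = y"
  "once gs i \<Longrightarrow> y \<in> {5, 6} \<Longrightarrow> foldl (\<lambda>y g. f_op d 0 y (g i)) y gs = y + 2"
  "foldl (\<lambda>y g. f_op d 0 y (g i)) 0 gs = 0"
proof -
  show inert: "inert gs i \<Longrightarrow> y \<in> {5, 6} \<Longrightarrow> foldl (\<lambda>y g. f_op d 0 y (g i)) y gs = y" for gs
    by (induction gs rule: rev_induct) (auto simp: inert_snoc f_op_def)
  show "once gs i \<Longrightarrow> y \<in> {5, 6} \<Longrightarrow> foldl (\<lambda>y g. f_op d 0 y (g i)) y gs = y + 2"
  proof (induction gs rule: rev_induct)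
    case Nil
    then show ?case by (simp add: once_def)
  next
    case (snoc c gs)
    then show ?case using inert[of gs] by (auto simp: once_snoc f_op_def)
  qed
  show "foldl (\<lambda>y g. f_op d 0 y (g i)) 0 gs = 0"
    by (induction gs rule: rev_induct) (auto simp: f_op_def)
qed

lemma Vals_chain:
  assumes "f \<in> Vals B X" "\<forall>x\<in>X. \<forall>p. x p \<in> U" "set gs \<subseteq> U"
  shows "\<exists>h\<in>Vals B X. \<forall>p. \<forall>i\<in>I. h p i = foldl (\<lambda>y g. f_op d 0 y (g i)) (f p i) gs"
  using assms(3)
proof (induction gs rule: rev_induct)
  case Nil
  then show ?case using assms(1) by auto
next
  case (snoc c gs)
  then obtain h where h: "h \<in> Vals B X" "\<forall>p. \<forall>i\<in>I. h p i = foldl (\<lambda>y g. f_op d 0 y (g i)) (f p i) gs"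
    by auto
  have "(\<lambda>_. c) \<in> Vals B X" using snoc.prems by (intro Vals.const) simp
  from Vals_ops(2)[OF assms(2) _ h(1) this, of 0] show ?case
    using h(2) by (intro bexI) auto
qed

text \<open>On ready truth values with a history the machine can be run with the gates of the history
  as its units; a full run then opens the operation that exchanges two given tuples.\<close>

lemma ready_swap:
  assumes ab: "a \<in> U" "b \<in> U" and ex: "exact gs {a, b}" and ready: "ready a" "ready b" and fills: "fills"
  shows "\<exists>\<psi>\<in>Vals B {\<lambda>s. if s then b else a}. \<psi> False = b \<and> \<psi> True = a"
proof -
  \<comment> \<open>A coordinate at which only one of the tuples is alive also counts. At the
    remaining ones both are 0, and so is every result.\<close>
  define L where "L = {i \<in> I. a i \<noteq> 0 \<or> b i \<noteq> 0}"
  have X: "\<forall>x\<in>{\<lambda>s. if s then b else a}. \<forall>p. x p \<in> U" using ab by simp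
  have gsU: "set gs \<subseteq> U" using ex by (simp add: exact_def)
  have once: "once gs i" if "i \<in> L" for i
  proof -
    have i: "i \<in> I" "a i \<noteq> 0 \<or> b i \<noteq> 0" using that by (auto simp: L_def)
    have "y i = 0 \<or> y i \<in> {5, 6} \<and> inert gs i \<or> y i \<in> {3, 4, 7, 8} \<and> once gs i"
      if "y \<in> {a, b}" for y
      by (rule exactD[OF ex that i(1)])
    from this[of a] this[of b]
    have "a i = 0 \<or> a i \<in> {5, 6} \<or> once gs i" "b i = 0 \<or> b i \<in> {5, 6} \<or> once gs i" by auto
    moreover have "a i \<in> {0, 3, 4}" "b i \<in> {0, 3, 4}" using ready i(1) by (simp_all add: ready_def)
    ultimately show ?thesis using i(2) by auto
  qed
  show ?thesis
  proof (cases "L = {}")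
    case True
    then have "a = b" by (intro U_ext[OF ab]) (auto simp: L_def)
    then show ?thesis using ab by (intro bexI[OF _ Vals.const[of b]]) auto
  next
    case False
    then have ne: "gs \<noteq> []" using once by (auto simp: once_def)
    then obtain x where x: "x \<in> reach (length gs)" "\<forall>i<length gs. w (x i)"
      using fills by (auto simp: fills_def)
    obtain c where c: "c \<in> U" "\<forall>i\<in>L. \<forall>j<length gs. (gs ! j) i = 1 \<longrightarrow> c i = x j"
      using gate_run[OF gsU ne _ _ x(1), of L] once by (auto simp: L_def)
    have cw: "9 \<le> c i \<and> w (c i)" if "i \<in> L" for i
    proof -
      obtain j where j: "j < length gs" "once_at gs i j"
        using once[OF \<open>i \<in> L\<close>] by (auto simp: once_def)
      then have "(gs ! j) i = 1" by (simp add: once_atD)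
      with j(1) show ?thesis using c(2) that x reach_range[OF x(1)] by simp
    qed
    let ?x = "\<lambda>s. if s then b else a"
    let ?f = "\<lambda>s. \<lambda>i\<in>I. c_op w (?x s i) (a i) (b i) (c i)"
    have "?f \<in> Vals B {?x}"
      using Vals_ops(4)[OF X Vals.gen Vals.const Vals.const Vals.const, of ?x a b c] ab c(1) by simp
    \<comment> \<open>The exchanged values are freshly written; sending them through the same gates
      and then through \<open>u_op\<close> makes them readable again on all of
      \<open>L\<close>.\<close>
    from Vals_chain[OF this X gsU] obtain h where
      h: "h \<in> Vals B {?x}" "\<forall>p. \<forall>i\<in>I. h p i = foldl (\<lambda>y g. f_op d 0 y (g i)) (?f p i) gs"
      by blast
    let ?h = "\<lambda>p. \<lambda>i\<in>I. u_op (h p i)"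
    have hV: "?h \<in> Vals B {?x}" by (rule Vals_ops(1)[OF X h(1)])
    have val: "?h s i = ?x (\<not> s) i" if i: "i \<in> I" for s i
    proof (cases "i \<in> L")
      case True
      have r: "a i \<in> {0, 3, 4}" "b i \<in> {0, 3, 4}" using ready i by (auto simp: ready_def)
      then have "?f s i = (if ?x (\<not> s) i = 0 then 0 else ?x (\<not> s) i + 2)"
        using i cw[OF True] by (auto simp: c_op_def tv_def Let_def)
      moreover have "?x (\<not> s) i \<in> {0, 3, 4}" using r by simp
      moreover have hi: "h s i = foldl (\<lambda>y g. f_op d 0 y (g i)) (?f s i) gs" using h(2) i by blast
      ultimately consider "h s i = foldl (\<lambda>y g. f_op d 0 y (g i)) 0 gs" "?x (\<not> s) i = 0"
        | "h s i = foldl (\<lambda>y g. f_op d 0 y (g i)) 5 gs" "?x (\<not> s) i = 3"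
        | "h s i = foldl (\<lambda>y g. f_op d 0 y (g i)) 6 gs" "?x (\<not> s) i = 4"
        by (elim insertE emptyE) simp_all
      then have "u_op (h s i) = ?x (\<not> s) i"
      proof cases
        case 1
        then show ?thesis unfolding 1(2) 1(1) f_op_chain(3) by (simp add: u_op_def)
      next
        case 2
        show ?thesis unfolding 2(2) unfolding 2(1) using f_op_chain(2)[OF once[OF True], of 5]
          by (simp add: u_op_def)
      next
        case 3
        show ?thesis unfolding 3(2) unfolding 3(1) using f_op_chain(2)[OF once[OF True], of 6]
          by (simp add: u_op_def)
      qed
      then show ?thesis using i by simp
    next
      case False
      then have "a i = 0" "b i = 0" using i by (auto simp: L_def)
      then show ?thesis using i h(2) f_op_chain(3)[of i gs] by (auto simp: c_op_def tv_def u_op_def Let_def)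
    qed
    show ?thesis
    proof (rule bexI[OF _ hV], rule conjI)
      show "?h False = b" using val Vals_U[OF hV X] ab by (intro U_ext) auto
      show "?h True = a" using val Vals_U[OF hV X] ab by (intro U_ext) auto
    qed
  qed
qed

section \<open>Polynomials in two variables and in one, evaluated at a pair of tuples\<close>

definition quad_gens :: "(nat \<Rightarrow> nat) \<Rightarrow> (nat \<Rightarrow> nat) \<Rightarrow> (bool \<times> bool \<Rightarrow> nat \<Rightarrow> nat) set" where
  "quad_gens z u = {\<lambda>p. if fst p then u else z, \<lambda>p. if snd p then u else z}"

definition pair_gens :: "(nat \<Rightarrow> nat) \<Rightarrow> (nat \<Rightarrow> nat) \<Rightarrow> (bool \<Rightarrow> nat \<Rightarrow> nat) set" where
  "pair_gens z u = {\<lambda>s. if s then u else z}"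

lemma quad_gens_U: "z \<in> U \<Longrightarrow> u \<in> U \<Longrightarrow> \<forall>x\<in>quad_gens z u. \<forall>p. x p \<in> U"
  by (auto simp: quad_gens_def)

lemma pair_gens_U: "z \<in> U \<Longrightarrow> u \<in> U \<Longrightarrow> \<forall>x\<in>pair_gens z u. \<forall>p. x p \<in> U"
  by (auto simp: pair_gens_def)

lemma xonly_gens: "f \<in> quad_gens z u \<Longrightarrow> xonly f \<or> yonly f"
  by (auto simp: quad_gens_def xonly_def yonly_def)

lemma f_op_values:
  assumes "q < 2" "y < n" shows "f_op d q y g \<in> {0, 5, 6, 7, 8} \<or> 9 \<le> f_op d q y g"
  using d_range[OF assms(1), of g y] assms(2) by (auto simp: f_op_def)

text \<open>No operation produces the values 1 and 2. They can come only from a generator, which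
  depends on a single variable, or from a constant.\<close>

lemma quad_not_gate:
  assumes zu: "z \<in> U" "u \<in> U" and \<phi>: "\<phi> \<in> Vals B (quad_gens z u)"
  shows "xonly \<phi> \<or> yonly \<phi> \<or> (\<forall>p. \<forall>i\<in>I. \<phi> p i \<notin> {1, 2})"
  using \<phi> quad_gens_U[OF zu]
proof (induction rule: Vals_ops_induct)
  case (gen f)
  then show ?case using xonly_gens by blast
next
  case (const c)
  then show ?case by (simp add: xonly_def)
next
  case (u_op f)
  have "u_op y \<notin> {1, 2}" for y using u_op_values[of y] by auto
  then show ?case by simp
next
  case (f_op q f g)
  have "f_op d q (f p i) (g p i) \<notin> {1, 2}" if "i \<in> I" for p i
    using f_op_values[OF f_op(1), of "f p i" "g p i"] U_less[OF Vals_U[OF f_op(2) quad_gens_U[OF zu]] that, of p]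
    by auto
  then show ?case by simp
next
  case (s_op f g h)
  have "s_op x y v \<notin> {1, 2}" for x y v using s_op_values[of x y v] by auto
  then show ?case by simp
next
  case (c_op f g h k)
  have "c_op w x y v h \<notin> {1, 2}" for x y v h using c_op_values[of w x y v h] by auto
  then show ?case by simp
qed

text \<open>If \<open>z\<close> and \<open>u\<close> show no gates, then only constants do. A gate
  that has any effect is therefore a fixed tuple and can be entered in a history.\<close>

lemma quad_const_or_not_gate:
  assumes zu: "z \<in> U" "u \<in> U" "\<forall>i\<in>I. z i \<notin> {1, 2} \<and> u i \<notin> {1, 2}"
    and \<phi>: "\<phi> \<in> Vals B (quad_gens z u)"
  shows "(\<exists>c\<in>U. \<phi> = (\<lambda>_. c)) \<or> (\<forall>p. \<forall>i\<in>I. \<phi> p i \<notin> {1, 2})"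
  using \<phi> quad_gens_U[OF zu(1,2)]
proof (induction rule: Vals_ops_induct)
  case (gen f)
  then have "f p = z \<or> f p = u" for p by (auto simp: quad_gens_def)
  then show ?case using zu(3) by metis
next
  case (const c)
  then show ?case by auto
next
  case (u_op f)
  have "u_op y \<notin> {1, 2}" for y using u_op_values[of y] by auto
  then show ?case by simp
next
  case (f_op q f g)
  have "f_op d q (f p i) (g p i) \<notin> {1, 2}" if "i \<in> I" for p i
    using f_op_values[OF f_op(1), of "f p i" "g p i"] U_less[OF Vals_U[OF f_op(2) quad_gens_U[OF zu(1,2)]] that, of p]
    by auto
  then show ?case by simp
next
  case (s_op f g h)
  have "s_op x y v \<notin> {1, 2}" for x y v using s_op_values[of x y v] by auto
  then show ?case by simp
next
  case (c_op f g h k)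
  have "c_op w x y v h \<notin> {1, 2}" for x y v h using c_op_values[of w x y v h] by auto
  then show ?case by simp
qed

lemma f_op_no_gate: "g \<notin> {1, 2} \<Longrightarrow> f_op d q y g = 0"
  by (auto simp: f_op_def)

lemma exact_u_op:
  assumes "exact gs Y" shows "exact gs ((\<lambda>y. \<lambda>i\<in>I. u_op (y i)) ` Y)"
proof (rule exactI[OF exact_gates[OF assms]])
  fix y' i assume "y' \<in> (\<lambda>y. \<lambda>i\<in>I. u_op (y i)) ` Y" and i: "i \<in> I"
  then obtain y where y: "y \<in> Y" "y' i = u_op (y i)" by auto
  consider "y i \<in> {0, 3, 4, 5, 6}" | "y i \<in> {7, 8}" "once gs i"
    using exactD[OF assms y(1) i] by auto
  then show "y' i = 0 \<or> y' i \<in> {5, 6} \<and> inert gs i \<or> y' i \<in> {3, 4, 7, 8} \<and> once gs i"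
    unfolding y(2) by cases (auto simp: u_op_def)
qed

text \<open>At a gate ready values die, waiting values keep waiting or become finished, and finished
  values survive only where the gate is idle. Each case agrees with the history extended by
  \<open>c\<close>.\<close>

lemma exact_f_op:
  assumes "exact gs Y" "c \<in> U"
  shows "exact (gs @ [c]) ((\<lambda>y. \<lambda>i\<in>I. f_op d 0 (y i) (c i)) ` Y)"
proof -
  have *: "f_op d 0 (y i) (c i) = 0 \<or> f_op d 0 (y i) (c i) \<in> {5, 6} \<and> inert (gs @ [c]) i \<or>
      f_op d 0 (y i) (c i) \<in> {3, 4, 7, 8} \<and> once (gs @ [c]) i" if "y \<in> Y" "i \<in> I" for y i
  proof -
    have "y i = 0 \<or> y i \<in> {5, 6} \<and> inert gs i \<or> y i \<in> {3, 4, 7, 8} \<and> once gs i"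
      by (rule exactD[OF assms(1) that])
    then consider "y i \<in> {0, 3, 4}" | "y i \<in> {5, 6}" "inert gs i" | "y i \<in> {7, 8}" "once gs i"
      by blast
    then show ?thesis
    proof cases
      case 1
      then show ?thesis by (auto simp: f_op_def)
    next
      case 2
      then show ?thesis unfolding inert_snoc once_snoc by (auto simp: f_op_def)
    next
      case 3
      then show ?thesis unfolding inert_snoc once_snoc by (auto simp: f_op_def)
    qed
  qed
  have "y' i = 0 \<or> y' i \<in> {5, 6} \<and> inert (gs @ [c]) i \<or> y' i \<in> {3, 4, 7, 8} \<and> once (gs @ [c]) i"
    if "y' \<in> (\<lambda>y. \<lambda>i\<in>I. f_op d 0 (y i) (c i)) ` Y" "i \<in> I" for y' i
  proof -
    obtain y where "y \<in> Y" "y' = (\<lambda>i\<in>I. f_op d 0 (y i) (c i))" using \<open>y' \<in> _\<close> by blast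
    moreover from this(2) have "y' i = f_op d 0 (y i) (c i)" using \<open>i \<in> I\<close> by simp
    ultimately show ?thesis using *[of y i] \<open>i \<in> I\<close> by simp
  qed
  moreover have "set (gs @ [c]) \<subseteq> U" using assms exact_gates by auto
  ultimately show ?thesis by (intro exactI)
qed

lemma xonly_const: "f = (\<lambda>_. c) \<Longrightarrow> xonly f"
  by (simp add: xonly_def)

lemma exact_written:
  assumes "\<And>p i. i \<in> I \<Longrightarrow> f p i \<in> {0, 5, 6}"
  shows "exact [] (range f)" "pending (f p)"
proof -
  show "exact [] (range f)"
  proof (rule exactI)
    fix y i assume "y \<in> range f" "i \<in> I"
    then obtain p where "y = f p" by blast
    then have "y i \<in> {0, 5, 6}" using assms[OF \<open>i \<in> I\<close>, of p] by simp
    then show "y i = 0 \<or> y i \<in> {5, 6} \<and> inert [] i \<or> y i \<in> {3, 4, 7, 8} \<and> once [] i"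
      by (auto simp: inert_def)
  qed simp
  show "pending (f p)" unfolding pending_def
  proof
    fix i assume "i \<in> I"
    from assms[OF this, of p] show "f p i \<in> {0, 5, 6, 7, 8}" by auto
  qed
qed

text \<open>Dependence on both variables can arise only in \<open>s_op\<close> or
  \<open>c_op\<close>, which write waiting values with the empty history. After that, a live value
  meets only constant gates, which extend the history, and \<open>u_op\<close>, which keeps
  it.\<close>

lemma quad_exact:
  assumes zu: "z \<in> U" "u \<in> U" "\<forall>i\<in>I. z i \<notin> {1, 2} \<and> u i \<notin> {1, 2}"
    and \<phi>: "\<phi> \<in> Vals B (quad_gens z u)"
  shows "xonly \<phi> \<or> yonly \<phi> \<or>
    (\<exists>gs. exact gs (range \<phi>)) \<and> ((\<forall>p. ready (\<phi> p)) \<or> (\<forall>p. pending (\<phi> p)))"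
  using \<phi> quad_gens_U[OF zu(1,2)]
proof (induction rule: Vals_ops_induct)
  case (gen f)
  then show ?case using xonly_gens by blast
next
  case (const c)
  then show ?case by (simp add: xonly_def)
next
  case (u_op f)
  show ?case
  proof (cases "xonly f \<or> yonly f")
    case True
    then show ?thesis unfolding xonly_def yonly_def by metis
  next
    case False
    then obtain gs where gs: "exact gs (range f)" using u_op by blast
    have "u_op y \<in> {0, 3, 4}" if "y \<in> {0, 3, 4, 5, 6, 7, 8}" for y using that by (auto simp: u_op_def)
    then have "ready (\<lambda>i\<in>I. u_op (f p i))" for p
      using exact_low[OF gs, of "f p"] by (simp add: ready_def)
    moreover have "exact gs (range (\<lambda>p. \<lambda>i\<in>I. u_op (f p i)))"
      using exact_u_op[OF gs] by (simp add: image_image)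
    ultimately show ?thesis by blast
  qed
next
  case (f_op q f g)
  show ?case
  \<comment> \<open>A gate argument that varies contains no gates at all, and then the result is
    dead.\<close>
  proof (cases "\<exists>c\<in>U. g = (\<lambda>_. c)")
    case False
    then have "\<forall>p. \<forall>i\<in>I. g p i \<notin> {1, 2}"
      using quad_const_or_not_gate[OF zu f_op(3)] by blast
    then have "f_op d q (f p i) (g p i) = 0" if "i \<in> I" for p i
      using that by (intro f_op_no_gate) blast
    then have "(\<lambda>p. \<lambda>i\<in>I. f_op d q (f p i) (g p i)) = (\<lambda>p. \<lambda>i\<in>I. 0)"
      by (intro ext) simp
    then show ?thesis by (intro disjI1 xonly_const)
  next
    case True
    then obtain c where c: "c \<in> U" "g = (\<lambda>_. c)" by blast
    show ?thesis
    proof (cases "xonly f \<or> yonly f")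
      case True
      then show ?thesis unfolding xonly_def yonly_def c by metis
    next
      case False
      then obtain gs where gs: "exact gs (range f)" using f_op by blast
      show ?thesis
      proof (cases "q = 0")
        case True
        have "f_op d 0 y e \<in> {0, 5, 6, 7, 8}" if "y \<in> {0, 3, 4, 5, 6, 7, 8}" for y e
          using that by (auto simp: f_op_def)
        then have "pending (\<lambda>i\<in>I. f_op d q (f p i) (g p i))" for p
          using exact_low[OF gs, of "f p"] True by (simp add: pending_def)
        moreover have "exact (gs @ [c]) (range (\<lambda>p. \<lambda>i\<in>I. f_op d q (f p i) (g p i)))"
          using exact_f_op[OF gs c(1)] True by (simp add: image_image c)
        ultimately show ?thesis by blast
      next
        case False
        \<comment> \<open>Move 1 acts on symbols only and kills every truth value.\<close>
        have f0: "f_op d q y e = 0" if "y \<in> {0, 3, 4, 5, 6, 7, 8}" for y e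
          using that False by (auto simp: f_op_def)
        have "f_op d q (f p i) (g p i) = 0" if "i \<in> I" for p i
          by (rule f0[OF exact_low[OF gs rangeI that]])
        then have "(\<lambda>p. \<lambda>i\<in>I. f_op d q (f p i) (g p i)) = (\<lambda>p. \<lambda>i\<in>I. 0)"
          by (intro ext) simp
        then show ?thesis by (intro disjI1 xonly_const)
      qed
    qed
  qed
next
  case (s_op f g h)
  have "(\<lambda>i\<in>I. s_op (f p i) (g p i) (h p i)) i \<in> {0, 5, 6}" if "i \<in> I" for p i
    using s_op_values that by simp
  from exact_written[of "\<lambda>p. \<lambda>i\<in>I. s_op (f p i) (g p i) (h p i)", OF this] show ?case by blast
next
  case (c_op f g h k)
  have "(\<lambda>i\<in>I. c_op w (f p i) (g p i) (h p i) (k p i)) i \<in> {0, 5, 6}" if "i \<in> I" for p i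
    using c_op_values that by simp
  from exact_written[of "\<lambda>p. \<lambda>i\<in>I. c_op w (f p i) (g p i) (h p i) (k p i)", OF this] show ?case by blast
qed

text \<open>For a meet, the values at \<open>(False, False)\<close> and \<open>(True, True)\<close>
  lie in the classes of \<open>z\<close> and \<open>u\<close>. Then the witness reverses the two
  classes, which a lattice forbids.\<close>

definition swappable :: "(nat \<Rightarrow> nat) \<Rightarrow> (nat \<Rightarrow> nat) \<Rightarrow> (bool \<times> bool \<Rightarrow> nat \<Rightarrow> nat) \<Rightarrow> bool" where
  "swappable z u f \<longleftrightarrow> (\<exists>\<psi>\<in>Vals B (pair_gens z u). \<psi> False = f (True, True) \<and> \<psi> True = f (False, False))"

lemma swappable_const:
  assumes "z \<in> U" "u \<in> U" "f \<in> Vals B (quad_gens z u)" "f = (\<lambda>_. c)"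
  shows "swappable z u f"
proof -
  have "c \<in> U" using Vals_U[OF assms(3) quad_gens_U[OF assms(1,2)]] assms(4) by simp
  then show ?thesis unfolding swappable_def assms(4) by (intro bexI[OF _ Vals.const[of c]]) auto
qed

lemma diag_Vals:
  assumes "f \<in> Vals B (quad_gens z u)"
  shows "(\<lambda>s. f (s, s)) \<in> Vals B (pair_gens z u)"
  using Vals_reindex[OF assms, of "\<lambda>s. (s, s)" "pair_gens z u"]
  by (auto simp: quad_gens_def pair_gens_def o_def)

lemma c_op_tv: "tv x = tv x' \<Longrightarrow> tv a = tv a' \<Longrightarrow> tv b = tv b' \<Longrightarrow> c_op w x a b h = c_op w x' a' b' h"
  by (simp add: c_op_def)

text \<open>The values of \<open>u_op\<close> are 0, 3, 4 and 9, and \<open>u_op\<close> keeps none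
  of these alive.\<close>

lemma zero_U: "f \<in> U \<Longrightarrow> (\<lambda>i\<in>I. 0) \<in> U"
proof -
  assume "f \<in> U"
  have "u_op (u_op y) = 0" for y by (simp add: u_op_def)
  moreover have "(\<lambda>i\<in>I. u_op ((\<lambda>i\<in>I. u_op (f i)) i)) \<in> U"
    by (intro op_U_simps(1)) fact
  moreover have "(\<lambda>i\<in>I. u_op ((\<lambda>i\<in>I. u_op (f i)) i)) = (\<lambda>i\<in>I. u_op (u_op (f i)))" by auto
  ultimately show ?thesis by simp
qed

text \<open>A nontrivial reversal is created at \<open>u_op\<close>: it turns a waiting value with a
  history into a ready one, to which \<open>ready_swap\<close> applies. The other operations keep a
  one-variable value waiting, carry reversals of their arguments along, or give the dead constant,
  which is trivially reversed.\<close>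

lemma quad_swappable:
  assumes zu: "z \<in> U" "u \<in> U" and ex: "exact gs0 {z, u}" and pend: "pending z" "pending u"
    and fills: "fills" and \<phi>: "\<phi> \<in> Vals B (quad_gens z u)"
  shows "(xonly \<phi> \<or> yonly \<phi>) \<and> (\<exists>gs. exact gs (range \<phi>)) \<and> (\<forall>p. pending (\<phi> p)) \<or> swappable z u \<phi>"
  using \<phi> quad_gens_U[OF zu]
proof (induction rule: Vals_ops_induct)
  note QU = quad_gens_U[OF zu] and PU = pair_gens_U[OF zu]
  have ng: "\<forall>i\<in>I. z i \<notin> {1, 2} \<and> u i \<notin> {1, 2}" using pend by (fastforce simp: pending_def)
  {
    case (gen f)
    then have zu': "f p = z \<or> f p = u" for p by (auto simp: quad_gens_def)
    then have "range f \<subseteq> {z, u}" by auto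
    from exact_mono[OF ex this] have "exact gs0 (range f)" .
    moreover have "\<forall>p. pending (f p)" using zu' pend by metis
    ultimately show ?case using xonly_gens[OF gen] by blast
  next
    case (const c)
    then have "(\<lambda>_. c) \<in> Vals B (quad_gens z u)" by (intro Vals.const) simp
    from swappable_const[OF zu this] show ?case by simp
  next
    case (u_op f)
    have uf: "(\<lambda>p. \<lambda>i\<in>I. u_op (f p i)) \<in> Vals B (quad_gens z u)" by (rule Vals_ops(1)[OF QU u_op(1)])
    from u_op(2) have "swappable z u (\<lambda>p. \<lambda>i\<in>I. u_op (f p i))"
    proof
      assume "swappable z u f"
      then obtain \<psi> where "\<psi> \<in> Vals B (pair_gens z u)" "\<psi> False = f (True, True)" "\<psi> True = f (False, False)"
        by (auto simp: swappable_def)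
      then show ?thesis unfolding swappable_def
        by (intro bexI[OF _ Vals_ops(1)[OF PU]]) auto
    next
      assume "(xonly f \<or> yonly f) \<and> (\<exists>gs. exact gs (range f)) \<and> (\<forall>p. pending (f p))"
      then obtain gs where gs: "exact gs (range f)" by blast
      let ?u = "\<lambda>p. \<lambda>i\<in>I. u_op (f p i)"
      let ?a = "?u (False, False)" and ?b = "?u (True, True)"
      have "exact gs {?a, ?b}"
        by (rule exact_mono[OF exact_u_op[OF gs]]) auto
      moreover have "u_op y \<in> {0, 3, 4}" if "y \<in> {0, 3, 4, 5, 6, 7, 8}" for y using that by (auto simp: u_op_def)
      then have "ready ?a" "ready ?b"
        using exact_low[OF gs, of "f (False, False)"] exact_low[OF gs, of "f (True, True)"]
        by (simp_all add: ready_def)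
      ultimately obtain \<psi> where \<psi>: "\<psi> \<in> Vals B {\<lambda>s. if s then ?b else ?a}" "\<psi> False = ?b" "\<psi> True = ?a"
        using ready_swap[OF _ _ _ _ _ fills, of ?a ?b gs] Vals_U[OF uf QU] by auto
      \<comment> \<open>The input of the exchanging polynomial is itself the diagonal of
        \<open>?u\<close>, so substitution yields a polynomial in the original variable.\<close>
      have "(\<lambda>s. if s then ?b else ?a) = (\<lambda>s. ?u (s, s))" by auto
      then have "{\<lambda>s. if s then ?b else ?a} \<subseteq> Vals B (pair_gens z u)"
        using diag_Vals[OF uf] by simp
      from Vals_Vals[OF \<psi>(1) this] show ?thesis using \<psi>(2,3) by (auto simp: swappable_def)
    qed
    then show ?case ..
  next
    case (f_op q f g)
    have fV: "(\<lambda>p. \<lambda>i\<in>I. f_op d q (f p i) (g p i)) \<in> Vals B (quad_gens z u)"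
      by (rule Vals_ops(2)[OF QU f_op(1-3)])
    show ?case
    proof (cases "\<exists>c\<in>U. g = (\<lambda>_. c)")
      case False
      then have "\<forall>p. \<forall>i\<in>I. g p i \<notin> {1, 2}"
        using quad_const_or_not_gate[OF zu ng f_op(3)] by blast
      then have "f_op d q (f p i) (g p i) = 0" if "i \<in> I" for p i
        using that by (intro f_op_no_gate) blast
      then have "(\<lambda>p. \<lambda>i\<in>I. f_op d q (f p i) (g p i)) = (\<lambda>p. \<lambda>i\<in>I. 0)"
        by (intro ext) simp
      then show ?thesis by (intro disjI2 swappable_const[OF zu fV])
    next
      case True
      then obtain c where c: "c \<in> U" "g = (\<lambda>_. c)" by blast
      from f_op(4) show ?thesis
      proof
        assume "swappable z u f"
        then obtain \<psi> where "\<psi> \<in> Vals B (pair_gens z u)" "\<psi> False = f (True, True)" "\<psi> True = f (False, False)"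
          by (auto simp: swappable_def)
        moreover have "(\<lambda>_. c) \<in> Vals B (pair_gens z u)" using c by (auto intro: Vals.const)
        ultimately have "swappable z u (\<lambda>p. \<lambda>i\<in>I. f_op d q (f p i) (g p i))"
          unfolding swappable_def c
          by (intro bexI[OF _ Vals_ops(2)[OF PU f_op(1), of \<psi> "\<lambda>_. c"]]) auto
        then show ?thesis ..
      next
        assume *: "(xonly f \<or> yonly f) \<and> (\<exists>gs. exact gs (range f)) \<and> (\<forall>p. pending (f p))"
        then obtain gs where gs: "exact gs (range f)" by blast
        show ?thesis
        proof (cases "q = 0")
          case True
          have "f_op d 0 y e \<in> {0, 5, 6, 7, 8}" if "y \<in> {0, 3, 4, 5, 6, 7, 8}" for y e
            using that by (auto simp: f_op_def)
          then have "pending (\<lambda>i\<in>I. f_op d q (f p i) (g p i))" for p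
            using exact_low[OF gs, of "f p"] True by (simp add: pending_def)
          moreover have "exact (gs @ [c]) (range (\<lambda>p. \<lambda>i\<in>I. f_op d q (f p i) (g p i)))"
            using exact_f_op[OF gs c(1)] True by (simp add: image_image c)
          moreover have "xonly (\<lambda>p. \<lambda>i\<in>I. f_op d q (f p i) (g p i)) \<or> yonly (\<lambda>p. \<lambda>i\<in>I. f_op d q (f p i) (g p i))"
            using * unfolding xonly_def yonly_def c by metis
          ultimately show ?thesis by blast
        next
          case False
          have f0: "f_op d q y e = 0" if "y \<in> {0, 3, 4, 5, 6, 7, 8}" for y e
            using that False by (auto simp: f_op_def)
          have "f_op d q (f p i) (g p i) = 0" if "i \<in> I" for p i
            by (rule f0[OF exact_low[OF gs rangeI that]])
          then have "(\<lambda>p. \<lambda>i\<in>I. f_op d q (f p i) (g p i)) = (\<lambda>p. \<lambda>i\<in>I. 0)"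
            by (intro ext) simp
          then show ?thesis by (intro disjI2 swappable_const[OF zu fV])
        qed
      qed
    qed
  next
    case (s_op f g h)
    have sV: "(\<lambda>p. \<lambda>i\<in>I. s_op (f p i) (g p i) (h p i)) \<in> Vals B (quad_gens z u)"
      by (rule Vals_ops(3)[OF QU s_op(1-3)])
    show ?case
    proof (cases "swappable z u f \<and> swappable z u g \<and> swappable z u h")
      case True
      then obtain f' where f': "f' \<in> Vals B (pair_gens z u)" "f' False = f (True, True)" "f' True = f (False, False)"
        unfolding swappable_def by blast
      obtain g' where g': "g' \<in> Vals B (pair_gens z u)" "g' False = g (True, True)" "g' True = g (False, False)"
        using True unfolding swappable_def by blast
      obtain h' where h': "h' \<in> Vals B (pair_gens z u)" "h' False = h (True, True)" "h' True = h (False, False)"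
        using True unfolding swappable_def by blast
      have "swappable z u (\<lambda>p. \<lambda>i\<in>I. s_op (f p i) (g p i) (h p i))"
        unfolding swappable_def
        by (intro bexI[OF _ Vals_ops(3)[OF PU f'(1) g'(1) h'(1)]]) (simp add: f' g' h')
      then show ?thesis ..
    next
      case False
      \<comment> \<open>A waiting argument is not readable for \<open>s_op\<close> and forces the
        dead constant.\<close>
      then have "(\<forall>p. pending (f p)) \<or> (\<forall>p. pending (g p)) \<or> (\<forall>p. pending (h p))" using s_op by blast
      moreover have "s_op x y v = 0" if "x \<in> {0,5,6,7,8} \<or> y \<in> {0,5,6,7,8} \<or> v \<in> {0,5,6,7,8}" for x y v
        using that by (auto simp: s_op_def)
      ultimately have "s_op (f p i) (g p i) (h p i) = 0" if "i \<in> I" for p i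
        using that unfolding pending_def by blast
      then have "(\<lambda>p. \<lambda>i\<in>I. s_op (f p i) (g p i) (h p i)) = (\<lambda>p. \<lambda>i\<in>I. 0)"
        by (intro ext) simp
      then show ?thesis by (intro disjI2 swappable_const[OF zu sV])
    qed
  next
    case (c_op f g h k)
    have cV: "(\<lambda>p. \<lambda>i\<in>I. c_op w (f p i) (g p i) (h p i) (k p i)) \<in> Vals B (quad_gens z u)"
      by (rule Vals_ops(4)[OF QU c_op(1-4)])
    \<comment> \<open>The arguments that \<open>c_op\<close> sees only through \<open>tv\<close>
      need not be reversed exactly: a waiting one reads as 0 and is replaced by the dead
      tuple.\<close>
    have tvs: "\<exists>\<psi>\<in>Vals B (pair_gens z u). \<forall>i\<in>I. tv (\<psi> False i) = tv (f (True, True) i) \<and>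
        tv (\<psi> True i) = tv (f (False, False) i)"
      if "(xonly f \<or> yonly f) \<and> (\<exists>gs. exact gs (range f)) \<and> (\<forall>p. pending (f p)) \<or> swappable z u f" for f
      using that
    proof
      assume "swappable z u f"
      then obtain \<psi> where "\<psi> \<in> Vals B (pair_gens z u)" "\<psi> False = f (True, True)" "\<psi> True = f (False, False)"
        unfolding swappable_def by blast
      then show ?thesis by (intro bexI[of _ \<psi>]) simp_all
    next
      assume *: "(xonly f \<or> yonly f) \<and> (\<exists>gs. exact gs (range f)) \<and> (\<forall>p. pending (f p))"
      have "tv y = 0" if "y \<in> {0, 5, 6, 7, 8}" for y using that by (auto simp: tv_def)
      then have "\<forall>p. \<forall>i\<in>I. tv (f p i) = 0" using * unfolding pending_def by blast
      moreover have "tv 0 = 0" by (simp add: tv_def)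
      ultimately show ?thesis
        using zero_U[OF zu(1)] by (intro bexI[OF _ Vals.const[of "\<lambda>i\<in>I. 0"]]) auto
    qed
    from c_op(8) have "swappable z u (\<lambda>p. \<lambda>i\<in>I. c_op w (f p i) (g p i) (h p i) (k p i))"
    proof
      assume "swappable z u k"
      then obtain k' where k: "k' \<in> Vals B (pair_gens z u)" "k' False = k (True, True)" "k' True = k (False, False)"
        by (auto simp: swappable_def)
      obtain f' where f': "f' \<in> Vals B (pair_gens z u)"
        "\<forall>i\<in>I. tv (f' False i) = tv (f (True, True) i) \<and> tv (f' True i) = tv (f (False, False) i)"
        using tvs[OF c_op(5)] by blast
      obtain g' where g': "g' \<in> Vals B (pair_gens z u)"
        "\<forall>i\<in>I. tv (g' False i) = tv (g (True, True) i) \<and> tv (g' True i) = tv (g (False, False) i)"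
        using tvs[OF c_op(6)] by blast
      obtain h' where h': "h' \<in> Vals B (pair_gens z u)"
        "\<forall>i\<in>I. tv (h' False i) = tv (h (True, True) i) \<and> tv (h' True i) = tv (h (False, False) i)"
        using tvs[OF c_op(7)] by blast
      let ?c = "\<lambda>s. \<lambda>i\<in>I. c_op w (f' s i) (g' s i) (h' s i) (k' s i)"
      have "?c False = (\<lambda>i\<in>I. c_op w (f (True, True) i) (g (True, True) i) (h (True, True) i) (k (True, True) i))"
        unfolding k(2) by (intro restrict_ext c_op_tv) (simp_all add: f' g' h')
      moreover have "?c True = (\<lambda>i\<in>I. c_op w (f (False, False) i) (g (False, False) i) (h (False, False) i) (k (False, False) i))"
        unfolding k(3) by (intro restrict_ext c_op_tv) (simp_all add: f' g' h')
      ultimately show ?thesis unfolding swappable_def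
        by (intro bexI[OF _ Vals_ops(4)[OF PU f'(1) g'(1) h'(1) k(1)]] conjI)
    next
      assume *: "(xonly k \<or> yonly k) \<and> (\<exists>gs. exact gs (range k)) \<and> (\<forall>p. pending (k p))"
      then have "\<not> 9 \<le> k p i" if "i \<in> I" for p i
      proof -
        have "pending (k p)" using * by blast
        then have "k p i \<in> {0, 5, 6, 7, 8}" using that unfolding pending_def by blast
        then show ?thesis by auto
      qed
      then have "c_op w (f p i) (g p i) (h p i) (k p i) = 0" if "i \<in> I" for p i
        using that by (simp add: c_op_def)
      then have "(\<lambda>p. \<lambda>i\<in>I. c_op w (f p i) (g p i) (h p i) (k p i)) = (\<lambda>p. \<lambda>i\<in>I. 0)"
        by (intro ext) simp
      then show ?thesis by (rule swappable_const[OF zu cV])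
    qed
    then show ?case ..
  }
qed

end

text \<open>From two tuples over bottom and top of the trace the lifted meet produces another such
  pair, whose members are values of a polynomial depending on both variables. Repeating this
  improves the pair until the classes can be exchanged.\<close>

theorem (in unit_machine) no_type4:
  assumes fills: "\<forall>k>0. \<exists>x\<in>reach k. \<forall>i<k. w (x i)"
  shows "Type4_lattice \<notin> typ_variety A"
proof
  assume "Type4_lattice \<in> typ_variety A"
  then obtain C :: "(nat, nat) alg" and \<alpha> \<beta> where C: "C \<in> HSP A" "finite (univ C)"
    "prime_quotient C \<alpha> \<beta>" "has_quotient_type C \<alpha> \<beta> Type4_lattice"
    by (auto simp: typ_variety_def typ_class_def)
  obtain I :: "nat set" where "hsp_over I A C" using C(1) unfolding HSP_def by blast
  then obtain U h where algC: "is_alg C" and U: "subuniverse (power_alg I A) U"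
    and hom: "surj_hom (subalg (power_alg I A) U) C h"
    unfolding hsp_over_def by blast
  interpret subpower n d w I U by unfold_locales (rule U)
  have hom: "surj_hom B C h" using hom by (simp add: B_def)
  have fill: fills unfolding fills_def by (rule fills)
  show False
  proof (rule type4_obstruction[OF algC C(2-4)])
  fix N a b p
  assume NC: "N \<subseteq> univ C" and p: "p \<in> Pol C 2"
    and pN: "\<And>x y. x \<in> N \<Longrightarrow> y \<in> N \<Longrightarrow> p [x, y] \<in> N"
    and ab: "a \<in> N" "b \<in> N" "(a, b) \<notin> \<alpha>"
    and "\<And>x. x \<in> N \<Longrightarrow> (x, a) \<in> \<alpha> \<or> (x, b) \<in> \<alpha>"
    and meet: "\<And>x y. x \<in> N \<Longrightarrow> y \<in> N \<Longrightarrow> (p [x, y], if (x, b) \<in> \<alpha> \<and> (y, b) \<in> \<alpha> then b else a) \<in> \<alpha>"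
    and noswap: "\<And>r x y. r \<in> Pol C 1 \<Longrightarrow> x \<in> N \<Longrightarrow> y \<in> N \<Longrightarrow> (x, a) \<in> \<alpha> \<Longrightarrow> (y, b) \<in> \<alpha> \<Longrightarrow>
      (r [x], b) \<in> \<alpha> \<Longrightarrow> (r [y], a) \<in> \<alpha> \<Longrightarrow> False"
  have eqa: "equiv (univ C) \<alpha>" using C(3) by (auto simp: prime_quotient_def Con_def)
  have not_ab: "(x, a) \<in> \<alpha> \<Longrightarrow> (x, b) \<in> \<alpha> \<Longrightarrow> False" for x
    using ab(3) eqa unfolding equiv_def sym_def trans_def by blast
  define good where "good z u \<longleftrightarrow> z \<in> U \<and> u \<in> U \<and> h z \<in> N \<and> h u \<in> N \<and> (h z, a) \<in> \<alpha> \<and> (h u, b) \<in> \<alpha>" for z u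
  \<comment> \<open>The lifted meet is over the top at \<open>(True, True)\<close> and over the
    bottom at the other three points, so it depends on both variables, and its diagonal is again a
    pair over bottom and top.\<close>
  have lift: "\<exists>\<phi>\<in>Vals B (quad_gens z u). \<not> xonly \<phi> \<and> \<not> yonly \<phi> \<and> good (\<phi> (False, False)) (\<phi> (True, True))"
    if g: "good z u" for z u
  proof -
    let ?X = "\<lambda>p. if fst p then u else z" and ?Y = "\<lambda>p. if snd p then u else z"
    have zu: "z \<in> U" "u \<in> U" "h z \<in> N" "h u \<in> N" "(h z, a) \<in> \<alpha>" "(h u, b) \<in> \<alpha>"
      using g by (auto simp: good_def)
    have "\<forall>x\<in>set [h \<circ> ?X, h \<circ> ?Y]. \<forall>p. x p \<in> univ C" using zu NC by auto
    from Vals_of_Pol[OF p algC _ this]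
    have "(\<lambda>q. p (map (\<lambda>x. x q) [h \<circ> ?X, h \<circ> ?Y])) \<in> Vals C (set [h \<circ> ?X, h \<circ> ?Y])" by simp
    moreover have "set [h \<circ> ?X, h \<circ> ?Y] = (\<lambda>x. h \<circ> x) ` quad_gens z u" by (simp add: quad_gens_def)
    moreover have "\<forall>x\<in>quad_gens z u. \<forall>p. x p \<in> univ B" using quad_gens_U[OF zu(1,2)] by simp
    ultimately obtain \<phi> where \<phi>: "\<phi> \<in> Vals B (quad_gens z u)"
      "(\<lambda>q. p (map (\<lambda>x. x q) [h \<circ> ?X, h \<circ> ?Y])) = h \<circ> \<phi>"
      using Vals_hom_lift[OF _ hom is_alg_B] by (metis (no_types, lifting))
    have val: "h (\<phi> (s, t)) = p [h (if s then u else z), h (if t then u else z)]" for s t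
      using fun_cong[OF \<phi>(2), of "(s, t)"] by simp
    have m: "(h (\<phi> (s, t)), if s \<and> t then b else a) \<in> \<alpha>" "h (\<phi> (s, t)) \<in> N" for s t
    proof -
      have "(h u, b) \<in> \<alpha>" "(h z, b) \<notin> \<alpha>" using zu not_ab by blast+
      then show "(h (\<phi> (s, t)), if s \<and> t then b else a) \<in> \<alpha>"
        using meet[of "h (if s then u else z)" "h (if t then u else z)"] zu unfolding val
        by (cases s; cases t) simp_all
      show "h (\<phi> (s, t)) \<in> N" unfolding val using zu by (intro pN) simp_all
    qed
    have ne: "\<phi> (True, False) \<noteq> \<phi> (True, True)" "\<phi> (False, True) \<noteq> \<phi> (True, True)"
      using m(1)[of True True] m(1)[of True False] m(1)[of False True] not_ab by auto
    have "\<not> xonly \<phi>" "\<not> yonly \<phi>" using ne unfolding xonly_def yonly_def by blast+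
    moreover have "\<phi> q \<in> U" for q using Vals_U[OF \<phi>(1) quad_gens_U[OF zu(1,2)]] .
    then have "good (\<phi> (False, False)) (\<phi> (True, True))"
      using m(1)[of False False] m(1)[of True True] m(2) by (simp add: good_def)
    ultimately show ?thesis using \<phi>(1) by blast
  qed
  \<comment> \<open>Pushed down to \<open>C\<close>, such a polynomial would exchange the two
    classes of the trace.\<close>
  have contra: False if g: "good z u" and \<psi>: "\<psi> \<in> Vals B (pair_gens z u)"
    and g': "good (\<psi> True) (\<psi> False)" for z u \<psi>
  proof -
    have zu: "z \<in> U" "u \<in> U" "h z \<in> N" "h u \<in> N" "(h z, a) \<in> \<alpha>" "(h u, b) \<in> \<alpha>"
      using g by (auto simp: good_def)
    have "\<forall>x\<in>pair_gens z u. \<forall>p. x p \<in> univ B" using pair_gens_U[OF zu(1,2)] by simp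
    from Vals_hom_image[OF \<psi> hom is_alg_B this]
    have "h \<circ> \<psi> \<in> Vals C (set [\<lambda>s. h (if s then u else z)])" by (simp add: pair_gens_def o_def)
    moreover have "\<forall>x\<in>set [\<lambda>s. h (if s then u else z)]. \<forall>p. x p \<in> univ C" using zu NC by auto
    ultimately obtain r where r: "r \<in> Pol C 1" "\<forall>s. (h \<circ> \<psi>) s = r [h (if s then u else z)]"
      using Pol_of_Vals[of "h \<circ> \<psi>" C "[\<lambda>s. h (if s then u else z)]"] by auto
    have "r [h z] = h (\<psi> False)" "r [h u] = h (\<psi> True)" using r(2)[rule_format, of False] r(2)[rule_format, of True] by simp_all
    then show False using noswap[OF r(1) zu(3-6)] g' by (simp add: good_def)
  qed
  have "a \<in> univ C" "b \<in> univ C" using ab NC by auto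
  then obtain z0 u0 where "z0 \<in> U" "u0 \<in> U" "h z0 = a" "h u0 = b"
    using hom B_simps(1) unfolding surj_hom_def by (metis imageE)
  moreover have "(a, a) \<in> \<alpha>" "(b, b) \<in> \<alpha>"
    using eqa \<open>a \<in> univ C\<close> \<open>b \<in> univ C\<close> by (auto simp: equiv_def refl_on_def)
  ultimately have g0: "good z0 u0" using ab by (simp add: good_def)
  \<comment> \<open>The first application of the meet removes all gates from the pair.\<close>
  obtain \<phi>0 where \<phi>0: "\<phi>0 \<in> Vals B (quad_gens z0 u0)" "\<not> xonly \<phi>0" "\<not> yonly \<phi>0"
    and g1: "good (\<phi>0 (False, False)) (\<phi>0 (True, True))"
    using lift[OF g0] by blast
  define z1 u1 where "z1 = \<phi>0 (False, False)" and "u1 = \<phi>0 (True, True)"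
  have "z0 \<in> U" "u0 \<in> U" using g0 by (auto simp: good_def)
  then have ng: "\<forall>i\<in>I. z1 i \<notin> {1, 2} \<and> u1 i \<notin> {1, 2}"
    using quad_not_gate[OF _ _ \<phi>0(1)] \<phi>0(2,3) unfolding z1_def u1_def by blast
  have g1: "good z1 u1" using g1 by (simp add: z1_def u1_def)
  \<comment> \<open>The second application gives both members a common history.\<close>
  obtain \<phi>1 where \<phi>1: "\<phi>1 \<in> Vals B (quad_gens z1 u1)" "\<not> xonly \<phi>1" "\<not> yonly \<phi>1"
    and g2: "good (\<phi>1 (False, False)) (\<phi>1 (True, True))"
    using lift[OF g1] by blast
  define z2 u2 where "z2 = \<phi>1 (False, False)" and "u2 = \<phi>1 (True, True)"
  have g2: "good z2 u2" using g2 by (simp add: z2_def u2_def)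
  have "z1 \<in> U" "u1 \<in> U" using g1 by (auto simp: good_def)
  then obtain gs where gs: "exact gs (range \<phi>1)" and rp: "(\<forall>p. ready (\<phi>1 p)) \<or> (\<forall>p. pending (\<phi>1 p))"
    using quad_exact[OF _ _ ng \<phi>1(1)] \<phi>1(2,3) by blast
  have ex: "exact gs {z2, u2}" by (rule exact_mono[OF gs]) (auto simp: z2_def u2_def)
  have zu2: "z2 \<in> U" "u2 \<in> U" using g2 by (auto simp: good_def)
  from rp show False
  proof
    assume "\<forall>p. ready (\<phi>1 p)"
    then have "ready z2" "ready u2" by (simp_all add: z2_def u2_def)
    from ready_swap[OF zu2 ex this fill] obtain \<psi> where
      "\<psi> \<in> Vals B (pair_gens z2 u2)" "\<psi> False = u2" "\<psi> True = z2"
      unfolding pair_gens_def by blast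
    then show False using contra[OF g2] g2 by metis
  next
    assume "\<forall>p. pending (\<phi>1 p)"
    then have pend: "pending z2" "pending u2" by (simp_all add: z2_def u2_def)
    \<comment> \<open>Waiting tuples cannot be exchanged directly. A third meet of them must have
      read them on the way, and the exchange is inserted at that point.\<close>
    obtain \<phi>2 where \<phi>2: "\<phi>2 \<in> Vals B (quad_gens z2 u2)" "\<not> xonly \<phi>2" "\<not> yonly \<phi>2"
      and g3: "good (\<phi>2 (False, False)) (\<phi>2 (True, True))"
      using lift[OF g2] by blast
    have "swappable z2 u2 \<phi>2" using quad_swappable[OF zu2 ex pend fill \<phi>2(1)] \<phi>2(2,3) by blast
    then obtain \<psi> where "\<psi> \<in> Vals B (pair_gens z2 u2)" "\<psi> False = \<phi>2 (True, True)" "\<psi> True = \<phi>2 (False, False)"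
      unfolding swappable_def by blast
    then show False using contra[OF g2] g3 by metis
  qed
  qed
qed

section \<open>The lattice type when some number of units never fills up\<close>

text \<open>The classes of the intended quotient of a subpower with \<open>k\<close> coordinates:
  tuples containing 0 and all runs collapse to \<open>Dead\<close>, and \<open>Mark v W\<close> is
  the value \<open>v\<close> touched so far at the coordinates in \<open>W\<close>.\<close>

datatype elt = Dead | Ready bool | Gate nat | Mark bool "nat set"

locale bounded_machine = unit_machine +
  fixes k :: nat
  assumes k0: "0 < k" and bounded: "\<And>x. x \<in> reach k \<Longrightarrow> \<exists>i<k. \<not> w (x i)"
begin

definition E :: "elt set" where
  "E = {Dead} \<union> range Ready \<union> Gate ` {..<k} \<union> (\<lambda>(v, W). Mark v W) ` (UNIV \<times> Pow {..<k})"

lemma E_simps [simp]: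
  "Dead \<in> E" "Ready v \<in> E" "Gate j \<in> E \<longleftrightarrow> j < k" "Mark v W \<in> E \<longleftrightarrow> W \<subseteq> {..<k}"
  by (auto simp: E_def)

lemma finite_E: "finite E"
  by (auto simp: E_def)

fun u_elt :: "elt \<Rightarrow> elt" where
  "u_elt (Mark v W) = (if W = {..<k} then Ready v else Dead)"
| "u_elt _ = Dead"

fun f_elt :: "elt \<Rightarrow> elt \<Rightarrow> elt" where
  "f_elt (Mark v W) (Gate j) = (if j \<in> W then Dead else Mark v (insert j W))"
| "f_elt _ _ = Dead"

fun s_elt :: "elt \<Rightarrow> elt \<Rightarrow> elt \<Rightarrow> elt" where
  "s_elt (Ready x) (Ready y) (Ready v) = Mark (v \<or> x \<and> y) {}"
| "s_elt _ _ _ = Dead"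

text \<open>Operation 2 keeps nothing but runs alive, and operation 4 is inert because no run uses
  up all \<open>k\<close> units; both are constantly \<open>Dead\<close>.\<close>

definition e_op :: "nat \<Rightarrow> elt list \<Rightarrow> elt" where
  "e_op s es = (if s = 0 then u_elt (es ! 0) else if s = 1 then f_elt (es ! 0) (es ! 1)
     else if s = 3 then s_elt (es ! 0) (es ! 1) (es ! 2) else Dead)"

lemma tuples_Cons: "xs \<in> tuples (Suc m) V \<longleftrightarrow> (\<exists>y ys. xs = y # ys \<and> y \<in> V \<and> ys \<in> tuples m V)"
  by (cases xs) (auto simp: tuples_def)

lemma tuples_0: "xs \<in> tuples 0 V \<longleftrightarrow> xs = []"
  by (auto simp: tuples_def)

lemmas tuples_simps = tuples_Cons tuples_0

lemma u_elt_E: "x \<in> E \<Longrightarrow> u_elt x \<in> E"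
  by (cases x) auto

lemma f_elt_E: "x \<in> E \<Longrightarrow> y \<in> E \<Longrightarrow> f_elt x y \<in> E"
  by (cases x; cases y) auto

lemma s_elt_E: "s_elt x y z \<in> E"
  by (cases x; cases y; cases z) auto

lemma e_op_E: "s < 5 \<Longrightarrow> es \<in> tuples (mach_rank s) E \<Longrightarrow> e_op s es \<in> E"
  by (auto simp: less_5 e_op_def tuples_simps eval_nat_numeral u_elt_E f_elt_E s_elt_E)

subsection \<open>The subalgebra of the power\<close>

fun val :: "elt \<Rightarrow> nat \<Rightarrow> nat" where
  "val Dead i = 0"
| "val (Ready v) i = (if v then 4 else 3)"
| "val (Gate j) i = (if i = j then 1 else 2)"
| "val (Mark v W) i = (if i \<in> W then 7 else 5) + (if v then 1 else 0)"

definition tup :: "elt \<Rightarrow> nat \<Rightarrow> nat" where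
  "tup e = restrict (val e) {..<k}"

text \<open>Tuples with a 0 absorb every failure. Runs must be included because \<open>u_op\<close>
  applied to a gate starts one.\<close>

definition U :: "(nat \<Rightarrow> nat) set" where
  "U = {f \<in> {..<k} \<rightarrow>\<^sub>E {..<n}. \<exists>i<k. f i = 0} \<union> tup ` (E - {Dead}) \<union> (\<lambda>x. restrict x {..<k}) ` reach k"

definition cls :: "(nat \<Rightarrow> nat) \<Rightarrow> elt" where
  "cls f = (if f \<in> tup ` (E - {Dead}) then inv_into (E - {Dead}) tup f else Dead)"

lemma tup_apply: "i < k \<Longrightarrow> tup e i = val e i"
  by (simp add: tup_def)

lemma val_inj:
  assumes "e \<in> E" "e' \<in> E" "\<And>i. i < k \<Longrightarrow> val e i = val e' i"
  shows "e = e'"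
proof -
  have 0: "val e 0 = val e' 0" using assms(3) k0 by simp
  show ?thesis
  proof (cases e)
    case Dead
    then show ?thesis using 0 by (cases e') (auto split: if_splits)
  next
    case (Ready v)
    then show ?thesis using 0 by (cases e') (auto split: if_splits)
  next
    case (Gate j)
    then have j: "j < k" using assms(1) by simp
    obtain j' where "e' = Gate j'" using 0 Gate by (cases e') (auto split: if_splits)
    then show ?thesis using assms(3)[OF j] Gate by (simp split: if_splits)
  next
    case (Mark v W)
    then obtain v' W' where e': "e' = Mark v' W'" using 0 by (cases e') (auto split: if_splits)
    have "v = v'" using 0 Mark e' by (auto split: if_splits)
    moreover have "i \<in> W \<longleftrightarrow> i \<in> W'" if "i < k" for i
      using assms(3)[OF that] Mark e' by (auto split: if_splits)
    then have "W = W'" using assms(1,2) Mark e' by auto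
    ultimately show ?thesis using Mark e' by simp
  qed
qed

lemma inj_tup: "inj_on tup E"
proof (rule inj_onI)
  fix e e' assume "e \<in> E" "e' \<in> E" "tup e = tup e'"
  moreover from this(3) have "val e i = val e' i" if "i < k" for i
    using that tup_apply by metis
  ultimately show "e = e'" using val_inj by blast
qed

lemma cls_tup: "e \<in> E \<Longrightarrow> e \<noteq> Dead \<Longrightarrow> cls (tup e) = e"
  using inj_on_subset[OF inj_tup, of "E - {Dead}"] by (simp add: cls_def)

lemma val_pos: "e \<noteq> Dead \<Longrightarrow> 0 < val e i"
  by (cases e) auto

lemma val_less_9: "val e i < 9"
  by (cases e) auto

lemma zero_mem: "f \<in> {..<k} \<rightarrow>\<^sub>E {..<n} \<Longrightarrow> i < k \<Longrightarrow> f i = 0 \<Longrightarrow> f \<in> U \<and> cls f = Dead"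
proof -
  assume f: "f \<in> {..<k} \<rightarrow>\<^sub>E {..<n}" "i < k" "f i = 0"
  have "f \<notin> tup ` (E - {Dead})"
  proof
    assume "f \<in> tup ` (E - {Dead})"
    then obtain e where "e \<noteq> Dead" "f = tup e" by blast
    then show False using f(2,3) val_pos[of e i] by (simp add: tup_apply)
  qed
  then show ?thesis using f by (auto simp: U_def cls_def)
qed

lemma tup_mem: "e \<in> E \<Longrightarrow> e \<noteq> Dead \<Longrightarrow> tup e \<in> U \<and> cls (tup e) = e"
  by (simp add: U_def cls_tup)

lemma reach_mem: "x \<in> reach k \<Longrightarrow> restrict x {..<k} \<in> U \<and> cls (restrict x {..<k}) = Dead"
proof -
  assume x: "x \<in> reach k"
  have "9 \<le> x 0" using reach_range[OF x k0] by simp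
  then have "restrict x {..<k} \<noteq> tup e" for e
    using val_less_9[of e 0] tup_apply[of 0 e] k0 by (metis leD lessThan_iff restrict_apply')
  then show ?thesis using x by (auto simp: U_def cls_def)
qed

lemma U_cases [consumes 1, case_names zero tup reach]:
  assumes "f \<in> U"
  obtains i where "i < k" "f i = 0" "cls f = Dead" "f \<in> {..<k} \<rightarrow>\<^sub>E {..<n}"
  | e where "e \<in> E" "e \<noteq> Dead" "f = tup e" "cls f = e"
  | x where "x \<in> reach k" "f = restrict x {..<k}" "cls f = Dead"
proof -
  from assms consider "f \<in> {..<k} \<rightarrow>\<^sub>E {..<n} \<and> (\<exists>i<k. f i = 0)" | "f \<in> tup ` (E - {Dead})"
    | "f \<in> (\<lambda>x. restrict x {..<k}) ` reach k"
    unfolding U_def by auto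
  then show thesis
  proof cases
    case 1
    then show ?thesis using that(1) zero_mem by blast
  next
    case 2
    then obtain e where "e \<in> E" "e \<noteq> Dead" "f = tup e" by blast
    then show ?thesis using that(2) tup_mem[of e] by simp
  next
    case 3
    then obtain x where "x \<in> reach k" "f = restrict x {..<k}" by blast
    then show ?thesis using that(3) reach_mem[of x] by simp
  qed
qed

lemma U_PiE:
  assumes "f \<in> U" shows "f \<in> {..<k} \<rightarrow>\<^sub>E {..<n}"
  using assms
proof (cases rule: U_cases)
  case (zero i)
  then show ?thesis by simp
next
  case (tup e)
  have "val e i < n" for i using n9 val_less_9[of e i] by simp
  then show ?thesis using tup by (simp add: tup_def)
next
  case (reach x)
  then show ?thesis using reach_range by auto
qed

lemma cls_E:
  assumes "f \<in> U" shows "cls f \<in> E"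
  using assms by (cases rule: U_cases) auto

definition behaves :: "(nat \<Rightarrow> nat) \<Rightarrow> elt \<Rightarrow> bool" where
  "behaves f e \<longleftrightarrow> f \<in> U \<and> cls f = e"

lemma behaves_zero:
  "(\<And>i. i < k \<Longrightarrow> f i < n) \<Longrightarrow> i < k \<Longrightarrow> f i = 0 \<Longrightarrow> behaves (restrict f {..<k}) Dead"
  unfolding behaves_def by (rule zero_mem[of _ i]) auto

lemma behaves_tup:
  "(\<And>i. i < k \<Longrightarrow> f i = val e i) \<Longrightarrow> e \<in> E \<Longrightarrow> e \<noteq> Dead \<Longrightarrow> behaves (restrict f {..<k}) e"
  using tup_mem[of e] restrict_ext[of "{..<k}" f "val e"] by (simp add: behaves_def tup_def)

lemma behaves_reach:
  "(\<And>i. i < k \<Longrightarrow> f i = x i) \<Longrightarrow> x \<in> reach k \<Longrightarrow> behaves (restrict f {..<k}) Dead"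
  using reach_mem[of x] restrict_ext[of "{..<k}" f x] by (simp add: behaves_def)

lemma U_lt: "f \<in> U \<Longrightarrow> i < k \<Longrightarrow> f i < n"
  using U_PiE by fastforce

lemma behaves_u:
  assumes f: "f \<in> U" shows "behaves (\<lambda>i\<in>{..<k}. u_op (f i)) (u_elt (cls f))"
proof -
  have lt: "u_op y < n" for y using u_op_values[of y] n9 by auto
  from f show ?thesis
  proof (cases rule: U_cases)
    case (zero i)
    then show ?thesis using behaves_zero[of "\<lambda>i. u_op (f i)" i] lt by (simp add: u_op_def)
  next
    case (reach x)
    then have "u_op (f 0) = 0" using reach_range[OF reach(1) k0] k0 by (simp add: u_op_def)
    then show ?thesis using behaves_zero[of "\<lambda>i. u_op (f i)" 0] lt k0 reach by simp
  next
    case (tup e)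
    show ?thesis
    proof (cases e)
      case (Ready v)
      then have "u_op (f 0) = 0" using tup k0 by (simp add: tup_apply u_op_def)
      then show ?thesis using behaves_zero[of "\<lambda>i. u_op (f i)" 0] lt k0 tup Ready by simp
    next
      case (Gate j)
      \<comment> \<open>On a gate \<open>u_op\<close> gives the initial symbol everywhere, which is
        the start of a run.\<close>
      have "behaves (\<lambda>i\<in>{..<k}. u_op (f i)) Dead"
        by (rule behaves_reach[OF _ reach.init]) (use tup Gate in \<open>simp add: tup_apply u_op_def\<close>)
      then show ?thesis using tup Gate by simp
    next
      case (Mark v W)
      show ?thesis
      proof (cases "W = {..<k}")
        case True
        have "behaves (\<lambda>i\<in>{..<k}. u_op (f i)) (Ready v)"
          by (rule behaves_tup) (use tup Mark True in \<open>auto simp: tup_apply u_op_def\<close>)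
        then show ?thesis using tup Mark True by simp
      next
        case False
        then obtain i where i: "i < k" "i \<notin> W" using tup Mark by auto
        then have "u_op (f i) = 0" using tup Mark by (simp add: tup_apply u_op_def)
        then show ?thesis using behaves_zero[of "\<lambda>i. u_op (f i)" i] lt i tup Mark False by simp
      qed
    qed (use tup in simp)
  qed
qed

lemma not_gate:
  assumes "g \<in> U" "\<And>j. cls g \<noteq> Gate j"
  shows "\<exists>i<k. g i \<notin> {1, 2}"
  using assms(1)
proof (cases rule: U_cases)
  case (tup e)
  then have "val e 0 \<notin> {1, 2}" using assms(2) by (cases e) auto
  then show ?thesis using tup k0 tup_apply by auto
next
  case (reach x)
  then show ?thesis using reach_range[OF reach(1) k0] k0 by (intro exI[of _ 0]) auto
qed auto

text \<open>\<open>Gate j\<close> touches coordinate \<open>j\<close> alone, so acting on a run it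
  is a move of the unit machine. The result is again a run or contains a 0, and both belong to
  \<open>Dead\<close>.\<close>

lemma behaves_f:
  assumes f: "f \<in> U" and g: "g \<in> U" and q: "q < 2"
  shows "behaves (\<lambda>i\<in>{..<k}. f_op d q (f i) (g i)) (if q = 0 then f_elt (cls f) (cls g) else Dead)"
proof -
  define r where "r = (if q = 0 then f_elt (cls f) (cls g) else Dead)"
  have lt: "f_op d q (f i) (g i) < n" if "i < k" for i using f_op_less[OF q U_lt[OF f that]] .
  have dead: "behaves (\<lambda>i\<in>{..<k}. f_op d q (f i) (g i)) r" if "i < k" "f_op d q (f i) (g i) = 0" "r = Dead" for i
    unfolding that(3) using behaves_zero[of "\<lambda>i. f_op d q (f i) (g i)" i] lt that by blast
  have "behaves (\<lambda>i\<in>{..<k}. f_op d q (f i) (g i)) r"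
  proof (cases "\<exists>j. cls g = Gate j")
    case False
    then obtain i where i: "i < k" "g i \<notin> {1, 2}" using not_gate[OF g] by blast
    have "f_elt (cls f) (cls g) = Dead" using False by (cases "cls f"; cases "cls g") auto
    then show ?thesis using i by (intro dead[of i]) (auto simp: f_op_def r_def)
  next
    case True
    then obtain j where j: "cls g = Gate j" by blast
    have gt: "g = tup (Gate j)" "j < k" using g j by (cases rule: U_cases; auto)+
    then have gi: "g i = (if i = j then 1 else 2)" if "i < k" for i using that by (simp add: tup_apply)
    from f show ?thesis
    proof (cases rule: U_cases)
      case (zero i)
      then show ?thesis by (intro dead[of i]) (auto simp: f_op_def r_def)
    next
      case (reach x)
      have fi: "f_op d q (f i) (g i) = d q (if i = j then 1 else 2) (x i)" if "i < k" for i
        using reach reach_range[OF reach(1) that] that gi[OF that] by (simp add: f_op_def)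
      have r: "r = Dead" using reach by (simp add: r_def)
      show ?thesis
      proof (cases "\<forall>i<k. d q (if i = j then 1 else 2) (x i) \<noteq> 0")
        case True
        show ?thesis unfolding r
          by (rule behaves_reach[OF fi reach.step[OF reach(1) gt(2) q True]])
      next
        case False
        then obtain i where "i < k" "d q (if i = j then 1 else 2) (x i) = 0" by blast
        then show ?thesis using r by (intro dead[of i]) (simp_all add: fi)
      qed
    next
      case (tup e)
      show ?thesis
      proof (cases e)
        case Dead
        then show ?thesis using tup by simp
      next
        case (Ready v)
        have "r = Dead" using tup Ready by (simp add: r_def)
        then show ?thesis
          by (intro dead[OF k0]) (use k0 tup Ready in \<open>auto simp: tup_apply f_op_def\<close>)
      next
        case (Gate l)
        have "r = Dead" using tup Gate by (simp add: r_def)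
        then show ?thesis
          by (intro dead[OF k0]) (use k0 tup Gate in \<open>auto simp: tup_apply f_op_def\<close>)
      next
        case (Mark v W)
        have fi: "f i = (if i \<in> W then 7 else 5) + (if v then 1 else 0)" if "i < k" for i
          using tup Mark that by (simp add: tup_apply)
        show ?thesis
        proof (cases "q = 0 \<and> j \<notin> W")
          case False
          then have "f_op d q (f j) (g j) = 0" using fi[OF gt(2)] gi[OF gt(2)] by (auto simp: f_op_def)
          moreover have "r = Dead" using False tup Mark j by (auto simp: r_def)
          ultimately show ?thesis by (intro dead[OF gt(2)])
        next
          case True
          have "r = Mark v (insert j W)" using tup Mark True j by (simp add: r_def)
          moreover have "behaves (\<lambda>i\<in>{..<k}. f_op d q (f i) (g i)) (Mark v (insert j W))"
          proof (rule behaves_tup)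
            fix i assume "i < k"
            from fi[OF this] gi[OF this] show "f_op d q (f i) (g i) = val (Mark v (insert j W)) i"
              using True by (auto simp: f_op_def)
          qed (use tup Mark gt in auto)
          ultimately show ?thesis by simp
        qed
      qed
    qed
  qed
  then show ?thesis by (simp only: r_def)
qed

lemma not_ready:
  assumes "g \<in> U" "\<And>v. cls g \<noteq> Ready v"
  shows "\<exists>i<k. g i \<notin> {3, 4}"
  using assms(1)
proof (cases rule: U_cases)
  case (tup e)
  then have "val e 0 \<notin> {3, 4}" using assms(2) by (cases e) auto
  then show ?thesis using tup k0 tup_apply by auto
next
  case (reach x)
  then show ?thesis using reach_range[OF reach(1) k0] k0 by (intro exI[of _ 0]) auto
qed auto

lemma ready_apply:
  assumes "g \<in> U" "cls g = Ready v" "i < k" shows "g i = (if v then 4 else 3)"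
  using assms by (cases rule: U_cases) (auto simp: tup_apply)

lemma behaves_s:
  assumes f: "f \<in> U" and g: "g \<in> U" and h: "h \<in> U"
  shows "behaves (\<lambda>i\<in>{..<k}. s_op (f i) (g i) (h i)) (s_elt (cls f) (cls g) (cls h))"
proof (cases "(\<exists>a. cls f = Ready a) \<and> (\<exists>b. cls g = Ready b) \<and> (\<exists>c. cls h = Ready c)")
  case True
  then obtain a b c where abc: "cls f = Ready a" "cls g = Ready b" "cls h = Ready c" by blast
  have "behaves (\<lambda>i\<in>{..<k}. s_op (f i) (g i) (h i)) (Mark (c \<or> a \<and> b) {})"
    by (rule behaves_tup)
      (use ready_apply[OF f abc(1)] ready_apply[OF g abc(2)] ready_apply[OF h abc(3)] in \<open>auto simp: s_op_def\<close>)
  then show ?thesis using abc by simp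
next
  case False
  then obtain i where "i < k" "f i \<notin> {3, 4} \<or> g i \<notin> {3, 4} \<or> h i \<notin> {3, 4}"
    using not_ready[OF f] not_ready[OF g] not_ready[OF h] by metis
  moreover have "s_op x y z < n" for x y z using s_op_values[of x y z] n9 by auto
  ultimately have "behaves (\<lambda>i\<in>{..<k}. s_op (f i) (g i) (h i)) Dead"
    by (intro behaves_zero[of _ i]) (auto simp: s_op_def)
  moreover have "s_elt (cls f) (cls g) (cls h) = Dead"
    using False by (cases "cls f"; cases "cls g"; cases "cls h") auto
  ultimately show ?thesis by simp
qed

lemma behaves_c:
  assumes f: "f \<in> U" and g: "g \<in> U" and h: "h \<in> U" and l: "l \<in> U"
  shows "behaves (\<lambda>i\<in>{..<k}. c_op w (f i) (g i) (h i) (l i)) Dead"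
proof -
  have "\<exists>i<k. \<not> (9 \<le> l i \<and> w (l i))"
    using l
  proof (cases rule: U_cases)
    case (tup e)
    then show ?thesis using val_less_9[of e 0] k0 by (intro exI[of _ 0]) (auto simp: tup_apply)
  next
    case (reach x)
    then show ?thesis using bounded by auto
  qed auto
  then obtain i where i: "i < k" "\<not> (9 \<le> l i \<and> w (l i))" by blast
  have "c_op w x y z v < n" for x y z v using c_op_values[of w x y z v] n9 by auto
  then show ?thesis using i by (intro behaves_zero[of _ i]) (auto simp: c_op_def)
qed

lemma behaves_op:
  assumes s: "s < 5" and fs: "fs \<in> tuples (mach_rank s) U"
  shows "behaves (\<lambda>i\<in>{..<k}. mach_op d w s (map (\<lambda>f. f i) fs)) (e_op s (map cls fs))"
proof -
  have l: "length fs = mach_rank s" and m: "fs ! j \<in> U" if "j < mach_rank s" for j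
    using fs that by (auto simp: tuples_def)
  have l: "length fs = mach_rank s" using fs by (simp add: tuples_def)
  consider "s = 0" | "s = 1" | "s = 2" | "s = 3" | "s = 4" using s by (auto simp: less_5)
  then show ?thesis
  proof cases
    case 1
    then show ?thesis using behaves_u[of "fs ! 0"] m l by (simp add: mach_op_def e_op_def)
  next
    case 2
    then show ?thesis using behaves_f[of "fs ! 0" "fs ! 1" 0] m l by (simp add: mach_op_def e_op_def)
  next
    case 3
    then show ?thesis using behaves_f[of "fs ! 0" "fs ! 1" 1] m l by (simp add: mach_op_def e_op_def)
  next
    case 4
    then show ?thesis using behaves_s[of "fs ! 0" "fs ! 1" "fs ! 2"] m l by (simp add: mach_op_def e_op_def)
  next
    case 5
    then show ?thesis using behaves_c[of "fs ! 0" "fs ! 1" "fs ! 2" "fs ! 3"] m l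
      by (simp add: mach_op_def e_op_def)
  qed
qed

subsection \<open>The quotient\<close>

text \<open>\<open>typ_variety\<close> admits only algebras over \<open>nat\<close>, so the quotient
  receives an arbitrary injective numbering.\<close>

definition code :: "elt \<Rightarrow> nat" where
  "code = (SOME c. inj_on c E)"

lemma inj_code: "inj_on code E"
proof -
  have "\<exists>c :: elt \<Rightarrow> nat. inj_on c E" using finite_imp_inj_to_nat_seg[OF finite_E] by blast
  then show ?thesis unfolding code_def by (rule someI_ex)
qed

definition decode :: "nat \<Rightarrow> elt" where "decode = inv_into E code"

lemma decode_code [simp]: "e \<in> E \<Longrightarrow> decode (code e) = e"
  using inj_code by (simp add: decode_def)

lemma code_eq [simp]: "e \<in> E \<Longrightarrow> e' \<in> E \<Longrightarrow> code e = code e' \<longleftrightarrow> e = e'"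
  using inj_code by (auto simp: inj_on_def)

definition C :: "(nat, nat) alg" where
  "C = \<lparr>univ = code ` E, symbs = {..<5}, rank = mach_rank,
     interp = (\<lambda>s xs. code (e_op s (map decode xs)))\<rparr>"

lemma C_simps [simp]: "univ C = code ` E" "symbs C = {..<5}" "rank C = mach_rank"
  by (simp_all add: C_def)

lemma map_code_tuples: "es \<in> tuples m E \<Longrightarrow> map code es \<in> tuples m (code ` E)"
  by (auto simp: tuples_def)

lemma tuples_codeE:
  assumes "xs \<in> tuples m (code ` E)" obtains es where "es \<in> tuples m E" "xs = map code es"
proof (rule that)
  show "map decode xs \<in> tuples m E" using assms by (auto simp: tuples_def)
  have "map (\<lambda>x. code (decode x)) xs = map (\<lambda>x. x) xs"
    using assms by (intro map_cong) (auto simp: tuples_def)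
  then show "xs = map code (map decode xs)" by (simp add: o_def)
qed

lemma interp_C: "s < 5 \<Longrightarrow> es \<in> tuples (mach_rank s) E \<Longrightarrow> interp C s (map code es) = code (e_op s es)"
proof -
  assume "es \<in> tuples (mach_rank s) E"
  then have "map decode (map code es) = es" by (auto simp: tuples_def intro!: map_idI)
  then show ?thesis by (simp add: C_def)
qed

lemma is_alg_C: "is_alg C"
proof -
  have "interp C s xs \<in> code ` E" if "s < 5" "xs \<in> tuples (mach_rank s) (code ` E)" for s xs
    using that(2) by (rule tuples_codeE) (use that(1) interp_C e_op_E in auto)
  then show ?thesis by (auto simp: is_alg_def closed_under_def intro: exI[of _ Dead] E_simps(1))
qed

lemma hsp_C: "hsp_over {..<k} A C"
proof -
  have pow: "interp (power_alg {..<k} A) s fs = (\<lambda>i\<in>{..<k}. mach_op d w s (map (\<lambda>f. f i) fs))"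
    if "s < 5" "fs \<in> tuples (mach_rank s) U" for s fs
  proof -
    have "map (\<lambda>f. f i) fs \<in> tuples (mach_rank s) {..<n}" if "i < k" for i
      using \<open>fs \<in> _\<close> that U_lt by (auto simp: tuples_def)
    then show ?thesis using that(1) by (auto simp: power_alg_def)
  qed
  have "U \<noteq> {}" using tup_mem[of "Ready True"] by auto
  then have "subuniverse (power_alg {..<k} A) U"
    using U_PiE pow behaves_op
    by (auto simp: subuniverse_def closed_under_def power_alg_def[of "{..<k}" A, THEN arg_cong, of univ]
        power_alg_def[of "{..<k}" A, THEN arg_cong, of symbs] power_alg_def[of "{..<k}" A, THEN arg_cong, of rank]
        behaves_def)
  moreover have "surj_hom (subalg (power_alg {..<k} A) U) C (\<lambda>f. code (cls f))"
  proof -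
    have "cls ` U = E"
    proof
      show "cls ` U \<subseteq> E" using cls_E by blast
      have "behaves (\<lambda>i\<in>{..<k}. 0) Dead" using behaves_zero[of "\<lambda>_. 0" 0] n9 k0 by simp
      then have "Dead \<in> cls ` U" unfolding behaves_def by (metis imageI)
      moreover have "e \<in> cls ` U" if "e \<in> E" "e \<noteq> Dead" for e
        using tup_mem[OF that] by (metis imageI)
      ultimately show "E \<subseteq> cls ` U" by blast
    qed
    then have im: "(\<lambda>f. code (cls f)) ` U = code ` E" by (simp flip: image_image)
    have op: "code (cls (interp (power_alg {..<k} A) s fs)) = interp C s (map (\<lambda>f. code (cls f)) fs)"
      if "s < 5" "fs \<in> tuples (mach_rank s) U" for s fs
    proof -
      have "map cls fs \<in> tuples (mach_rank s) E" using that cls_E by (auto simp: tuples_def)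
      from interp_C[OF that(1) this] have "interp C s (map (\<lambda>f. code (cls f)) fs) = code (e_op s (map cls fs))"
        by (simp add: o_def)
      then show ?thesis using behaves_op[OF that] pow[OF that] by (simp add: behaves_def)
    qed
    have [simp]: "symbs (power_alg {..<k} A) = {..<5}" "rank (power_alg {..<k} A) = rank A"
      by (simp_all add: power_alg_def)
    show ?thesis using im op by (simp add: surj_hom_def subalg_def)
  qed
  ultimately show ?thesis using is_alg_C unfolding hsp_over_def by blast
qed

end

section \<open>The congruence that forgets truth values is an atom\<close>

context bounded_machine
begin

fun shape :: "elt \<Rightarrow> elt" where
  "shape (Ready v) = Ready False"
| "shape (Mark v W) = Mark False W"
| "shape e = e"

lemma shape_u: "shape (u_elt x) = shape (u_elt (shape x))"
  by (cases x) auto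

lemma shape_f: "shape (f_elt x y) = shape (f_elt (shape x) (shape y))"
  by (cases x; cases y) auto

lemma shape_s: "shape (s_elt x y z) = shape (s_elt (shape x) (shape y) (shape z))"
  by (cases x; cases y; cases z) auto

definition \<beta> :: "(nat \<times> nat) set" where
  "\<beta> = {(code e, code e') | e e'. e \<in> E \<and> e' \<in> E \<and> shape e = shape e'}"

lemma beta_iff [simp]: "e \<in> E \<Longrightarrow> e' \<in> E \<Longrightarrow> (code e, code e') \<in> \<beta> \<longleftrightarrow> shape e = shape e'"
  unfolding \<beta>_def using code_eq by blast

lemma betaE:
  assumes "(x, y) \<in> \<beta>"
  obtains e e' where "x = code e" "y = code e'" "e \<in> E" "e' \<in> E" "shape e = shape e'"
  using assms unfolding \<beta>_def by blast

lemma con_op: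
  assumes "\<gamma> \<in> Con C" "s < 5" "es \<in> tuples (mach_rank s) E" "es' \<in> tuples (mach_rank s) E"
    "list_all2 (\<lambda>e e'. (code e, code e') \<in> \<gamma>) es es'"
  shows "(code (e_op s es), code (e_op s es')) \<in> \<gamma>"
proof -
  have "list_all2 (\<lambda>x y. (x, y) \<in> \<gamma>) (map code es) (map code es')"
    using assms(5) by (simp add: list_all2_map1 list_all2_map2)
  then have "(interp C s (map code es), interp C s (map code es')) \<in> \<gamma>"
    using assms(1,2) map_code_tuples[OF assms(3)] map_code_tuples[OF assms(4)] by (simp add: Con_def)
  then show ?thesis using interp_C assms by simp
qed

lemma e_op_shape:
  assumes "s < 5" "length es = mach_rank s" "length es' = mach_rank s"
    "\<And>j. j < mach_rank s \<Longrightarrow> shape (es ! j) = shape (es' ! j)"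
  shows "shape (e_op s es) = shape (e_op s es')"
proof -
  consider "s = 0" | "s = 1" | "s = 2" | "s = 3" | "s = 4" using assms(1) by (auto simp: less_5)
  then show ?thesis
  proof cases
    case 1
    then have "shape (es ! 0) = shape (es' ! 0)" using assms(4) by simp
    then show ?thesis using 1 shape_u[of "es ! 0"] shape_u[of "es' ! 0"] by (simp add: e_op_def)
  next
    case 2
    then have "shape (es ! 0) = shape (es' ! 0)" "shape (es ! 1) = shape (es' ! 1)" using assms(4) by simp_all
    then show ?thesis using 2 shape_f[of "es ! 0" "es ! 1"] shape_f[of "es' ! 0" "es' ! 1"] by (simp add: e_op_def)
  next
    case 4
    then have "shape (es ! 0) = shape (es' ! 0)" "shape (es ! 1) = shape (es' ! 1)" "shape (es ! 2) = shape (es' ! 2)"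
      using assms(4) by simp_all
    then show ?thesis using 4 shape_s[of "es ! 0" "es ! 1" "es ! 2"] shape_s[of "es' ! 0" "es' ! 1" "es' ! 2"]
      by (simp add: e_op_def)
  qed (simp_all add: e_op_def)
qed

lemma beta_Con: "\<beta> \<in> Con C"
proof -
  have "equiv (code ` E) \<beta>"
  proof (rule equivI)
    show "\<beta> \<subseteq> code ` E \<times> code ` E" by (auto simp: \<beta>_def)
    show "refl_on (code ` E) \<beta>" by (auto simp: refl_on_def)
    show "sym \<beta>" by (auto simp: sym_def elim!: betaE)
    show "trans \<beta>"
    proof (rule transI)
      fix x y z assume "(x, y) \<in> \<beta>" "(y, z) \<in> \<beta>"
      then show "(x, z) \<in> \<beta>" by (elim betaE) simp
    qed
  qed
  moreover have "(interp C s xs, interp C s ys) \<in> \<beta>"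
    if s: "s < 5" and xs: "xs \<in> tuples (mach_rank s) (code ` E)" and ys: "ys \<in> tuples (mach_rank s) (code ` E)"
      and l: "list_all2 (\<lambda>x y. (x, y) \<in> \<beta>) xs ys" for s xs ys
  proof -
    obtain es where es: "es \<in> tuples (mach_rank s) E" "xs = map code es" using xs by (rule tuples_codeE)
    obtain es' where es': "es' \<in> tuples (mach_rank s) E" "ys = map code es'" using ys by (rule tuples_codeE)
    have len: "length es = mach_rank s" "length es' = mach_rank s" and
      mem: "\<And>j. j < mach_rank s \<Longrightarrow> es ! j \<in> E \<and> es' ! j \<in> E"
      using es(1) es'(1) by (auto simp: tuples_def)
    have "(code (es ! j), code (es' ! j)) \<in> \<beta>" if "j < mach_rank s" for j
      using l len that unfolding es es' list_all2_conv_all_nth by simp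
    then have "shape (e_op s es) = shape (e_op s es')"
      using mem by (intro e_op_shape s len) simp
    then show ?thesis unfolding es(2) es'(2) interp_C[OF s es(1)] interp_C[OF s es'(1)]
      using e_op_E[OF s es(1)] e_op_E[OF s es'(1)] by simp
  qed
  ultimately show ?thesis by (simp add: Con_def)
qed

lemma Id_Con: "Id_on (code ` E) \<in> Con C"
proof -
  have "equiv (code ` E) (Id_on (code ` E))"
    by (rule equivI) (auto simp: refl_on_def sym_def trans_def)
  moreover have "xs = ys" if "list_all2 (\<lambda>x y. (x, y) \<in> Id_on (code ` E)) xs ys" for xs ys
    using that by (induction rule: list_all2_induct) auto
  moreover have "interp C s xs \<in> code ` E" if "s < 5" "xs \<in> tuples (mach_rank s) (code ` E)" for s xs
    using is_alg_C that by (simp add: is_alg_def closed_under_def)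
  ultimately show ?thesis by (fastforce simp: Con_def)
qed

lemma tuples_in:
  "[x] \<in> tuples (mach_rank 0) E \<longleftrightarrow> x \<in> E" "[x, y] \<in> tuples (mach_rank 1) E \<longleftrightarrow> x \<in> E \<and> y \<in> E"
  "[x, y, z] \<in> tuples (mach_rank 3) E \<longleftrightarrow> x \<in> E \<and> y \<in> E \<and> z \<in> E"
  by (auto simp: tuples_def)

lemma con_ops:
  assumes "\<gamma> \<in> Con C"
  shows "x \<in> E \<Longrightarrow> x' \<in> E \<Longrightarrow> (code x, code x') \<in> \<gamma> \<Longrightarrow> (code (u_elt x), code (u_elt x')) \<in> \<gamma>"
    "x \<in> E \<Longrightarrow> x' \<in> E \<Longrightarrow> (code x, code x') \<in> \<gamma> \<Longrightarrow> j < k \<Longrightarrow>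
      (code (f_elt x (Gate j)), code (f_elt x' (Gate j))) \<in> \<gamma>"
    "x \<in> E \<Longrightarrow> x' \<in> E \<Longrightarrow> (code x, code x') \<in> \<gamma> \<Longrightarrow>
      (code (s_elt x x x), code (s_elt x' x' x')) \<in> \<gamma>"
proof -
  have refl: "(code e, code e) \<in> \<gamma>" if "e \<in> E" for e
    using assms that by (auto simp: Con_def equiv_def refl_on_def)
  show "x \<in> E \<Longrightarrow> x' \<in> E \<Longrightarrow> (code x, code x') \<in> \<gamma> \<Longrightarrow> (code (u_elt x), code (u_elt x')) \<in> \<gamma>"
    using con_op[OF assms, of 0 "[x]" "[x']"] tuples_in(1) by (simp add: e_op_def)
  show "x \<in> E \<Longrightarrow> x' \<in> E \<Longrightarrow> (code x, code x') \<in> \<gamma> \<Longrightarrow> j < k \<Longrightarrow>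
      (code (f_elt x (Gate j)), code (f_elt x' (Gate j))) \<in> \<gamma>"
    using con_op[OF assms, of 1 "[x, Gate j]" "[x', Gate j]"] tuples_in(2) refl[of "Gate j"]
    by (simp add: e_op_def)
  show "x \<in> E \<Longrightarrow> x' \<in> E \<Longrightarrow> (code x, code x') \<in> \<gamma> \<Longrightarrow>
      (code (s_elt x x x), code (s_elt x' x' x')) \<in> \<gamma>"
    using con_op[OF assms, of 3 "[x, x, x]" "[x', x', x']"] tuples_in(3)
    by (simp add: e_op_def)
qed

text \<open>The gates of the missing coordinates are applied one by one; none of them has touched
  before.\<close>

lemma con_mark_mono:
  assumes \<gamma>: "\<gamma> \<in> Con C" and W: "W \<subseteq> W'" "W' \<subseteq> {..<k}"
    and m: "(code (Mark v W), code (Mark v' W)) \<in> \<gamma>"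
  shows "(code (Mark v W'), code (Mark v' W')) \<in> \<gamma>"
proof -
  have "finite (W' - W)" using W(2) finite_subset by blast
  have "(code (Mark v W'), code (Mark v' W')) \<in> \<gamma>"
    if "finite V" "W \<subseteq> W'" "W' - W = V" "(code (Mark v W), code (Mark v' W)) \<in> \<gamma>" for V W
    using that
  proof (induction V arbitrary: W rule: finite_induct)
    case empty
    then have "W = W'" by blast
    then show ?case using empty by simp
  next
    case (insert j V)
    have j: "j \<in> W'" "j \<notin> W" "j < k" using insert.prems(2) W(2) by auto
    have Wk: "W \<subseteq> {..<k}" using insert.prems(1) W(2) by blast
    have "(code (f_elt (Mark v W) (Gate j)), code (f_elt (Mark v' W) (Gate j))) \<in> \<gamma>"
      using insert.prems(3) j Wk by (intro con_ops(2)[OF \<gamma>]) simp_all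
    then have "(code (Mark v (insert j W)), code (Mark v' (insert j W))) \<in> \<gamma>" using j by simp
    moreover have "W' - insert j W = V" "insert j W \<subseteq> W'" using insert j by auto
    ultimately show ?case using insert.IH[of "insert j W"] insert.prems by blast
  qed
  from this[OF \<open>finite (W' - W)\<close> W(1) refl m] show ?thesis .
qed

text \<open>From any separated pair inside \<beta>, the missing gates and then \<open>u_elt\<close>
  lead to two different \<open>Ready\<close> elements. From these \<open>s_elt x x x\<close> gives
  the unmarked pair, and gates give the pairs for all other sets of marks.\<close>

lemma prime: "prime_quotient C (Id_on (code ` E)) \<beta>"
proof -
  have "\<gamma> = \<beta>" if \<gamma>: "\<gamma> \<in> Con C" "Id_on (code ` E) \<subset> \<gamma>" "\<gamma> \<subseteq> \<beta>" for \<gamma>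
  proof -
    have eq: "equiv (code ` E) \<gamma>" using \<gamma>(1) by (simp add: Con_def)
    obtain x y where xy: "(x, y) \<in> \<gamma>" "(x, y) \<notin> Id_on (code ` E)" using \<gamma>(2) by auto
    then have "(x, y) \<in> \<beta>" using \<gamma>(3) by blast
    then obtain e e' where e: "x = code e" "y = code e'" "e \<in> E" "e' \<in> E" "shape e = shape e'" by (rule betaE)
    have ne: "e \<noteq> e'" using xy(2) e by auto
    have ready: "\<exists>v v'. v \<noteq> v' \<and> (code (Ready v), code (Ready v')) \<in> \<gamma>"
    proof (cases e)
      case (Ready v)
      then obtain v' where "e' = Ready v'" using e(5) by (cases e') auto
      then show ?thesis using Ready xy e ne by auto
    next
      case (Mark v W)
      then obtain v' where e': "e' = Mark v' W" using e(5) by (cases e') auto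
      have "(code (Mark v {..<k}), code (Mark v' {..<k})) \<in> \<gamma>"
        using con_mark_mono[OF \<gamma>(1), of W "{..<k}" v v'] xy e Mark e' by simp
      from con_ops(1)[OF \<gamma>(1) _ _ this] show ?thesis using Mark e' ne by auto
    qed (use e ne in \<open>cases e'; auto\<close>)+
    then obtain b b' where b: "b \<noteq> b'" "(code (Ready b), code (Ready b')) \<in> \<gamma>"
      by (elim exE conjE)
    have b': "(code (Ready b'), code (Ready b)) \<in> \<gamma>"
      using eq b(2) by (simp add: equiv_def sym_def)
    have rs: "(code (Ready v), code (Ready v')) \<in> \<gamma>" for v v'
    proof (cases "v = v'")
      case True
      then show ?thesis using eq by (auto simp: equiv_def refl_on_def)
    next
      case False
      then have "v = b \<and> v' = b' \<or> v = b' \<and> v' = b" using b(1) by auto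
      then show ?thesis using b(2) b' by auto
    qed
    have ms: "(code (Mark v W), code (Mark v' W)) \<in> \<gamma>" if "W \<subseteq> {..<k}" for v v' W
      using con_ops(3)[OF \<gamma>(1) _ _ rs[of v v']] con_mark_mono[OF \<gamma>(1) _ that, of "{}" v v'] by simp
    have "(code e, code e') \<in> \<gamma>" if "e \<in> E" "e' \<in> E" "shape e = shape e'" for e e'
    proof (cases "e = e'")
      case True
      then show ?thesis using that eq by (auto simp: equiv_def refl_on_def)
    next
      case False
      then show ?thesis using that rs ms by (cases e; cases e') auto
    qed
    then have "\<beta> \<subseteq> \<gamma>" by (auto elim!: betaE)
    then show ?thesis using \<gamma>(3) by blast
  qed
  moreover have "Id_on (code ` E) \<subset> \<beta>"
  proof -
    have "(code (Ready False), code (Ready True)) \<in> \<beta>" by simp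
    moreover have "(code (Ready False), code (Ready True)) \<notin> Id_on (code ` E)" by (auto simp: Id_on_def)
    moreover have "Id_on (code ` E) \<subseteq> \<beta>" by auto
    ultimately show ?thesis by blast
  qed
  ultimately show ?thesis using beta_Con Id_Con unfolding prime_quotient_def by (metis psubset_imp_subset psubset_eq)
qed

section \<open>Unary polynomials of the quotient, its minimal set and trace\<close>

fun finish :: "elt \<Rightarrow> elt" where
  "finish (Mark v W) = Ready v"
| "finish _ = Dead"

definition lifted :: "nat \<Rightarrow> (nat list \<Rightarrow> elt) \<Rightarrow> nat list \<Rightarrow> nat" where
  "lifted m h = (\<lambda>xs\<in>tuples m (code ` E). code (h xs))"

lemma lifted_apply [simp]: "xs \<in> tuples m (code ` E) \<Longrightarrow> lifted m h xs = code (h xs)"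
  by (simp add: lifted_def)

lemma lifted_eqI: "(\<And>xs. xs \<in> tuples m (code ` E) \<Longrightarrow> f xs = code (h xs)) \<Longrightarrow>
    restrict f (tuples m (univ C)) = lifted m h"
  unfolding lifted_def C_simps by (rule restrict_ext)

lemma lifted_const: "e \<in> E \<Longrightarrow> lifted m (\<lambda>_. e) \<in> Pol C m"
  using Pol.const[of "code e" C m] by (simp add: lifted_def del: restrict_apply)

lemma Pol_e_op:
  assumes s: "s < 5" and len: "length gs = mach_rank s"
    and gs: "\<forall>g\<in>set gs. lifted m (\<lambda>xs. g xs) \<in> Pol C m \<and> (\<forall>xs. g xs \<in> E)"
  shows "lifted m (\<lambda>xs. e_op s (map (\<lambda>g. g xs) gs)) \<in> Pol C m"
proof -
  let ?hs = "map (\<lambda>g. lifted m g) gs"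
  have "(\<lambda>xs\<in>tuples m (univ C). interp C s (map (\<lambda>h. h xs) ?hs)) \<in> Pol C m"
    using s len gs by (intro Pol.app) auto
  moreover have val: "interp C s (map (\<lambda>h. h xs) ?hs) = code (e_op s (map (\<lambda>g. g xs) gs))"
    if xs: "xs \<in> tuples m (code ` E)" for xs
  proof -
    have "map (\<lambda>h. h xs) ?hs = map code (map (\<lambda>g. g xs) gs)" using xs by simp
    moreover have "map (\<lambda>g. g xs) gs \<in> tuples (mach_rank s) E" using gs len by (auto simp: tuples_def)
    ultimately show ?thesis using interp_C[OF s] by metis
  qed
  from lifted_eqI[OF this] have "(\<lambda>xs\<in>tuples m (univ C). interp C s (map (\<lambda>h. h xs) ?hs)) =
      lifted m (\<lambda>xs. e_op s (map (\<lambda>g. g xs) gs))" .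
  ultimately show ?thesis by (simp only:)
qed

text \<open>All \<open>k\<close> gates are applied as constants, each exactly once, and then
  \<open>u_elt\<close>. This makes a freshly written value readable.\<close>

lemma Pol_finish:
  assumes g: "lifted m (\<lambda>xs. g xs) \<in> Pol C m" "\<forall>xs. g xs = Dead \<or> (\<exists>v. g xs = Mark v {})"
  shows "lifted m (\<lambda>xs. finish (g xs)) \<in> Pol C m"
proof -
  \<comment> \<open>For \<open>W = {..<l}\<close> this is the state after the first \<open>l\<close>
    gates.\<close>
  define ad where "ad W e = (case e of Mark v V \<Rightarrow> Mark v W | _ \<Rightarrow> Dead)" for W e
  have adE: "ad W (g xs) \<in> E" if "W \<subseteq> {..<k}" for W xs using g(2) that by (auto simp: ad_def split: elt.splits)
  have "lifted m (\<lambda>xs. ad {..<l} (g xs)) \<in> Pol C m" if "l \<le> k" for l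
    using that
  proof (induction l)
    case 0
    have "ad {..<0} (g xs) = g xs" for xs using g(2)[rule_format, of xs] by (auto simp: ad_def)
    then show ?case using g(1) by simp
  next
    case (Suc l)
    have c: "lifted m (\<lambda>xs. Gate l) \<in> Pol C m"
      using lifted_const[of "Gate l" m] Suc.prems by simp
    have "f_elt (ad {..<l} (g xs)) (Gate l) = ad {..<Suc l} (g xs)" for xs
      using g(2)[rule_format, of xs] by (auto simp: ad_def lessThan_Suc)
    moreover have "lifted m (\<lambda>xs. e_op 1 (map (\<lambda>g. g xs) [\<lambda>xs. ad {..<l} (g xs), \<lambda>_. Gate l])) \<in> Pol C m"
      by (rule Pol_e_op) (use Suc c adE[of "{..<l}"] in auto)
    ultimately show ?case by (simp add: e_op_def)
  qed
  from this[of k] have "lifted m (\<lambda>xs. ad {..<k} (g xs)) \<in> Pol C m" by simp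
  then have "lifted m (\<lambda>xs. e_op 0 (map (\<lambda>g. g xs) [\<lambda>xs. ad {..<k} (g xs)])) \<in> Pol C m"
    by (intro Pol_e_op) (use adE[of "{..<k}"] in auto)
  moreover have "e_op 0 (map (\<lambda>g. g xs) [\<lambda>xs. ad {..<k} (g xs)]) = finish (g xs)" for xs
    using g(2)[rule_format, of xs] by (auto simp: e_op_def ad_def)
  ultimately show ?thesis by simp
qed

lemma Pol_lattice:
  assumes "\<forall>g\<in>{f, g, h}. lifted m (\<lambda>xs. g xs) \<in> Pol C m \<and> (\<forall>xs. g xs \<in> E)"
  shows "lifted m (\<lambda>xs. finish (s_elt (f xs) (g xs) (h xs))) \<in> Pol C m"
proof (rule Pol_finish)
  have "lifted m (\<lambda>xs. e_op 3 (map (\<lambda>g. g xs) [f, g, h])) \<in> Pol C m"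
    by (rule Pol_e_op) (use assms in auto)
  then show "lifted m (\<lambda>xs. s_elt (f xs) (g xs) (h xs)) \<in> Pol C m"
    by (simp add: e_op_def)
  have "s_elt x y z = Dead \<or> (\<exists>v. s_elt x y z = Mark v {})" for x y z
    by (cases x; cases y; cases z) auto
  then show "\<forall>xs. s_elt (f xs) (g xs) (h xs) = Dead \<or> (\<exists>v. s_elt (f xs) (g xs) (h xs) = Mark v {})" by blast
qed

lemma Pol_proj: "j < m \<Longrightarrow> lifted m (\<lambda>xs. decode (xs ! j)) \<in> Pol C m"
proof -
  assume j: "j < m"
  have "code (decode (xs ! j)) = xs ! j" if "xs \<in> tuples m (code ` E)" for xs
  proof -
    have "xs ! j \<in> code ` E" using that j by (auto simp: tuples_def)
    then show ?thesis by auto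
  qed
  then have "(\<lambda>xs\<in>tuples m (univ C). xs ! j) = lifted m (\<lambda>xs. decode (xs ! j))"
    by (intro lifted_eqI) simp
  then show ?thesis using Pol.proj[OF j, of C] by (simp only:)
qed

lemma decode_E: "x \<in> code ` E \<Longrightarrow> decode x \<in> E"
  by auto

lemma e_op_strict: "s < 5 \<Longrightarrow> length es = mach_rank s \<Longrightarrow> Dead \<in> set es \<Longrightarrow> e_op s es = Dead"
proof -
  assume s: "s < 5" and len: "length es = mach_rank s" and "Dead \<in> set es"
  then obtain j where j: "j < mach_rank s" "es ! j = Dead" by (metis in_set_conv_nth)
  have d: "f_elt x Dead = Dead" for x by (cases x) simp_all
  have d': "s_elt x Dead z = Dead" for x z by (cases x) simp_all
  have d'': "s_elt x y Dead = Dead" for x y by (cases x; cases y) simp_all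
  consider "s = 0" | "s = 1" | "s = 2 \<or> s = 4" | "s = 3" using s by (auto simp: less_5)
  then show ?thesis
  proof cases
    case 1
    then show ?thesis using j by (simp add: e_op_def)
  next
    case 2
    then have "j = 0 \<or> j = 1" using j(1) by auto
    then show ?thesis using 2 j d by (auto simp: e_op_def)
  next
    case 3
    then show ?thesis by (auto simp: e_op_def)
  next
    case 4
    then have "j = 0 \<or> j = 1 \<or> j = 2" using j(1) by auto
    then show ?thesis using 4 j d' d'' by (auto simp: e_op_def)
  qed
qed

text \<open>Every operation returns \<open>Dead\<close> if one of its arguments is
  \<open>Dead\<close>. So either some argument polynomial already fixes \<open>Dead\<close>, or all
  of them are constant.\<close>

lemma Pol_strict:
  assumes "f \<in> Pol C 1"
  shows "f [code Dead] = code Dead \<or> (\<exists>c. \<forall>x\<in>code ` E. f [x] = c)"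
  using assms
proof (induction f rule: Pol.induct)
  case (proj j)
  then show ?case by (auto simp: tuples_def)
next
  case (const c)
  then show ?case by (auto simp: tuples_def)
next
  case (app s gs)
  have s: "s < 5" and len: "length gs = mach_rank s" using app by auto
  have t1: "[x] \<in> tuples 1 (univ C)" if "x \<in> code ` E" for x using that by (auto simp: tuples_def)
  have Dt: "[code Dead] \<in> tuples 1 (univ C)" using t1[of "code Dead"] E_simps(1) by blast
  show ?case
  proof (cases "\<exists>g\<in>set gs. g [code Dead] = code Dead")
    case True
    have gm: "g [code Dead] \<in> code ` E" if "g \<in> set gs" for g
      using Pol_mem[OF _ is_alg_C Dt, of g] app that by auto
    then have "map (\<lambda>g. g [code Dead]) gs \<in> tuples (mach_rank s) (code ` E)" using len by (auto simp: tuples_def)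
    then obtain es where es: "es \<in> tuples (mach_rank s) E" "map (\<lambda>g. g [code Dead]) gs = map code es"
      by (rule tuples_codeE)
    obtain g where "g \<in> set gs" "code Dead = g [code Dead]" using True by metis
    then have "code Dead \<in> (\<lambda>g. g [code Dead]) ` set gs" by (intro image_eqI)
    then have "code Dead \<in> set (map code es)" unfolding es(2)[symmetric] by simp
    then have "Dead \<in> set es" using es(1) code_eq[of Dead] by (auto simp: tuples_def)
    then have "e_op s es = Dead" using es(1) s by (intro e_op_strict) (auto simp: tuples_def)
    then show ?thesis using Dt es interp_C[OF s es(1)] by simp
  next
    case False
    then have "\<forall>g\<in>set gs. \<exists>c. \<forall>x\<in>code ` E. g [x] = c" using app by blast
    then obtain c where c: "\<forall>g\<in>set gs. \<forall>x\<in>code ` E. g [x] = c g" by metis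
    have "map (\<lambda>g. g [x]) gs = map c gs" if "x \<in> code ` E" for x using c that by auto
    then show ?thesis using t1 by (auto simp del: map_eq_conv)
  qed
qed

definition bit :: "bool \<Rightarrow> nat" where "bit v = code (Ready v)"

lemma bit_eq [simp]: "bit v = bit v' \<longleftrightarrow> v = v'"
  by (simp add: bit_def)

lemma bit_mem: "bit v \<in> code ` E"
  by (simp add: bit_def)

lemma decode_bit [simp]: "decode (bit v) = Ready v"
  by (simp add: bit_def)

text \<open>The map from \<open>x\<close> to \<open>finish (s_elt x x x)\<close> has this set as
  image. A unary polynomial that separates a \<beta>-pair inside it must hit both bits, and, not
  being constant, it fixes \<open>Dead\<close>; so no smaller image is possible.\<close>

lemma minimal: "{code Dead, bit False, bit True} \<in> minimal_sets C (Id_on (code ` E)) \<beta>"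
proof -
  let ?M = "{code Dead, bit False, bit True}"
  have t1: "[x] \<in> tuples 1 (univ C)" if "x \<in> code ` E" for x using that by (auto simp: tuples_def)
  \<comment> \<open>Outside the numbers of elements \<open>decode\<close> is arbitrary. The guard
    makes all values lie in \<open>E\<close>, as \<open>Pol_lattice\<close> demands.\<close>
  let ?d = "\<lambda>xs. if xs \<in> tuples 1 (code ` E) then decode (xs ! 0) else Dead"
  have dP: "lifted 1 (\<lambda>xs. ?d xs) \<in> Pol C 1"
  proof -
    have "lifted 1 ?d = lifted 1 (\<lambda>xs. decode (xs ! 0))" unfolding lifted_def by (rule restrict_ext) simp
    then show ?thesis using Pol_proj[of 0 1] by simp
  qed
  have dE: "?d xs \<in> E" for xs by (auto simp: tuples_Cons decode_E)
  let ?f = "lifted 1 (\<lambda>xs. finish (s_elt (?d xs) (?d xs) (?d xs)))"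
  have fP: "?f \<in> Pol C 1" by (rule Pol_lattice) (use dP dE in blast)
  have fv: "?f [code e] = (case e of Ready v \<Rightarrow> bit v | _ \<Rightarrow> code Dead)" if "e \<in> E" for e
    using t1[of "code e"] that by (cases e) (simp_all add: bit_def)
  have im: "(\<lambda>x. ?f [x]) ` univ C = ?M"
  proof -
    have "(\<lambda>x. ?f [x]) ` univ C = (\<lambda>e. ?f [code e]) ` E" by (simp add: image_image)
    also have "\<dots> = (\<lambda>e. case e of Ready v \<Rightarrow> bit v | _ \<Rightarrow> code Dead) ` E" using fv by (rule image_cong[OF refl])
    also have "\<dots> = ?M"
    proof
      show "(\<lambda>e. case e of Ready v \<Rightarrow> bit v | _ \<Rightarrow> code Dead) ` E \<subseteq> ?M"
        by (auto split: elt.splits)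
      show "?M \<subseteq> (\<lambda>e. case e of Ready v \<Rightarrow> bit v | _ \<Rightarrow> code Dead) ` E"
      proof -
        let ?F = "\<lambda>e. case e of Ready v \<Rightarrow> bit v | _ \<Rightarrow> code Dead"
        have "?F Dead \<in> ?F ` E" "?F (Ready False) \<in> ?F ` E" "?F (Ready True) \<in> ?F ` E"
          by (rule imageI, simp)+
        then show ?thesis by simp
      qed
    qed
    finally show ?thesis .
  qed
  have "?M \<in> U_sets C (Id_on (code ` E)) \<beta>"
  proof -
    have "(bit False, bit True) \<in> \<beta>" by (simp add: bit_def)
    moreover have "(?f [bit False], ?f [bit True]) \<notin> Id_on (code ` E)"
      using fv[of "Ready False"] fv[of "Ready True"] by (simp add: bit_def Id_on_def)
    ultimately show ?thesis using fP im unfolding U_sets_def by blast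
  qed
  moreover have "V = ?M" if V: "V \<in> U_sets C (Id_on (code ` E)) \<beta>" "V \<subseteq> ?M" for V
  proof -
    obtain f x y where f: "f \<in> Pol C 1" "V = (\<lambda>x. f [x]) ` univ C" "(x, y) \<in> \<beta>" "(f [x], f [y]) \<notin> Id_on (code ` E)"
      using V(1) unfolding U_sets_def by blast
    have xy: "x \<in> code ` E" "y \<in> code ` E" using f(3) by (auto elim!: betaE)
    have fm: "f [x] \<in> code ` E" "f [y] \<in> code ` E"
      using Pol_mem[OF f(1) is_alg_C] t1 xy by auto
    have ne: "f [x] \<noteq> f [y]" using f(4) fm by (auto simp: Id_on_def)
    have "(f [x], f [y]) \<in> \<beta>"
      using Pol_congruence[OF f(1) is_alg_C beta_Con t1[OF xy(1)] t1[OF xy(2)]] f(3) by simp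
    moreover have fV: "f [x] \<in> V" "f [y] \<in> V" using xy f(2) by auto
    then have "f [x] \<in> ?M" "f [y] \<in> ?M" using V(2) by blast+
    \<comment> \<open>Inside the three-element set the two bits are the only distinct
      \<beta>-related elements.\<close>
    ultimately have fxy: "{f [x], f [y]} = {bit False, bit True}" using ne by (auto simp: bit_def)
    have "f [code Dead] = code Dead"
      using Pol_strict[OF f(1)] ne xy by metis
    moreover have "f [code Dead] \<in> V" unfolding f(2) by (rule imageI) simp
    ultimately have "code Dead \<in> V" by simp
    have "{bit False, bit True} \<subseteq> V" using fV unfolding fxy[symmetric] by simp
    then show ?thesis using V(2) \<open>code Dead \<in> V\<close> by (intro equalityI) simp_all
  qed
  ultimately show ?thesis unfolding minimal_sets_def by blast
qed

definition N :: "nat set" where "N = {bit False, bit True}"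

lemma N_trace: "N \<in> traces C (Id_on (code ` E)) \<beta>"
proof -
  have "N = {code Dead, bit False, bit True} \<inter> \<beta> `` {bit False}"
    by (auto simp: N_def bit_def)
  moreover have "(bit False, bit True) \<notin> Id_on (code ` E)"
    by (metis Id_onE Pair_inject bit_eq)
  then have "\<not> N \<times> N \<subseteq> Id_on (code ` E)"
    unfolding N_def by blast
  ultimately show ?thesis using minimal unfolding traces_def by blast
qed

end

section \<open>The trace induces exactly the two-element lattice\<close>

context bounded_machine
begin

definition T :: "(two_symb, nat set) alg" where
  "T = two_elt_alg {Meet, Join} {bit False} {bit True}"

text \<open>The lower congruence is equality, so the elements of the quotient are
  singletons.\<close>

definition Q :: "(nat \<times> (nat list \<Rightarrow> nat), nat set) alg" where
  "Q = quotient_alg (induced_alg C N) (Id_on (code ` E) \<inter> N \<times> N)"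

abbreviation bits :: "nat set set" where
  "bits \<equiv> {{bit False}, {bit True}}"

lemma Image_N: "x \<in> N \<Longrightarrow> (Id_on (code ` E) \<inter> N \<times> N) `` {x} = {x}"
  using bit_mem by (auto simp: N_def)

lemma univ_Q: "univ Q = bits"
proof -
  have "univ Q = (\<lambda>x. (Id_on (code ` E) \<inter> N \<times> N) `` {x}) ` N"
    by (simp add: Q_def quotient_alg_def induced_alg_def quotient_def UNION_singleton_eq_range)
  also have "\<dots> = (\<lambda>x. {x}) ` N"
    by (rule image_cong[OF refl]) (rule Image_N)
  finally show ?thesis by (simp add: N_def)
qed

lemma univ_T: "univ T = bits"
  by (simp add: T_def two_elt_alg_def)

lemma bits_iff: "X \<in> bits \<longleftrightarrow> (\<exists>v. X = {bit v})"
  by (simp add: ex_bool_eq disj_commute)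

lemma interp_Q:
  assumes "Xs \<in> tuples r bits"
    and "f \<in> Pol C r" "\<forall>xs\<in>tuples r N. f xs \<in> N"
  shows "interp Q (r, restrict f (tuples r N)) Xs = {f (map the_elem Xs)}"
proof -
  have "(SOME x. x \<in> X) = the_elem X" "the_elem X \<in> N" if "X \<in> set Xs" for X
  proof -
    have "X \<in> bits" using assms(1) that by (auto simp: tuples_def)
    then obtain v where "X = {bit v}" unfolding bits_iff by blast
    then show "(SOME x. x \<in> X) = the_elem X" "the_elem X \<in> N" by (cases v; simp add: N_def)+
  qed
  then have some: "map (\<lambda>X. SOME x. x \<in> X) Xs = map the_elem Xs" and elem: "map the_elem Xs \<in> tuples r N"
    using assms(1) by (auto simp: tuples_def)
  have "interp Q (r, restrict f (tuples r N)) Xs =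
      (Id_on (code ` E) \<inter> N \<times> N) `` {restrict f (tuples r N) (map (\<lambda>X. SOME x. x \<in> X) Xs)}"
    unfolding Q_def quotient_alg_def induced_alg_def by simp
  also have "\<dots> = {f (map the_elem Xs)}"
    unfolding some restrict_apply'[OF elem] by (rule Image_N) (use assms(3) elem in blast)
  finally show ?thesis .
qed

lemma is_alg_T: "is_alg T"
  by (auto simp: is_alg_def T_def two_elt_alg_def closed_under_def)

text \<open>Invariant of the polynomials of \<open>C\<close> on bits: the kind of the value and the
  set of marks do not depend on the arguments, and the truth value, where there is one, is a lattice
  polynomial.\<close>

definition lattice_form :: "nat \<Rightarrow> (nat set list \<Rightarrow> elt) \<Rightarrow> bool" where
  "lattice_form m h \<longleftrightarrow> (\<exists>e\<in>E. \<forall>Xs\<in>tuples m bits. h Xs = e) \<or>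
     (\<exists>l\<in>Pol T m. \<forall>Xs\<in>tuples m bits. h Xs = Ready (l Xs = {bit True})) \<or>
     (\<exists>l\<in>Pol T m. \<exists>W\<subseteq>{..<k}. \<forall>Xs\<in>tuples m bits. h Xs = Mark (l Xs = {bit True}) W)"

lemma lattice_form_dead: "(\<And>Xs. Xs \<in> tuples m bits \<Longrightarrow> h Xs = Dead) \<Longrightarrow> lattice_form m h"
  unfolding lattice_form_def by (intro disjI1 bexI[of _ Dead]) auto

lemma lattice_form_u:
  assumes "lattice_form m h" shows "lattice_form m (\<lambda>Xs. u_elt (h Xs))"
  using assms unfolding lattice_form_def[of m h]
proof (elim disjE bexE exE conjE)
  fix e assume "e \<in> E" "\<forall>Xs\<in>tuples m bits. h Xs = e"
  then show ?thesis unfolding lattice_form_def by (intro disjI1 bexI[of _ "u_elt e"]) (auto intro: u_elt_E)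
next
  fix l assume "\<forall>Xs\<in>tuples m bits. h Xs = Ready (l Xs = {bit True})"
  then show ?thesis by (intro lattice_form_dead) simp
next
  fix l W assume l: "l \<in> Pol T m" and h: "\<forall>Xs\<in>tuples m bits. h Xs = Mark (l Xs = {bit True}) W"
  show ?thesis
  proof (cases "W = {..<k}")
    case True
    then show ?thesis unfolding lattice_form_def using l h by (intro disjI2 disjI1 bexI[of _ l]) auto
  next
    case False
    then show ?thesis using h by (intro lattice_form_dead) simp
  qed
qed

lemma f_elt_not_gate: "(\<And>j. y \<noteq> Gate j) \<Longrightarrow> f_elt x y = Dead"
  by (cases x; cases y) auto

text \<open>Of the three forms only a constant can be a gate, so a live result comes from one fixed
  gate, which leaves the truth value as it is.\<close>

lemma lattice_form_f:
  assumes "lattice_form m h" "lattice_form m h'" shows "lattice_form m (\<lambda>Xs. f_elt (h Xs) (h' Xs))"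
proof (cases "\<exists>j<k. \<forall>Xs\<in>tuples m bits. h' Xs = Gate j")
  case False
  have "f_elt (h Xs) (h' Xs) = Dead" if Xs: "Xs \<in> tuples m bits" for Xs
  proof (rule f_elt_not_gate)
    fix j show "h' Xs \<noteq> Gate j"
      using assms(2) False Xs unfolding lattice_form_def by (metis E_simps(3) elt.distinct(7,11))
  qed
  then show ?thesis by (rule lattice_form_dead)
next
  case True
  then obtain j where j: "j < k" "\<forall>Xs\<in>tuples m bits. h' Xs = Gate j" by blast
  show ?thesis using assms(1) unfolding lattice_form_def[of m h]
  proof (elim disjE bexE exE conjE)
    fix e assume "e \<in> E" "\<forall>Xs\<in>tuples m bits. h Xs = e"
    then show ?thesis unfolding lattice_form_def using j
      by (intro disjI1 bexI[of _ "f_elt e (Gate j)"]) (auto intro: f_elt_E)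
  next
    fix l assume "\<forall>Xs\<in>tuples m bits. h Xs = Ready (l Xs = {bit True})"
    then show ?thesis by (intro lattice_form_dead) simp
  next
    fix l W assume l: "l \<in> Pol T m" "W \<subseteq> {..<k}" and h: "\<forall>Xs\<in>tuples m bits. h Xs = Mark (l Xs = {bit True}) W"
    show ?thesis
    proof (cases "j \<in> W")
      case True
      then show ?thesis using h j by (intro lattice_form_dead) simp
    next
      case False
      then show ?thesis unfolding lattice_form_def using l h j
        by (intro disjI2 bexI[of _ l] exI[of _ "insert j W"]) auto
    qed
  qed
qed

lemma s_elt_ready: "\<not> ((\<exists>a. x = Ready a) \<and> (\<exists>b. y = Ready b) \<and> (\<exists>c. z = Ready c)) \<Longrightarrow> s_elt x y z = Dead"
  by (cases x; cases y; cases z) auto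

lemma const_T: "(\<lambda>Xs\<in>tuples m bits. {bit v}) \<in> Pol T m"
  using Pol.const[of "{bit v}" T m] univ_T bits_iff by simp

lemma lattice_form_cases:
  assumes "lattice_form m h"
  shows "(\<exists>l\<in>Pol T m. \<forall>Xs\<in>tuples m bits. h Xs = Ready (l Xs = {bit True})) \<or>
    (\<forall>Xs\<in>tuples m bits. \<forall>v. h Xs \<noteq> Ready v)"
  using assms unfolding lattice_form_def
proof (elim disjE bexE exE conjE)
  fix e assume e: "\<forall>Xs\<in>tuples m bits. h Xs = e"
  show ?thesis
  proof (cases "\<exists>v. e = Ready v")
    case True
    then obtain v where "e = Ready v" by blast
    then have "\<forall>Xs\<in>tuples m bits. h Xs = Ready ((\<lambda>Xs\<in>tuples m bits. {bit v}) Xs = {bit True})"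
      using e by simp
    then show ?thesis using const_T by blast
  next
    case False
    then show ?thesis using e by auto
  qed
next
  fix l assume "l \<in> Pol T m" "\<forall>Xs\<in>tuples m bits. h Xs = Ready (l Xs = {bit True})"
  then show ?thesis by blast
qed auto

lemma Pol_T_mem: "l \<in> Pol T m \<Longrightarrow> Xs \<in> tuples m bits \<Longrightarrow> l Xs \<in> bits"
  using Pol_mem[OF _ is_alg_T, of l m Xs] univ_T by simp

lemma Pol_T_app:
  assumes "l \<in> Pol T m" "l' \<in> Pol T m"
  shows "\<exists>f\<in>Pol T m. \<forall>Xs\<in>tuples m bits. f Xs = {bit True} \<longleftrightarrow> l Xs = {bit True} \<and> l' Xs = {bit True}"
    "\<exists>f\<in>Pol T m. \<forall>Xs\<in>tuples m bits. f Xs = {bit True} \<longleftrightarrow> l Xs = {bit True} \<or> l' Xs = {bit True}"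
proof -
  have "(\<lambda>Xs\<in>tuples m (univ T). interp T s (map (\<lambda>g. g Xs) [l, l'])) \<in> Pol T m" if "s \<in> {Meet, Join}" for s
  proof (rule Pol.app)
    show "s \<in> symbs T" "length [l, l'] = rank T s" using that by (auto simp: T_def two_elt_alg_def)
    show "\<forall>g\<in>set [l, l']. g \<in> Pol T m" using assms by simp
  qed
  then have M: "(\<lambda>Xs\<in>tuples m bits. interp T Meet [l Xs, l' Xs]) \<in> Pol T m"
    and J: "(\<lambda>Xs\<in>tuples m bits. interp T Join [l Xs, l' Xs]) \<in> Pol T m"
    unfolding univ_T by simp_all
  have v: "l Xs = {bit False} \<or> l Xs = {bit True}" "l' Xs = {bit False} \<or> l' Xs = {bit True}"
    if "Xs \<in> tuples m bits" for Xs
    using Pol_T_mem[OF assms(1) that] Pol_T_mem[OF assms(2) that] by auto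
  show "\<exists>f\<in>Pol T m. \<forall>Xs\<in>tuples m bits. f Xs = {bit True} \<longleftrightarrow> l Xs = {bit True} \<and> l' Xs = {bit True}"
    by (rule bexI[OF _ M]) (auto simp: T_def two_elt_alg_def)
  show "\<exists>f\<in>Pol T m. \<forall>Xs\<in>tuples m bits. f Xs = {bit True} \<longleftrightarrow> l Xs = {bit True} \<or> l' Xs = {bit True}"
  proof (rule bexI[OF _ J], rule ballI)
    fix Xs assume Xs: "Xs \<in> tuples m bits"
    show "(\<lambda>Xs\<in>tuples m bits. interp T Join [l Xs, l' Xs]) Xs = {bit True} \<longleftrightarrow> l Xs = {bit True} \<or> l' Xs = {bit True}"
      using v[OF Xs] Xs by (auto simp: T_def two_elt_alg_def)
  qed
qed

lemma lattice_form_s: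
  assumes "lattice_form m f" "lattice_form m g" "lattice_form m h"
  shows "lattice_form m (\<lambda>Xs. s_elt (f Xs) (g Xs) (h Xs))"
proof (cases "(\<forall>Xs\<in>tuples m bits. \<forall>v. f Xs \<noteq> Ready v) \<or> (\<forall>Xs\<in>tuples m bits. \<forall>v. g Xs \<noteq> Ready v) \<or>
    (\<forall>Xs\<in>tuples m bits. \<forall>v. h Xs \<noteq> Ready v)")
  case True
  then have "s_elt (f Xs) (g Xs) (h Xs) = Dead" if "Xs \<in> tuples m bits" for Xs
    using that by (intro s_elt_ready) blast
  then show ?thesis by (rule lattice_form_dead)
next
  case False
  then obtain a b c where a: "a \<in> Pol T m" "\<forall>Xs\<in>tuples m bits. f Xs = Ready (a Xs = {bit True})"
    and b: "b \<in> Pol T m" "\<forall>Xs\<in>tuples m bits. g Xs = Ready (b Xs = {bit True})"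
    and c: "c \<in> Pol T m" "\<forall>Xs\<in>tuples m bits. h Xs = Ready (c Xs = {bit True})"
    using lattice_form_cases[OF assms(1)] lattice_form_cases[OF assms(2)] lattice_form_cases[OF assms(3)] by meson
  obtain p where p: "p \<in> Pol T m" "\<forall>Xs\<in>tuples m bits. p Xs = {bit True} \<longleftrightarrow> a Xs = {bit True} \<and> b Xs = {bit True}"
    using Pol_T_app(1)[OF a(1) b(1)] by blast
  obtain q where q: "q \<in> Pol T m" "\<forall>Xs\<in>tuples m bits. q Xs = {bit True} \<longleftrightarrow> c Xs = {bit True} \<or> p Xs = {bit True}"
    using Pol_T_app(2)[OF c(1) p(1)] by blast
  have "\<forall>Xs\<in>tuples m bits. s_elt (f Xs) (g Xs) (h Xs) = Mark (q Xs = {bit True}) {}"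
    using a(2) b(2) c(2) p(2) q(2) by simp
  then show ?thesis unfolding lattice_form_def using q(1) by blast
qed

text \<open>The arguments are themselves lattice polynomials \<open>gs\<close>, so that the lemma
  covers one step of composition in \<open>Q\<close>.\<close>

lemma Pol_lattice_form:
  assumes f: "f \<in> Pol C r" and gs: "length gs = r" "\<forall>g\<in>set gs. g \<in> Pol T m"
  shows "\<exists>h. lattice_form m h \<and> (\<forall>Xs\<in>tuples m bits. h Xs \<in> E \<and> f (map (\<lambda>g. the_elem (g Xs)) gs) = code (h Xs))"
  using f
proof (induction f rule: Pol.induct)
  have t: "map (\<lambda>g. the_elem (g Xs)) gs \<in> tuples r (univ C)" if "Xs \<in> tuples m bits" for Xs
  proof -
    have "the_elem (g Xs) \<in> code ` E" if "g \<in> set gs" for g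
      using Pol_T_mem[of g m Xs] gs(2) that \<open>Xs \<in> _\<close> bit_mem by (auto simp: bits_iff)
    then show ?thesis using gs(1) by (auto simp: tuples_def)
  qed
  {
    case (proj j)
    let ?h = "\<lambda>Xs. Ready ((gs ! j) Xs = {bit True})"
    have j: "gs ! j \<in> Pol T m" using gs proj by auto
    have "lattice_form m ?h" unfolding lattice_form_def using j by blast
    moreover have "the_elem ((gs ! j) Xs) = code (?h Xs)" if "Xs \<in> tuples m bits" for Xs
      using Pol_T_mem[OF j that] by (auto simp: bit_def)
    ultimately show ?case using t proj gs(1) by (intro exI[of _ ?h]) simp
  next
    case (const c)
    then obtain e where "e \<in> E" "c = code e" by auto
    moreover from this have "lattice_form m (\<lambda>_. e)" unfolding lattice_form_def by blast
    ultimately show ?case using t by (intro exI[of _ "\<lambda>_. e"]) simp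
  next
    case (app s fs)
    have s: "s < 5" and len: "length fs = mach_rank s" using app by auto
    obtain H where H: "\<forall>f\<in>set fs. lattice_form m (H f) \<and>
        (\<forall>Xs\<in>tuples m bits. H f Xs \<in> E \<and> f (map (\<lambda>g. the_elem (g Xs)) gs) = code (H f Xs))"
      using app by metis
    let ?h = "\<lambda>Xs. e_op s (map (\<lambda>f. H f Xs) fs)"
    have hm: "map (\<lambda>f. H f Xs) fs \<in> tuples (mach_rank s) E" if "Xs \<in> tuples m bits" for Xs
      using H that len by (auto simp: tuples_def)
    have val: "interp C s (map (\<lambda>f. f (map (\<lambda>g. the_elem (g Xs)) gs)) fs) = code (?h Xs)"
      if "Xs \<in> tuples m bits" for Xs
    proof -
      have "map (\<lambda>f. f (map (\<lambda>g. the_elem (g Xs)) gs)) fs = map code (map (\<lambda>f. H f Xs) fs)"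
        using H that by simp
      then show ?thesis by (simp only: interp_C[OF s hm[OF that]])
    qed
    have Hf: "lattice_form m (H (fs ! j))" if "j < mach_rank s" for j using H len that by simp
    have "lattice_form m ?h"
    proof -
      consider "s = 0" | "s = 1" | "s = 2 \<or> s = 4" | "s = 3" using s by (auto simp: less_5)
      then show ?thesis
      proof cases
        case 1
        then show ?thesis using lattice_form_u[OF Hf[of 0]] len by (simp add: e_op_def)
      next
        case 2
        then show ?thesis using lattice_form_f[OF Hf[of 0] Hf[of 1]] len by (simp add: e_op_def)
      next
        case 3
        then show ?thesis by (intro lattice_form_dead) (auto simp: e_op_def)
      next
        case 4
        then show ?thesis using lattice_form_s[OF Hf[of 0] Hf[of 1] Hf[of 2]] len by (simp add: e_op_def)
      qed
    qed
    then show ?case using t val e_op_E[OF s hm] by (intro exI[of _ ?h]) (simp add: o_def)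
  }
qed

lemma Pol_Q_subset: "F \<in> Pol Q m \<Longrightarrow> F \<in> Pol T m"
proof (induction F rule: Pol.induct)
  case (proj j)
  then show ?case unfolding univ_Q univ_T[symmetric] by (rule Pol.proj)
next
  case (const c)
  then show ?case unfolding univ_Q univ_T[symmetric] by (rule Pol.const)
next
  case (app s gs)
  have "symbs Q = {(r, restrict f (tuples r N)) | r f. f \<in> Pol C r \<and> (\<forall>xs\<in>tuples r N. f xs \<in> N)}"
    by (simp add: Q_def quotient_alg_def induced_alg_def)
  then obtain r f where f: "s = (r, restrict f (tuples r N))" "f \<in> Pol C r" "\<forall>xs\<in>tuples r N. f xs \<in> N"
    using app(1) by blast
  have len: "length gs = r" using app(2) f(1) by (simp add: Q_def quotient_alg_def induced_alg_def)
  have gT: "\<forall>g\<in>set gs. g \<in> Pol T m" using app by blast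
  obtain h where h: "lattice_form m h" "\<forall>Xs\<in>tuples m bits. h Xs \<in> E \<and> f (map (\<lambda>g. the_elem (g Xs)) gs) = code (h Xs)"
    using Pol_lattice_form[OF f(2) len gT] by blast
  let ?F = "\<lambda>Xs\<in>tuples m (univ Q). interp Q s (map (\<lambda>g. g Xs) gs)"
  have FX: "?F Xs = {code (h Xs)} \<and> code (h Xs) \<in> N" if Xs: "Xs \<in> tuples m bits" for Xs
  proof -
    have b: "map (\<lambda>g. g Xs) gs \<in> tuples r bits" using gT Pol_T_mem[OF _ Xs] len by (auto simp: tuples_def)
    have "?F Xs = {f (map the_elem (map (\<lambda>g. g Xs) gs))}"
      using interp_Q[OF b f(2,3)] Xs univ_Q f(1) by simp
    moreover have "map the_elem (map (\<lambda>g. g Xs) gs) \<in> tuples r N"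
    proof -
      have "the_elem X \<in> N" if X: "X \<in> bits" for X
      proof -
        obtain v where "X = {bit v}" using X unfolding bits_iff by blast
        then show ?thesis by (cases v) (simp_all add: N_def)
      qed
      moreover have "length (map (\<lambda>g. g Xs) gs) = r" "set (map (\<lambda>g. g Xs) gs) \<subseteq> bits"
        using b unfolding tuples_def by blast+
      ultimately have "the_elem ` set (map (\<lambda>g. g Xs) gs) \<subseteq> N" by blast
      then show ?thesis using len unfolding tuples_def by (simp del: image_subset_iff add: image_image)
    qed
    then have "f (map the_elem (map (\<lambda>g. g Xs) gs)) \<in> N" using f(3) by blast
    ultimately show ?thesis using h(2) Xs by (simp add: o_def)
  qed
  have FQ: "?F = restrict G (tuples m bits)" if "\<And>Xs. Xs \<in> tuples m bits \<Longrightarrow> {code (h Xs)} = G Xs" for G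
    using that FX by (auto simp: univ_Q fun_eq_iff restrict_def)
  have bitN: "\<exists>v. e = Ready v" if "e \<in> E" "code e \<in> N" for e
    using that code_eq[OF that(1)] by (auto simp: N_def bit_def)
  \<comment> \<open>One tuple of bits suffices to recognize the form: a value in \<open>N\<close>
    there is \<open>Ready\<close>, and then the value is \<open>Ready\<close> everywhere.\<close>
  have ne: "replicate m {bit False} \<in> tuples m bits" by (auto simp: tuples_def)
  have "\<exists>l\<in>Pol T m. \<forall>Xs\<in>tuples m bits. h Xs = Ready (l Xs = {bit True})"
    using lattice_form_cases[OF h(1)] FX[OF ne] h(2) ne bitN by metis
  then obtain l where l: "l \<in> Pol T m" "\<forall>Xs\<in>tuples m bits. h Xs = Ready (l Xs = {bit True})" by blast
  have "?F = restrict l (tuples m bits)"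
  proof (rule FQ)
    fix Xs assume Xs: "Xs \<in> tuples m bits"
    then show "{code (h Xs)} = l Xs"
      using l(2) Pol_T_mem[OF l(1) Xs] by (auto simp: bit_def)
  qed
  then show ?case using Pol_ext[OF l(1)] l(1) univ_T by simp
qed

lemma Q_symb:
  assumes "\<forall>g\<in>{a, b, c}. lifted 2 (\<lambda>xs. g xs) \<in> Pol C 2 \<and> (\<forall>xs. g xs \<in> E)"
    and "\<And>v v'. finish (s_elt (a [bit v, bit v']) (b [bit v, bit v']) (c [bit v, bit v'])) = Ready (op v v')"
  shows "\<exists>s\<in>symbs Q. rank Q s = 2 \<and> (\<forall>v v'. interp Q s [{bit v}, {bit v'}] = {bit (op v v')})"
proof -
  let ?f = "lifted 2 (\<lambda>xs. finish (s_elt (a xs) (b xs) (c xs)))"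
  have f: "?f \<in> Pol C 2" by (rule Pol_lattice[OF assms(1)])
  have val: "?f [bit v, bit v'] = bit (op v v')" for v v'
    using assms(2) bit_mem by (simp add: tuples_def bit_def)
  have N2: "\<exists>v v'. xs = [bit v, bit v']" if "xs \<in> tuples 2 N" for xs
    using that by (auto simp: eval_nat_numeral tuples_simps N_def)
  have bN: "bit v \<in> N" for v by (cases v) (auto simp: N_def)
  have fN: "\<forall>xs\<in>tuples 2 N. ?f xs \<in> N"
  proof
    fix xs assume "xs \<in> tuples 2 N"
    then obtain v v' where "xs = [bit v, bit v']" using N2 by blast
    then show "?f xs \<in> N" using val bN by simp
  qed
  let ?s = "(2::nat, restrict ?f (tuples 2 N))"
  have "symbs Q = {(r, restrict f (tuples r N)) | r f. f \<in> Pol C r \<and> (\<forall>xs\<in>tuples r N. f xs \<in> N)}"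
    by (simp add: Q_def quotient_alg_def induced_alg_def)
  then have "?s \<in> symbs Q" using f fN by blast
  moreover have "rank Q ?s = 2" by (simp add: Q_def quotient_alg_def induced_alg_def)
  moreover have "interp Q ?s [{bit v}, {bit v'}] = {bit (op v v')}" for v v'
    using interp_Q[OF _ f fN, of "[{bit v}, {bit v'}]"] val
    by (cases v; cases v') (simp_all add: tuples_def)
  ultimately show ?thesis by blast
qed

text \<open>Fixing the third argument of \<open>s_elt\<close> to false gives the meet, fixing the
  second to true gives the join of the others.\<close>

lemma Q_ops:
  "\<exists>s\<in>symbs Q. rank Q s = 2 \<and> (\<forall>v v'. interp Q s [{bit v}, {bit v'}] = {bit (v \<and> v')})"
  "\<exists>s\<in>symbs Q. rank Q s = 2 \<and> (\<forall>v v'. interp Q s [{bit v}, {bit v'}] = {bit (v' \<or> v)})"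
proof -
  define pr where "pr j xs = (if xs \<in> tuples 2 (code ` E) then decode (xs ! j) else Dead)" for j xs
  have pr: "lifted 2 (\<lambda>xs. pr j xs) \<in> Pol C 2 \<and> (\<forall>xs. pr j xs \<in> E)" if "j < 2" for j
  proof
    show "lifted 2 (\<lambda>xs. pr j xs) \<in> Pol C 2"
    proof -
      have "lifted 2 (\<lambda>xs. pr j xs) = lifted 2 (\<lambda>xs. decode (xs ! j))"
        unfolding lifted_def by (rule restrict_ext) (simp add: pr_def)
      then show ?thesis using Pol_proj[OF that] by simp
    qed
    have "xs ! j \<in> code ` E" if "xs \<in> tuples 2 (code ` E)" for xs
      using that \<open>j < 2\<close> by (auto simp: tuples_def)
    then show "\<forall>xs. pr j xs \<in> E" by (auto simp: pr_def decode_E)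
  qed
  have c: "lifted 2 (\<lambda>xs. Ready v) \<in> Pol C 2 \<and> (\<forall>xs :: nat list. Ready v \<in> E)" for v
    using lifted_const by simp
  have prv: "pr 0 [bit v, bit v'] = Ready v" "pr 1 [bit v, bit v'] = Ready v'" for v v'
    using bit_mem by (simp_all add: pr_def tuples_def)
  show "\<exists>s\<in>symbs Q. rank Q s = 2 \<and> (\<forall>v v'. interp Q s [{bit v}, {bit v'}] = {bit (v \<and> v')})"
    by (rule Q_symb[of "pr 0" "pr 1" "\<lambda>_. Ready False"]) (use pr c prv in simp_all)
  show "\<exists>s\<in>symbs Q. rank Q s = 2 \<and> (\<forall>v v'. interp Q s [{bit v}, {bit v'}] = {bit (v' \<or> v)})"
    by (rule Q_symb[of "pr 0" "\<lambda>_. Ready True" "pr 1"]) (use pr c prv in simp_all)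
qed

lemma Pol_T_subset: "F \<in> Pol T m \<Longrightarrow> F \<in> Pol Q m"
proof (induction F rule: Pol.induct)
  case (proj j)
  then show ?case unfolding univ_T univ_Q[symmetric] by (rule Pol.proj)
next
  case (const c)
  then show ?case unfolding univ_T univ_Q[symmetric] by (rule Pol.const)
next
  case (app s gs)
  have "s = Meet \<or> s = Join" "length gs = 2" using app by (auto simp: T_def two_elt_alg_def)
  then obtain g h where gs: "gs = [g, h]" by (auto simp: length_Suc_conv numeral_2_eq_2)
  have "\<exists>q\<in>symbs Q. rank Q q = 2 \<and> (\<forall>v v'. interp Q q [{bit v}, {bit v'}] = interp T s [{bit v}, {bit v'}])"
    using \<open>s = Meet \<or> s = Join\<close>
  proof
    assume s: "s = Meet"
    have "interp T s [{bit v}, {bit v'}] = {bit (v \<and> v')}" for v v'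
      using s by (cases v; cases v') (simp_all add: T_def two_elt_alg_def)
    then show ?thesis using Q_ops(1) by simp
  next
    assume s: "s = Join"
    have "interp T s [{bit v}, {bit v'}] = {bit (v' \<or> v)}" for v v'
      using s by (cases v; cases v') (simp_all add: T_def two_elt_alg_def)
    then show ?thesis using Q_ops(2) by simp
  qed
  then obtain q where q: "q \<in> symbs Q" "rank Q q = 2"
    "\<And>v v'. interp Q q [{bit v}, {bit v'}] = interp T s [{bit v}, {bit v'}]" by blast
  have "(\<lambda>Xs\<in>tuples m (univ Q). interp Q q (map (\<lambda>g. g Xs) gs)) \<in> Pol Q m"
    using app q gs by (intro Pol.app) auto
  moreover have "interp Q q (map (\<lambda>g. g Xs) gs) = interp T s (map (\<lambda>g. g Xs) gs)"
    if Xs: "Xs \<in> tuples m bits" for Xs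
  proof -
    have "g Xs \<in> bits" "h Xs \<in> bits" using app gs Pol_T_mem[OF _ Xs] by auto
    then obtain v v' where "g Xs = {bit v}" "h Xs = {bit v'}" unfolding bits_iff by blast
    then show ?thesis using q(3) gs by simp
  qed
  then have "(\<lambda>Xs\<in>tuples m (univ Q). interp Q q (map (\<lambda>g. g Xs) gs)) =
      (\<lambda>Xs\<in>tuples m (univ T). interp T s (map (\<lambda>g. g Xs) gs))"
    unfolding univ_Q univ_T by (intro restrict_ext)
  ultimately show ?case by (simp only:)
qed

theorem type4: "Type4_lattice \<in> typ_variety A"
proof -
  have "poly_equivalent Q T"
    using Pol_Q_subset Pol_T_subset univ_Q univ_T by (auto simp: poly_equivalent_def)
  then have "minimal_alg_type Q Type4_lattice"
    unfolding minimal_alg_type.simps T_def by (intro exI[of _ "{bit False}"] exI[of _ "{bit True}"]) simp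
  then have "has_quotient_type C (Id_on (code ` E)) \<beta> Type4_lattice"
    unfolding has_quotient_type_def Q_def using N_trace by blast
  moreover have "C \<in> HSP A" using hsp_C unfolding HSP_def by blast
  moreover have "finite (univ C)" using finite_E by simp
  ultimately show ?thesis unfolding typ_variety_def typ_class_def using prime by blast
qed

end

theorem (in unit_machine) type4_iff:
  "Type4_lattice \<in> typ_variety A \<longleftrightarrow> (\<exists>k>0. \<forall>x\<in>reach k. \<exists>i<k. \<not> w (x i))"
proof
  assume "\<exists>k>0. \<forall>x\<in>reach k. \<exists>i<k. \<not> w (x i)"
  then obtain k where "0 < k" "\<And>x. x \<in> reach k \<Longrightarrow> \<exists>i<k. \<not> w (x i)" by blast
  then interpret bounded_machine n d w k by unfold_locales
  show "Type4_lattice \<in> typ_variety A" by (rule type4)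
next
  assume "Type4_lattice \<in> typ_variety A"
  then show "\<exists>k>0. \<forall>x\<in>reach k. \<exists>i<k. \<not> w (x i)" using no_type4 by blast
qed

section \<open>Counter machines as unit machines\<close>

text \<open>Instructions are given by a kind (1: increment, 2: decrement or jump on zero, anything else:
  halt), the content of the units that count the register, and two jump targets.  The content of a unit is
  \<open>0\<close> while it is free and \<open>1\<close> when it is used up.  Every step touches one unit, and no unit
  becomes free again, so a machine that runs forever fills any number of units.\<close>

definition sym :: "nat \<Rightarrow> nat \<Rightarrow> nat \<Rightarrow> nat" where
  "sym b q c = 9 + q * b + c"

text \<open>The move \<open>m\<close> is a guess of the outcome of the zero test. The jump must
  touch a free unit, which it uses up, and it is vetoed by every other unit that counts the tested
  register.\<close>

definition delta :: "nat \<Rightarrow> (nat \<Rightarrow> nat) \<Rightarrow> (nat \<Rightarrow> nat) \<Rightarrow> (nat \<Rightarrow> nat) \<Rightarrow> (nat \<Rightarrow> nat) \<Rightarrow>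
    nat \<Rightarrow> nat \<Rightarrow> nat \<Rightarrow> nat" where
  "delta b kd rg na nb m g y =
     (let q = (y - 9) div b; c = (y - 9) mod b in
      if m = 0 then
        if kd q = 1 then if g = 1 then if c = 0 then sym b (na q) (rg q) else 0 else sym b (na q) c
        else if kd q = 2 then if g = 1 then if c = rg q then sym b (na q) 1 else 0 else sym b (na q) c
        else 0
      else if kd q = 2 then
        if g = 1 then if c = 0 then sym b (nb q) 1 else 0 else if c = rg q then 0 else sym b (nb q) c
      else 0)"

definition used :: "nat \<Rightarrow> nat \<Rightarrow> bool" where
  "used b y \<longleftrightarrow> (y - 9) mod b \<noteq> 0"

lemma sym_div: "c < b \<Longrightarrow> (sym b q c - 9) div b = q" and sym_mod: "c < b \<Longrightarrow> (sym b q c - 9) mod b = c"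
  by (simp_all add: sym_def)

lemma sym_ge: "9 \<le> sym b q c"
  by (simp add: sym_def)

text \<open>Contents 0 and 1 mean free and used up, so the registers that instructions address begin
  at 2.\<close>

locale counter_machine =
  fixes b S :: nat and kd rg na nb :: "nat \<Rightarrow> nat"
  assumes b1: "1 < b" and S0: "0 < S"
    and rg_less: "\<And>q. q < S \<Longrightarrow> rg q < b"
    and na_less: "\<And>q. q < S \<Longrightarrow> kd q = 1 \<or> kd q = 2 \<Longrightarrow> na q < S"
    and nb_less: "\<And>q. q < S \<Longrightarrow> kd q = 2 \<Longrightarrow> nb q < S"
    and rg_ge: "\<And>q. q < S \<Longrightarrow> kd q = 1 \<or> kd q = 2 \<Longrightarrow> 2 \<le> rg q"
begin

abbreviation d where "d \<equiv> delta b kd rg na nb"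

lemma sym_less: "q < S \<Longrightarrow> c < b \<Longrightarrow> sym b q c < 9 + S * b"
proof -
  assume "q < S" "c < b"
  then have "q * b + c < (q + 1) * b" by simp
  also have "\<dots> \<le> S * b" using \<open>q < S\<close> by (intro mult_right_mono) auto
  finally show ?thesis by (simp add: sym_def)
qed

lemma d_sym:
  assumes "c < b"
  shows "d m g (sym b q c) = (if m = 0 then
        if kd q = 1 then if g = 1 then if c = 0 then sym b (na q) (rg q) else 0 else sym b (na q) c
        else if kd q = 2 then if g = 1 then if c = rg q then sym b (na q) 1 else 0 else sym b (na q) c
        else 0
      else if kd q = 2 then
        if g = 1 then if c = 0 then sym b (nb q) 1 else 0 else if c = rg q then 0 else sym b (nb q) c
      else 0)"
  by (simp add: delta_def sym_div[OF assms] sym_mod[OF assms])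

lemma sym_cases:
  assumes "9 \<le> y" "y < 9 + S * b"
  obtains q c where "y = sym b q c" "q < S" "c < b"
proof
  show "y = sym b ((y - 9) div b) ((y - 9) mod b)" using assms(1) by (simp add: sym_def)
  show "(y - 9) div b < S" using assms b1 by (simp add: less_mult_imp_div_less)
  show "(y - 9) mod b < b" using b1 by simp
qed

sublocale unit_machine "9 + S * b" d "used b"
proof
  show "9 < 9 + S * b" using b1 S0 by simp
  fix k g y :: nat assume "9 \<le> y" "y < 9 + S * b"
  then obtain q c where y: "y = sym b q c" "q < S" "c < b" by (rule sym_cases)
  define G where "G x \<longleftrightarrow> x = 0 \<or> 9 \<le> x \<and> x < 9 + S * b" for x
  have G: "G 0" "\<And>q c. q < S \<Longrightarrow> c < b \<Longrightarrow> G (sym b q c)"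
    using sym_ge sym_less by (auto simp: G_def)
  have "G (d k g y)"
    unfolding y(1) d_sym[OF y(3)] using na_less[OF y(2)] nb_less[OF y(2)] rg_less[OF y(2)] y(3) b1
    by (simp add: G)
  then show "d k g y = 0 \<or> 9 \<le> d k g y \<and> d k g y < 9 + S * b" by (simp add: G_def)
qed

section \<open>Runs of the unit machine follow the counter machine\<close>

fun cstep :: "nat \<times> (nat \<Rightarrow> nat) \<Rightarrow> nat \<times> (nat \<Rightarrow> nat)" where
  "cstep (q, V) = (if kd q = 1 then (na q, V(rg q := Suc (V (rg q))))
     else if kd q = 2 then if 0 < V (rg q) then (na q, V(rg q := V (rg q) - 1)) else (nb q, V)
     else (q, V))"

definition cfg :: "nat \<Rightarrow> nat \<times> (nat \<Rightarrow> nat)" where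
  "cfg t = (cstep ^^ t) (0, \<lambda>_. 0)"

definition stops :: bool where
  "stops \<longleftrightarrow> (\<exists>t. kd (fst (cfg t)) \<notin> {1, 2})"

lemma cfg_Suc: "cfg (Suc t) = cstep (cfg t)"
  by (simp add: cfg_def)

lemma cfg_less: "fst (cfg t) < S"
proof (induction t)
  case 0
  then show ?case using S0 by (simp add: cfg_def)
next
  case (Suc t)
  then show ?case using na_less nb_less unfolding cfg_Suc by (cases "cfg t") auto
qed

definition num :: "nat \<Rightarrow> (nat \<Rightarrow> bool) \<Rightarrow> (nat \<Rightarrow> nat) \<Rightarrow> nat" where
  "num k P c = card {i. i < k \<and> P (c i)}"

lemma num_upd:
  assumes "j < k"
  shows "num k P (c(j := v)) + of_bool (P (c j)) = num k P c + of_bool (P v)"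
proof -
  have fin: "finite {i. i < k \<and> i \<noteq> j \<and> P (c i)}" by simp
  have "{i. i < k \<and> P (f i)} = (if P (f j) then insert j {i. i < k \<and> i \<noteq> j \<and> P (f i)}
      else {i. i < k \<and> i \<noteq> j \<and> P (f i)})" for f :: "nat \<Rightarrow> nat"
    using assms by auto
  then have *: "num k P f = card {i. i < k \<and> i \<noteq> j \<and> P (f i)} + of_bool (P (f j))" for f
    by (simp add: num_def)
  have "{i. i < k \<and> i \<noteq> j \<and> P ((c(j := v)) i)} = {i. i < k \<and> i \<noteq> j \<and> P (c i)}" by auto
  then show ?thesis using *[of c] *[of "c(j := v)"] by simp
qed

lemma num_le: "num k P c \<le> k"
proof -
  have "card {i. i < k \<and> P (c i)} \<le> card {..<k}" by (rule card_mono) auto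
  then show ?thesis by (simp add: num_def)
qed

lemma num_0: "num k P c = 0 \<longleftrightarrow> (\<forall>i<k. \<not> P (c i))"
  by (auto simp: num_def)

definition rep :: "nat \<Rightarrow> nat \<Rightarrow> (nat \<Rightarrow> nat) \<Rightarrow> (nat \<Rightarrow> nat) \<Rightarrow> bool" where
  "rep k t c x \<longleftrightarrow> (\<forall>i<k. x i = sym b (fst (cfg t)) (c i) \<and> c i < b) \<and>
     (\<forall>r\<ge>2. num k (\<lambda>c. c = r) c = snd (cfg t) r)"

lemma rep_init: "rep k 0 (\<lambda>_. 0) (\<lambda>_. 9)"
  using b1 by (simp add: rep_def cfg_def sym_def num_def)

text \<open>A move that no unit forbids is the step of the counter machine: with an empty register
  no unit can be touched by a decrement, and with a nonempty one a counting unit vetoes the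
  jump.\<close>

lemma rep_step:
  assumes r: "rep k t c x" and j: "j < k" and m: "m < 2"
    and ok: "\<forall>i<k. d m (if i = j then 1 else 2) (x i) \<noteq> 0"
  shows "kd (fst (cfg t)) \<in> {1, 2} \<and>
    (\<exists>v. v \<noteq> 0 \<and> rep k (Suc t) (c(j := v)) (\<lambda>i. d m (if i = j then 1 else 2) (x i)))"
proof -
  obtain q V where qV: "cfg t = (q, V)" by force
  have q: "q < S" using cfg_less[of t] qV by simp
  have x: "x i = sym b q (c i)" "c i < b" if "i < k" for i using r that by (auto simp: rep_def qV)
  have V: "num k (\<lambda>c. c = r) c = V r" if "2 \<le> r" for r using r that by (auto simp: rep_def qV)
  have dx: "d m (if i = j then 1 else 2) (x i) = (if m = 0 then
        if kd q = 1 then if i = j then if c i = 0 then sym b (na q) (rg q) else 0 else sym b (na q) (c i)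
        else if kd q = 2 then if i = j then if c i = rg q then sym b (na q) 1 else 0 else sym b (na q) (c i)
        else 0
      else if kd q = 2 then
        if i = j then if c i = 0 then sym b (nb q) 1 else 0 else if c i = rg q then 0 else sym b (nb q) (c i)
      else 0)" if "i < k" for i
    using x[OF that] by (simp add: d_sym)
  have okj: "d m (if j = j then 1 else 2) (x j) \<noteq> 0" using ok j by blast
  have up: "num k (\<lambda>c. c = r) (c(j := v)) + of_bool (c j = r) = V r + of_bool (v = r)" if "2 \<le> r" for r v
    using num_upd[OF j, of "\<lambda>c. c = r" c v] V[OF that] by simp
  consider "kd q = 1" "m = 0" "c j = 0" | "kd q = 2" "m = 0" "c j = rg q" | "kd q = 2" "m \<noteq> 0" "c j = 0"
    using okj unfolding dx[OF j] by (auto split: if_splits)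
  then show ?thesis
  proof cases
    case 1
    have g: "2 \<le> rg q" using rg_ge[OF q] 1 by simp
    have "rep k (Suc t) (c(j := rg q)) (\<lambda>i. d m (if i = j then 1 else 2) (x i))"
      unfolding rep_def cfg_Suc qV
    proof (intro conjI allI impI)
      fix i assume i: "i < k"
      show "d m (if i = j then 1 else 2) (x i) = sym b (fst (cstep (q, V))) ((c(j := rg q)) i)"
        unfolding dx[OF i] using 1 by simp
      show "(c(j := rg q)) i < b" using x[OF i] rg_less[OF q] by simp
    next
      fix r :: nat assume "2 \<le> r"
      from up[OF this, of "rg q"] show "num k (\<lambda>c. c = r) (c(j := rg q)) = snd (cstep (q, V)) r"
        using 1 \<open>2 \<le> r\<close> by auto
    qed
    then show ?thesis using 1 g qV by (intro conjI exI[of _ "rg q"]) auto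
  next
    case 2
    have g: "2 \<le> rg q" using rg_ge[OF q] 2 by simp
    have pos: "0 < V (rg q)" using up[OF g, of 1] 2 g by simp
    have "rep k (Suc t) (c(j := 1)) (\<lambda>i. d m (if i = j then 1 else 2) (x i))"
      unfolding rep_def cfg_Suc qV
    proof (intro conjI allI impI)
      fix i assume i: "i < k"
      show "d m (if i = j then 1 else 2) (x i) = sym b (fst (cstep (q, V))) ((c(j := 1)) i)"
        unfolding dx[OF i] using 2 pos by simp
      show "(c(j := 1)) i < b" using x[OF i] b1 by simp
    next
      fix r :: nat assume "2 \<le> r"
      from up[OF this, of 1] show "num k (\<lambda>c. c = r) (c(j := 1)) = snd (cstep (q, V)) r"
        using 2 pos \<open>2 \<le> r\<close> by auto
    qed
    then show ?thesis using 2 qV by (intro conjI exI[of _ 1]) auto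
  next
    case 3
    have g: "2 \<le> rg q" using rg_ge[OF q] 3 by simp
    have "c i \<noteq> rg q" if "i < k" for i
    proof (cases "i = j")
      case True
      then show ?thesis using 3 g by simp
    next
      case False
      have "d m (if i = j then 1 else 2) (x i) \<noteq> 0" using ok that by blast
      then show ?thesis unfolding dx[OF that] using False 3 by (auto split: if_splits)
    qed
    then have V0: "V (rg q) = 0" using V[OF g] num_0[of k "\<lambda>c. c = rg q" c] by simp
    have "rep k (Suc t) (c(j := 1)) (\<lambda>i. d m (if i = j then 1 else 2) (x i))"
      unfolding rep_def cfg_Suc qV
    proof (intro conjI allI impI)
      fix i assume i: "i < k"
      have "d m (if i = j then 1 else 2) (x i) \<noteq> 0" using ok i by blast
      then show "d m (if i = j then 1 else 2) (x i) = sym b (fst (cstep (q, V))) ((c(j := 1)) i)"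
        unfolding dx[OF i] using 3 V0 by (auto split: if_splits)
      show "(c(j := 1)) i < b" using x[OF i] b1 by simp
    next
      fix r :: nat assume "2 \<le> r"
      from up[OF this, of 1] show "num k (\<lambda>c. c = r) (c(j := 1)) = snd (cstep (q, V)) r"
        using 3 V0 \<open>2 \<le> r\<close> by auto
    qed
    then show ?thesis using 3 qV by (intro conjI exI[of _ 1]) auto
  qed
qed

text \<open>Only the touched unit can stop being free, so the number of units that are not free is
  bounded by the number of steps.\<close>

lemma reach_rep:
  assumes "x \<in> reach k"
  shows "\<exists>t c. rep k t c x \<and> num k (\<lambda>c. c \<noteq> 0) c \<le> t \<and> (\<forall>t'<t. kd (fst (cfg t')) \<in> {1, 2})"
  using assms
proof (induction rule: reach.induct)
  case init
  show ?case using rep_init[of k] by (intro exI[of _ 0] exI[of _ "\<lambda>_. 0"]) (simp add: num_def)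
next
  case (step x j m)
  then obtain t c where t: "rep k t c x" "num k (\<lambda>c. c \<noteq> 0) c \<le> t" "\<forall>t'<t. kd (fst (cfg t')) \<in> {1, 2}" by blast
  from rep_step[OF t(1) step.hyps(2,3,4)] obtain v where v: "kd (fst (cfg t)) \<in> {1, 2}"
    "rep k (Suc t) (c(j := v)) (\<lambda>i. d m (if i = j then 1 else 2) (x i))" by blast
  have "of_bool (v \<noteq> 0) \<le> (1::nat)" by simp
  then have "num k (\<lambda>c. c \<noteq> 0) (c(j := v)) \<le> Suc t"
    using num_upd[OF step.hyps(2), of "\<lambda>c. c \<noteq> 0" c v] t(2) by linarith
  moreover have "\<forall>t'<Suc t. kd (fst (cfg t')) \<in> {1, 2}" using t(3) v(1) by (auto simp: less_Suc_eq)
  ultimately show ?case using v(2) by blast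
qed

text \<open>Give a free unit weight 2, a counting unit weight 1 and a used-up unit weight 0. An
  increment or a decrement lowers the total weight by 1, a jump by 2.\<close>

lemma follow:
  assumes r: "rep k t c x" and x: "x \<in> reach k" and kd: "kd (fst (cfg t)) \<in> {1, 2}"
    and free: "\<exists>i<k. c i = 0"
  shows "\<exists>x'\<in>reach k. \<exists>c'. rep k (Suc t) c' x' \<and>
    2 * num k (\<lambda>c. c = 0) c' + num k (\<lambda>c. 2 \<le> c) c' < 2 * num k (\<lambda>c. c = 0) c + num k (\<lambda>c. 2 \<le> c) c"
proof -
  obtain q V where qV: "cfg t = (q, V)" by force
  have q: "q < S" using cfg_less[of t] qV by simp
  have xi: "x i = sym b q (c i)" "c i < b" if "i < k" for i using r that by (auto simp: rep_def qV)
  have V: "num k (\<lambda>c. c = r) c = V r" if "2 \<le> r" for r using r that by (auto simp: rep_def qV)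
  have kq: "kd q = 1 \<or> kd q = 2" using kd qV by simp
  have g: "2 \<le> rg q" using rg_ge[OF q kq] .
  have sym0: "sym b q' c' \<noteq> 0" for q' c' by (simp add: sym_def)
  have "\<exists>m<2. \<exists>j<k. (\<forall>i<k. d m (if i = j then 1 else 2) (x i) \<noteq> 0) \<and>
      (c j = 0 \<or> 2 \<le> c j \<and> kd q = 2 \<and> m = 0)"
  proof (cases "kd q = 2 \<and> 0 < V (rg q)")
    case True
    then have "num k (\<lambda>c. c = rg q) c \<noteq> 0" using V[OF g] by simp
    then obtain j where j: "j < k" "c j = rg q" unfolding num_0 by blast
    have "d 0 (if i = j then 1 else 2) (x i) \<noteq> 0" if "i < k" for i
      using xi[OF that] True j sym0 by (simp add: d_sym)
    then show ?thesis using j g True by (intro exI[of _ 0] exI[of _ j] conjI) simp_all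
  next
    case False
    obtain j where j: "j < k" "c j = 0" using free by blast
    show ?thesis
    proof (cases "kd q = 1")
      case True
      have "d 0 (if i = j then 1 else 2) (x i) \<noteq> 0" if "i < k" for i
        using xi[OF that] True j sym0 by (simp add: d_sym)
      then show ?thesis using j by (intro exI[of _ 0] exI[of _ j] conjI) simp_all
    next
      case 2: False
      then have k2: "kd q = 2" using kq by simp
      then have "num k (\<lambda>c. c = rg q) c = 0" using V[OF g] False by simp
      then have "c i \<noteq> rg q" if "i < k" for i using that unfolding num_0 by blast
      then have "d 1 (if i = j then 1 else 2) (x i) \<noteq> 0" if "i < k" for i
        using xi[OF that] k2 j sym0 that by (simp add: d_sym)
      then show ?thesis using j by (intro exI[of _ 1] exI[of _ j] conjI) simp_all
    qed
  qed
  then obtain m j where mj: "m < 2" "j < k" "\<forall>i<k. d m (if i = j then 1 else 2) (x i) \<noteq> 0"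
    "c j = 0 \<or> 2 \<le> c j \<and> kd q = 2 \<and> m = 0" by blast
  let ?x = "\<lambda>i. d m (if i = j then 1 else 2) (x i)"
  obtain v where v: "v \<noteq> 0" "rep k (Suc t) (c(j := v)) ?x" using rep_step[OF r mj(2,1,3)] by blast
  have x': "?x \<in> reach k" by (rule reach.step[OF x mj(2,1,3)])
  have n0: "num k (\<lambda>c. c = 0) (c(j := v)) + of_bool (c j = 0) = num k (\<lambda>c. c = 0) c"
    using num_upd[OF mj(2), of "\<lambda>c. c = 0" c v] v(1) by simp
  have n2: "num k (\<lambda>c. 2 \<le> c) (c(j := v)) + of_bool (2 \<le> c j) = num k (\<lambda>c. 2 \<le> c) c + of_bool (2 \<le> v)"
    by (rule num_upd[OF mj(2)])
  have "2 * num k (\<lambda>c. c = 0) (c(j := v)) + num k (\<lambda>c. 2 \<le> c) (c(j := v)) <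
      2 * num k (\<lambda>c. c = 0) c + num k (\<lambda>c. 2 \<le> c) c"
  proof (cases "c j = 0")
    case True
    then have "num k (\<lambda>c. c = 0) (c(j := v)) + 1 = num k (\<lambda>c. c = 0) c"
      "num k (\<lambda>c. 2 \<le> c) (c(j := v)) = num k (\<lambda>c. 2 \<le> c) c + of_bool (2 \<le> v)"
      using n0 n2 by simp_all
    moreover have "of_bool (2 \<le> v) \<le> (1::nat)" by simp
    ultimately show ?thesis by linarith
  next
    case False
    then have cj: "2 \<le> c j" "kd q = 2" "m = 0" using mj(4) by auto
    have "sym b (fst (cfg (Suc t))) v = ?x j" "v < b" using v(2) mj(2) by (auto simp: rep_def)
    moreover have "?x j \<noteq> 0" using mj by blast
    then have "?x j = sym b (na q) 1" using xi[OF mj(2)] cj by (simp add: d_sym split: if_splits)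
    ultimately have "v = 1" using sym_mod[of v b] sym_mod[of 1 b] b1 by metis
    then have "num k (\<lambda>c. 2 \<le> c) (c(j := v)) + 1 = num k (\<lambda>c. 2 \<le> c) c"
      "num k (\<lambda>c. c = 0) (c(j := v)) = num k (\<lambda>c. c = 0) c"
      using n0 n2 cj False by simp_all
    then show ?thesis by linarith
  qed
  then show ?thesis using x' v(2) by blast
qed

text \<open>If every run leaves a free unit and the machine never stops, it can be followed forever,
  although the weight falls at each step. If it stops, the number of its steps bounds how many units
  are ever taken.\<close>

theorem bounded_iff_stops: "(\<exists>k>0. \<forall>x\<in>reach k. \<exists>i<k. \<not> used b (x i)) \<longleftrightarrow> stops"
proof
  assume "\<exists>k>0. \<forall>x\<in>reach k. \<exists>i<k. \<not> used b (x i)"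
  then obtain k where k: "\<And>x. x \<in> reach k \<Longrightarrow> \<exists>i<k. \<not> used b (x i)" by blast
  show stops
  proof (rule ccontr)
    assume "\<not> stops"
    then have kd: "kd (fst (cfg t)) \<in> {1, 2}" for t by (auto simp: stops_def)
    \<comment> \<open>\<open>3 * k\<close> is a crude bound for the initial weight.\<close>
    have "\<exists>x\<in>reach k. \<exists>c. rep k t c x \<and> 2 * num k (\<lambda>c. c = 0) c + num k (\<lambda>c. 2 \<le> c) c + t \<le> 3 * k" for t
    proof (induction t)
      case 0
      have "2 * num k (\<lambda>c. c = 0) (\<lambda>_. 0) + num k (\<lambda>c. 2 \<le> c) (\<lambda>_. 0) \<le> 3 * k"
        using num_le[of k "\<lambda>c. c = 0" "\<lambda>_. 0"] num_le[of k "\<lambda>c. 2 \<le> c" "\<lambda>_. 0"] by linarith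
      then show ?case using rep_init[of k] reach.init[of k] by (metis add.right_neutral)
    next
      case (Suc t)
      then obtain x c where x: "x \<in> reach k" "rep k t c x"
        "2 * num k (\<lambda>c. c = 0) c + num k (\<lambda>c. 2 \<le> c) c + t \<le> 3 * k" by blast
      obtain i where i: "i < k" "\<not> used b (x i)" using k[OF x(1)] by blast
      then have "c i = 0" using x(2) sym_mod[of "c i" b] by (auto simp: rep_def used_def)
      then have free: "\<exists>i<k. c i = 0" using i(1) by blast
      obtain x' c' where x': "x' \<in> reach k" "rep k (Suc t) c' x'"
        "2 * num k (\<lambda>c. c = 0) c' + num k (\<lambda>c. 2 \<le> c) c' < 2 * num k (\<lambda>c. c = 0) c + num k (\<lambda>c. 2 \<le> c) c"
        using follow[OF x(2,1) kd free] by blast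
      have "2 * num k (\<lambda>c. c = 0) c' + num k (\<lambda>c. 2 \<le> c) c' + Suc t \<le> 3 * k" using x'(3) x(3) by linarith
      then show ?case using x'(1,2) by blast
    qed
    from this[of "3 * k + 1"] show False by auto
  qed
next
  assume stops
  then obtain t where t: "kd (fst (cfg t)) \<notin> {1, 2}" by (auto simp: stops_def)
  \<comment> \<open>At most \<open>t\<close> steps are possible before the halt, so one of
    \<open>Suc t\<close> units remains free.\<close>
  have "\<exists>i<Suc t. \<not> used b (x i)" if x: "x \<in> reach (Suc t)" for x
  proof (rule ccontr)
    assume all: "\<not> ?thesis"
    obtain t' c where t': "rep (Suc t) t' c x" "num (Suc t) (\<lambda>c. c \<noteq> 0) c \<le> t'"
      "\<forall>t''<t'. kd (fst (cfg t'')) \<in> {1, 2}" using reach_rep[OF x] by blast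
    have "t' \<le> t" using t'(3) t by (metis not_le)
    have "c i \<noteq> 0" if "i < Suc t" for i
    proof
      assume "c i = 0"
      then have "\<not> used b (x i)" using t'(1) that sym_mod[of 0 b] b1 by (simp add: rep_def used_def)
      then show False using all that by blast
    qed
    then have "{i. i < Suc t \<and> c i \<noteq> 0} = {..<Suc t}" by auto
    then have "num (Suc t) (\<lambda>c. c \<noteq> 0) c = Suc t" unfolding num_def by simp
    then show False using t'(2) \<open>t' \<le> t\<close> by simp
  qed
  then show "\<exists>k>0. \<forall>x\<in>reach k. \<exists>i<k. \<not> used b (x i)" by (intro exI[of _ "Suc t"]) blast
qed

end

section \<open>Loop programs\<close>

text \<open>\<open>Loop r c\<close> runs \<open>r := r - 1; c\<close> as long as \<open>r\<close> is not zero.\<close>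

datatype com = Inc nat | Dec nat | Seq com com | Loop nat com

inductive big :: "com \<Rightarrow> (nat \<Rightarrow> nat) \<Rightarrow> (nat \<Rightarrow> nat) \<Rightarrow> bool" where
  Inc: "big (Inc r) s (s(r := Suc (s r)))"
| Dec: "big (Dec r) s (s(r := s r - Suc 0))"
| Seq: "big c s s' \<Longrightarrow> big c' s' s'' \<Longrightarrow> big (Seq c c') s s''"
| Loop0: "s r = 0 \<Longrightarrow> big (Loop r c) s s"
| Loop1: "s r > 0 \<Longrightarrow> big c (s(r := s r - Suc 0)) s' \<Longrightarrow> big (Loop r c) s' s'' \<Longrightarrow> big (Loop r c) s s''"

fun ren :: "(nat \<Rightarrow> nat) \<Rightarrow> com \<Rightarrow> com" where
  "ren f (Inc r) = Inc (f r)"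
| "ren f (Dec r) = Dec (f r)"
| "ren f (Seq c c') = Seq (ren f c) (ren f c')"
| "ren f (Loop r c) = Loop (f r) (ren f c)"

text \<open>Registers outside the range of \<open>f\<close> keep their values, so a renamed program
  can run beside data that must survive.\<close>

lemma big_ren:
  assumes "big c t t'" "inj f" "t = s \<circ> f"
  shows "\<exists>s'. big (ren f c) s s' \<and> t' = s' \<circ> f \<and> (\<forall>j. j \<notin> range f \<longrightarrow> s' j = s j)"
  using assms(1,3)
proof (induction arbitrary: s rule: big.induct)
  case (Inc r t)
  have "big (ren f (Inc r)) s (s(f r := Suc (s (f r))))" by (simp add: big.Inc)
  moreover have "t(r := Suc (t r)) = s(f r := Suc (s (f r))) \<circ> f"
    using Inc by (auto simp: fun_eq_iff inj_eq[OF assms(2)])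
  moreover have "\<forall>j. j \<notin> range f \<longrightarrow> (s(f r := Suc (s (f r)))) j = s j" by auto
  ultimately show ?case by blast
next
  case (Dec r t)
  have "big (ren f (Dec r)) s (s(f r := s (f r) - Suc 0))" by (simp add: big.Dec)
  moreover have "t(r := t r - Suc 0) = s(f r := s (f r) - Suc 0) \<circ> f"
    using Dec by (auto simp: fun_eq_iff inj_eq[OF assms(2)])
  moreover have "\<forall>j. j \<notin> range f \<longrightarrow> (s(f r := s (f r) - Suc 0)) j = s j" by auto
  ultimately show ?case by blast
next
  case (Seq c t t' c' t'')
  obtain s' where s': "big (ren f c) s s'" "t' = s' \<circ> f" "\<forall>j. j \<notin> range f \<longrightarrow> s' j = s j"
    using Seq by blast
  obtain s'' where s'': "big (ren f c') s' s''" "t'' = s'' \<circ> f" "\<forall>j. j \<notin> range f \<longrightarrow> s'' j = s' j"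
    using Seq s' by blast
  have "big (ren f (Seq c c')) s s''" using s' s'' by (auto intro: big.Seq)
  then show ?case using s' s'' by auto
next
  case (Loop0 t r c)
  then have "big (ren f (Loop r c)) s s" by (auto intro: big.Loop0)
  then show ?case using Loop0 by blast
next
  case (Loop1 t r c t' t'')
  have "t(r := t r - Suc 0) = s(f r := s (f r) - Suc 0) \<circ> f"
    using Loop1.prems by (auto simp: fun_eq_iff inj_eq[OF assms(2)])
  then obtain s' where s': "big (ren f c) (s(f r := s (f r) - Suc 0)) s'" "t' = s' \<circ> f"
    "\<forall>j. j \<notin> range f \<longrightarrow> s' j = (s(f r := s (f r) - Suc 0)) j"
    using Loop1.IH(1) by blast
  obtain s'' where s'': "big (ren f (Loop r c)) s' s''" "t'' = s'' \<circ> f" "\<forall>j. j \<notin> range f \<longrightarrow> s'' j = s' j"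
    using Loop1.IH(2) s'(2) by blast
  have "big (ren f (Loop r c)) s s''"
    using s'(1) s''(1) Loop1.hyps(1) Loop1.prems by (auto intro: big.Loop1)
  moreover have "\<forall>j. j \<notin> range f \<longrightarrow> s'' j = s j"
  proof (intro allI impI)
    fix j assume "j \<notin> range f"
    then show "s'' j = s j" using s'(3) s''(3) by (auto split: if_splits)
  qed
  ultimately show ?case using s''(2) by blast
qed

definition clear :: "nat \<Rightarrow> com" where "clear r = Loop r (Dec r)"
definition move :: "nat \<Rightarrow> nat \<Rightarrow> com" where "move a b = Seq (clear b) (Loop a (Inc b))"
text \<open>A loop destroys its counter, so \<open>a\<close> is restored from the second copy
  \<open>t\<close>.\<close>

definition copy :: "nat \<Rightarrow> nat \<Rightarrow> nat \<Rightarrow> com" where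
  "copy a b t = Seq (clear b) (Seq (clear t) (Seq (Loop a (Seq (Inc b) (Inc t))) (Loop t (Inc a))))"

lemma big_clear: "big (clear r) s (s(r := 0))"
proof (induction "s r" arbitrary: s rule: less_induct)
  case less
  show ?case
  proof (cases "s r = 0")
    case True
    then have "s(r := 0) = s" by auto
    then show ?thesis using True big.Loop0[of s r "Dec r"] by (simp add: clear_def)
  next
    case False
    let ?s = "(s(r := s r - Suc 0))(r := (s(r := s r - Suc 0)) r - Suc 0)"
    have "big (clear r) ?s (?s(r := 0))" using False by (intro less) simp
    then show ?thesis using False big.Loop1[of s r "Dec r" ?s] big.Dec[of r "s(r := s r - Suc 0)"]
      by (simp add: clear_def)
  qed
qed

lemma big_Loop_Inc:
  assumes "a \<noteq> b" shows "big (Loop a (Inc b)) s (s(a := 0, b := s b + s a))"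
proof (induction "s a" arbitrary: s)
  case 0
  then have "s(a := 0, b := s b + s a) = s" by (auto simp: fun_eq_iff)
  moreover have "big (Loop a (Inc b)) s s" using 0 by (intro big.Loop0) simp
  ultimately show ?case by (simp only:)
next
  case (Suc n)
  let ?s = "(s(a := s a - Suc 0))(b := Suc ((s(a := s a - Suc 0)) b))"
  have "big (Loop a (Inc b)) ?s (?s(a := 0, b := ?s b + ?s a))"
    using Suc(2) assms by (intro Suc(1)) auto
  moreover have "?s(a := 0, b := ?s b + ?s a) = s(a := 0, b := s b + s a)"
    using Suc(2)[symmetric] assms by (auto simp: fun_eq_iff)
  ultimately have l: "big (Loop a (Inc b)) ?s (s(a := 0, b := s b + s a))" by simp
  show ?case by (rule big.Loop1[OF _ big.Inc l]) (use Suc(2) in simp)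
qed

lemma big_move: "a \<noteq> b \<Longrightarrow> big (move a b) s (s(a := 0, b := s a))"
proof -
  assume ab: "a \<noteq> b"
  let ?s = "s(b := 0)"
  have "?s(a := 0, b := ?s b + ?s a) = s(a := 0, b := s a)" using ab by (auto simp: fun_eq_iff)
  then show ?thesis using big.Seq[OF big_clear big_Loop_Inc[OF ab, of ?s]] by (simp add: move_def)
qed

lemma big_Loop_Inc2:
  assumes "a \<noteq> b" "a \<noteq> t" "b \<noteq> t"
  shows "big (Loop a (Seq (Inc b) (Inc t))) s (s(a := 0, b := s b + s a, t := s t + s a))"
proof (induction "s a" arbitrary: s)
  case 0
  then have "s(a := 0, b := s b + s a, t := s t + s a) = s" by (auto simp: fun_eq_iff)
  moreover have "big (Loop a (Seq (Inc b) (Inc t))) s s" using 0 by (intro big.Loop0) simp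
  ultimately show ?case by (simp only:)
next
  case (Suc n)
  let ?s1 = "s(a := s a - Suc 0)"
  let ?s2 = "?s1(b := Suc (?s1 b))"
  let ?s = "?s2(t := Suc (?s2 t))"
  have "big (Loop a (Seq (Inc b) (Inc t))) ?s (?s(a := 0, b := ?s b + ?s a, t := ?s t + ?s a))"
    using Suc(2) assms by (intro Suc(1)) auto
  moreover have "?s(a := 0, b := ?s b + ?s a, t := ?s t + ?s a) = s(a := 0, b := s b + s a, t := s t + s a)"
    using Suc(2)[symmetric] assms by (auto simp: fun_eq_iff)
  ultimately have l: "big (Loop a (Seq (Inc b) (Inc t))) ?s (s(a := 0, b := s b + s a, t := s t + s a))"
    by simp
  show ?case by (rule big.Loop1[OF _ big.Seq[OF big.Inc big.Inc] l]) (use Suc(2) in simp)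
qed

lemma big_copy:
  assumes "a \<noteq> b" "a \<noteq> t" "b \<noteq> t" shows "big (copy a b t) s (s(t := 0, b := s a))"
proof -
  let ?s1 = "s(b := 0, t := 0)"
  let ?s2 = "?s1(a := 0, b := ?s1 b + ?s1 a, t := ?s1 t + ?s1 a)"
  have "?s2(t := 0, a := ?s2 a + ?s2 t) = s(t := 0, b := s a)" using assms by (auto simp: fun_eq_iff)
  then show ?thesis unfolding copy_def
    using big.Seq[OF big_clear[of b s] big.Seq[OF big_clear[of t] big.Seq[OF big_Loop_Inc2[OF assms, of ?s1]
      big_Loop_Inc[of t a ?s2]]]] assms by simp
qed

section \<open>Expressions computed by loop programs\<close>

definition ex :: "nat \<Rightarrow> ((nat \<Rightarrow> nat) \<Rightarrow> nat) \<Rightarrow> bool" where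
  "ex d f \<longleftrightarrow> (\<forall>s s'. (\<forall>i<d. s i = s' i) \<longrightarrow> f s = f s') \<and>
     (\<exists>c. \<forall>s. \<exists>s'. big c s s' \<and> (\<forall>i<d. s' i = s i) \<and> s' d = f s)"

lemma ex_dep: "ex d f \<Longrightarrow> \<forall>i<d. s i = s' i \<Longrightarrow> f s = f s'"
  by (simp add: ex_def)

lemma ex_prog:
  assumes "ex d f"
  obtains c where "\<And>s. \<exists>s'. big c s s' \<and> (\<forall>i<d. s' i = s i) \<and> s' d = f s"
  using assms by (auto simp: ex_def)

lemma exI_prog:
  assumes "\<And>s s'. \<forall>i<d. s i = s' i \<Longrightarrow> f s = f s'"
    "\<And>s. \<exists>s'. big c s s' \<and> (\<forall>i<d. s' i = s i) \<and> s' d = f s"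
  shows "ex d f"
  using assms unfolding ex_def by blast

lemma ex_weaken:
  assumes f: "ex d f" and d: "d \<le> d'" shows "ex d' f"
proof -
  obtain c where c: "\<And>s. \<exists>s'. big c s s' \<and> (\<forall>i<d. s' i = s i) \<and> s' d = f s" using ex_prog[OF f] by blast
  define \<sigma> where "\<sigma> i = (if i < d then i else i + (d' - d))" for i
  have inj: "inj \<sigma>" by (auto simp: inj_def \<sigma>_def split: if_splits)
  have "\<exists>s'. big (ren \<sigma> c) s s' \<and> (\<forall>i<d'. s' i = s i) \<and> s' d' = f s" for s
  proof -
    obtain t' where t': "big c (s \<circ> \<sigma>) t'" "\<forall>i<d. t' i = (s \<circ> \<sigma>) i" "t' d = f (s \<circ> \<sigma>)" using c by blast
    obtain s' where s': "big (ren \<sigma> c) s s'" "t' = s' \<circ> \<sigma>" "\<forall>j. j \<notin> range \<sigma> \<longrightarrow> s' j = s j"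
      using big_ren[OF t'(1) inj refl] by blast
    have "s' i = s i" if "i < d'" for i
    proof (cases "i < d")
      case True
      then have "t' i = s i" "t' i = s' i" using t'(2) s'(2) by (auto simp: \<sigma>_def)
      then show ?thesis by simp
    next
      case False
      then have "i \<notin> range \<sigma>" using that d by (auto simp: \<sigma>_def split: if_splits)
      then show ?thesis using s'(3) by blast
    qed
    moreover have "s' d' = t' d" using s'(2) d by (simp add: \<sigma>_def)
    moreover have "f (s \<circ> \<sigma>) = f s" by (rule ex_dep[OF f]) (simp add: \<sigma>_def)
    ultimately show ?thesis using s'(1) t'(3) by auto
  qed
  moreover have "f s = f s'" if "\<forall>i<d'. s i = s' i" for s s'
    using that d by (intro ex_dep[OF f]) simp
  ultimately show ?thesis using exI_prog[of d' f "ren \<sigma> c"] by blast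
qed

lemma ex_var: assumes "i < d" shows "ex d (\<lambda>s. s i)"
proof (rule exI_prog)
  show "\<exists>s'. big (copy i d (Suc d)) s s' \<and> (\<forall>i<d. s' i = s i) \<and> s' d = s i" for s
    by (intro exI[of _ "s(Suc d := 0, d := s i)"] conjI big_copy) (use assms in simp_all)
qed (use assms in simp)

lemma ex_Suc: assumes "ex d f" shows "ex d (\<lambda>s. Suc (f s))"
proof -
  obtain c where c: "\<And>s. \<exists>s'. big c s s' \<and> (\<forall>i<d. s' i = s i) \<and> s' d = f s" using ex_prog[OF assms] by blast
  show ?thesis
  proof (rule exI_prog)
    fix s
    obtain s' where s': "big c s s'" "\<forall>i<d. s' i = s i" "s' d = f s" using c by blast
    have "big (Seq c (Inc d)) s (s'(d := Suc (s' d)))" by (rule big.Seq[OF s'(1) big.Inc])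
    then show "\<exists>s'. big (Seq c (Inc d)) s s' \<and> (\<forall>i<d. s' i = s i) \<and> s' d = Suc (f s)"
      using s' by (intro exI[of _ "s'(d := Suc (s' d))"] conjI) simp_all
  next
    fix s s' :: "nat \<Rightarrow> nat" assume "\<forall>i<d. s i = s' i"
    then show "Suc (f s) = Suc (f s')" using ex_dep[OF assms] by metis
  qed
qed

lemma ex_pred: assumes "ex d f" shows "ex d (\<lambda>s. f s - 1)"
proof -
  obtain c where c: "\<And>s. \<exists>s'. big c s s' \<and> (\<forall>i<d. s' i = s i) \<and> s' d = f s" using ex_prog[OF assms] by blast
  show ?thesis
  proof (rule exI_prog)
    fix s
    obtain s' where s': "big c s s'" "\<forall>i<d. s' i = s i" "s' d = f s" using c by blast
    have "big (Seq c (Dec d)) s (s'(d := s' d - Suc 0))" by (rule big.Seq[OF s'(1) big.Dec])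
    then show "\<exists>s'. big (Seq c (Dec d)) s s' \<and> (\<forall>i<d. s' i = s i) \<and> s' d = f s - 1"
      using s' by (intro exI[of _ "s'(d := s' d - Suc 0)"] conjI) simp_all
  next
    fix s s' :: "nat \<Rightarrow> nat" assume "\<forall>i<d. s i = s' i"
    then show "f s - 1 = f s' - 1" using ex_dep[OF assms] by metis
  qed
qed

lemma ex_const: "ex d (\<lambda>s. k)"
proof (induction k)
  case 0
  show ?case
  proof (rule exI_prog)
    have "big (clear d) s (s(d := 0)) \<and> (\<forall>i<d. (s(d := 0)) i = s i) \<and> (s(d := 0)) d = 0" for s
      by (intro conjI big_clear) simp_all
    then show "\<exists>s'. big (clear d) s s' \<and> (\<forall>i<d. s' i = s i) \<and> s' d = 0" for s by blast
  qed simp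
next
  case (Suc k)
  then show ?case by (rule ex_Suc)
qed

lemma ex_args:
  assumes "\<forall>f\<in>set fs. ex d f"
  shows "\<exists>c. \<forall>s. \<exists>s'. big c s s' \<and> (\<forall>i<d. s' i = s i) \<and> (\<forall>j<length fs. s' (d + j) = (fs ! j) s)"
  using assms
proof (induction fs rule: rev_induct)
  case Nil
  have "big (clear d) s (s(d := 0)) \<and> (\<forall>i<d. (s(d := 0)) i = s i)" for s
    by (intro conjI big_clear) simp
  then show ?case unfolding list.size(3) by blast
next
  case (snoc f fs)
  obtain c where c: "\<And>s. \<exists>s'. big c s s' \<and> (\<forall>i<d. s' i = s i) \<and> (\<forall>j<length fs. s' (d + j) = (fs ! j) s)"
    using snoc by auto
  have f: "ex d f" using snoc by simp
  obtain c' where c': "\<And>s. \<exists>s'. big c' s s' \<and> (\<forall>i<d + length fs. s' i = s i) \<and> s' (d + length fs) = f s"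
    using ex_prog[OF ex_weaken[OF f, of "d + length fs"]] by auto
  show ?case
  proof (rule exI, rule allI)
    fix s
    obtain s' where s': "big c s s'" "\<forall>i<d. s' i = s i" "\<forall>j<length fs. s' (d + j) = (fs ! j) s" using c by blast
    obtain s'' where s'': "big c' s' s''" "\<forall>i<d + length fs. s'' i = s' i" "s'' (d + length fs) = f s'" using c' by blast
    have "f s' = f s" by (rule ex_dep[OF f]) (use s' in simp)
    then have "\<forall>j<length (fs @ [f]). s'' (d + j) = ((fs @ [f]) ! j) s"
      using s' s'' by (auto simp: nth_append less_Suc_eq)
    then show "\<exists>s'. big (Seq c c') s s' \<and> (\<forall>i<d. s' i = s i) \<and> (\<forall>j<length (fs @ [f]). s' (d + j) = ((fs @ [f]) ! j) s)"
      using s' s'' by (intro exI[of _ s'']) (auto intro: big.Seq)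
  qed
qed

text \<open>The arguments are stacked from register \<open>d\<close> on, where they are the inputs
  of the program for \<open>F\<close> shifted by \<open>d\<close>.\<close>

lemma ex_app:
  assumes fs: "\<forall>f\<in>set fs. ex d f" and F: "ex (length fs) (\<lambda>s. F (map s [0..<length fs]))"
  shows "ex d (\<lambda>s. F (map (\<lambda>f. f s) fs))"
proof -
  let ?k = "length fs"
  obtain c where c: "\<And>s. \<exists>s'. big c s s' \<and> (\<forall>i<d. s' i = s i) \<and> (\<forall>j<?k. s' (d + j) = (fs ! j) s)"
    using ex_args[OF fs] by blast
  obtain c' where c': "\<And>s. \<exists>s'. big c' s s' \<and> (\<forall>i<?k. s' i = s i) \<and> s' ?k = F (map s [0..<?k])"
    using ex_prog[OF F] by blast
  define \<sigma> where "\<sigma> i = d + i" for i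
  have inj: "inj \<sigma>" by (auto simp: inj_def \<sigma>_def)
  \<comment> \<open>Without arguments the result is already in \<open>d\<close>, and
    \<open>move d d\<close> would erase it. The language has no skip, hence an increment followed by
    a decrement.\<close>
  let ?m = "if ?k = 0 then Seq (Inc d) (Dec d) else move (d + ?k) d"
  show ?thesis
  proof (rule exI_prog)
    fix s
    obtain s1 where s1: "big c s s1" "\<forall>i<d. s1 i = s i" "\<forall>j<?k. s1 (d + j) = (fs ! j) s" using c by blast
    obtain t where t: "big c' (s1 \<circ> \<sigma>) t" "t ?k = F (map (s1 \<circ> \<sigma>) [0..<?k])" using c' by blast
    obtain s2 where s2: "big (ren \<sigma> c') s1 s2" "t = s2 \<circ> \<sigma>" "\<forall>j. j \<notin> range \<sigma> \<longrightarrow> s2 j = s1 j"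
      using big_ren[OF t(1) inj refl] by blast
    have "map (s1 \<circ> \<sigma>) [0..<?k] = map (\<lambda>f. f s) fs"
      using s1(3) by (intro nth_equalityI) (auto simp: \<sigma>_def)
    then have v: "s2 (d + ?k) = F (map (\<lambda>f. f s) fs)" using t(2) s2(2) by (simp add: \<sigma>_def)
    have low: "s2 i = s i" if "i < d" for i
    proof -
      have "i \<notin> range \<sigma>" using that by (auto simp: \<sigma>_def)
      then show ?thesis using s2(3) s1(2) that by simp
    qed
    have "\<exists>s3. big ?m s2 s3 \<and> (\<forall>i<d. s3 i = s2 i) \<and> s3 d = s2 (d + ?k)"
    proof (cases "?k = 0")
      case True
      have "big (Seq (Inc d) (Dec d)) s2 ((s2(d := Suc (s2 d)))(d := (s2(d := Suc (s2 d))) d - Suc 0))"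
        by (rule big.Seq[OF big.Inc big.Dec])
      then show ?thesis using True by (intro exI conjI) simp_all
    next
      case False
      then show ?thesis using big_move[of "d + ?k" d s2]
        by (intro exI[of _ "s2(d + ?k := 0, d := s2 (d + ?k))"] conjI) simp_all
    qed
    then obtain s3 where s3: "big ?m s2 s3" "\<forall>i<d. s3 i = s2 i" "s3 d = s2 (d + ?k)" by blast
    have "big (Seq c (Seq (ren \<sigma> c') ?m)) s s3" by (rule big.Seq[OF s1(1) big.Seq[OF s2(1) s3(1)]])
    then show "\<exists>s'. big (Seq c (Seq (ren \<sigma> c') ?m)) s s' \<and> (\<forall>i<d. s' i = s i) \<and> s' d = F (map (\<lambda>f. f s) fs)"
      using s3 low v by (intro exI[of _ s3] conjI) simp_all
  next
    fix s s' :: "nat \<Rightarrow> nat" assume *: "\<forall>i<d. s i = s' i"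
    have "f s = f s'" if "f \<in> set fs" for f using ex_dep[OF _ *, of f] fs that by blast
    then have "map (\<lambda>f. f s) fs = map (\<lambda>f. f s') fs" by simp
    then show "F (map (\<lambda>f. f s) fs) = F (map (\<lambda>f. f s') fs)" by (rule arg_cong)
  qed
qed

text \<open>The index runs downwards because the counter of a \<open>Loop\<close> does.\<close>

fun down :: "(nat \<Rightarrow> nat \<Rightarrow> nat) \<Rightarrow> nat \<Rightarrow> nat \<Rightarrow> nat" where
  "down f 0 r = r"
| "down f (Suc k) r = down f k (f k r)"

text \<open>During the loop register \<open>d\<close> is both the counter and the index,
  \<open>Suc d\<close> is the accumulator, and the body leaves its value in
  \<open>d + 2\<close>.\<close>

lemma ex_down:
  assumes n: "ex d n" and a: "ex d a" and b: "ex (d + 2) b"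
  shows "ex d (\<lambda>s. down (\<lambda>k r. b (s(d := k, Suc d := r))) (n s) (a s))"
proof -
  obtain c where c0: "\<forall>s. \<exists>s'. big c s s' \<and> (\<forall>i<d. s' i = s i) \<and>
      (\<forall>j<length [n, a]. s' (d + j) = ([n, a] ! j) s)"
    using ex_args[of "[n, a]" d] n a by auto
  have c: "\<exists>s'. big c s s' \<and> (\<forall>i<d. s' i = s i) \<and> s' d = n s \<and> s' (Suc d) = a s" for s
  proof -
    obtain s' where s': "big c s s'" "\<forall>i<d. s' i = s i"
      and j: "\<forall>j<length [n, a]. s' (d + j) = ([n, a] ! j) s"
      using c0 by blast
    have "s' d = n s" "s' (Suc d) = a s" using j[rule_format, of 0] j[rule_format, of 1] by simp_all
    then show ?thesis using s' by blast
  qed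
  obtain cb where cb: "\<And>s. \<exists>s'. big cb s s' \<and> (\<forall>i<d + 2. s' i = s i) \<and> s' (d + 2) = b s"
    using ex_prog[OF b] by blast
  let ?body = "Seq cb (move (d + 2) (Suc d))"
  have loop: "\<exists>s''. big (Loop d ?body) s' s'' \<and> (\<forall>i<d. s'' i = s i) \<and>
      s'' (Suc d) = down (\<lambda>k r. b (s(d := k, Suc d := r))) (s' d) (s' (Suc d))"
    if "\<forall>i<d. s' i = s i" for s s'
    using that
  proof (induction "s' d" arbitrary: s')
    case 0
    then show ?case by (intro exI[of _ s']) (auto intro: big.Loop0)
  next
    case (Suc k)
    let ?s1 = "s'(d := s' d - Suc 0)"
    obtain s2 where s2: "big cb ?s1 s2" "\<forall>i<d + 2. s2 i = ?s1 i" "s2 (d + 2) = b ?s1" using cb by blast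
    let ?s3 = "s2(d + 2 := 0, Suc d := s2 (d + 2))"
    have s3: "big ?body ?s1 ?s3" by (rule big.Seq[OF s2(1) big_move]) simp
    have v: "?s3 d = k" "?s3 (Suc d) = b ?s1" "\<forall>i<d. ?s3 i = s i" using s2 Suc by auto
    obtain s4 where s4: "big (Loop d ?body) ?s3 s4" "\<forall>i<d. s4 i = s i"
      "s4 (Suc d) = down (\<lambda>k r. b (s(d := k, Suc d := r))) (?s3 d) (?s3 (Suc d))"
      using Suc.hyps(1)[of ?s3] v by auto
    have bs: "b ?s1 = b (s(d := k, Suc d := s' (Suc d)))"
    proof (rule ex_dep[OF b], intro allI impI)
      fix i assume "i < d + 2"
      then consider "i < d" | "i = d" | "i = Suc d" by linarith
      then show "?s1 i = (s(d := k, Suc d := s' (Suc d))) i"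
        by cases (simp_all add: Suc.prems flip: Suc.hyps(2))
    qed
    have "s4 (Suc d) = down (\<lambda>k r. b (s(d := k, Suc d := r))) k (b (s(d := k, Suc d := s' (Suc d))))"
      unfolding s4(3) v(1) v(2) bs ..
    moreover have "s' d = Suc k" using Suc.hyps(2) by simp
    ultimately have "s4 (Suc d) = down (\<lambda>k r. b (s(d := k, Suc d := r))) (s' d) (s' (Suc d))"
      by (simp only: down.simps(2))
    moreover have "big (Loop d ?body) s' s4" by (rule big.Loop1[OF _ s3 s4(1)]) (use Suc in simp)
    ultimately show ?case using s4(2) by blast
  qed
  show ?thesis
  proof (rule exI_prog)
    fix s
    obtain s1 where s1: "big c s s1" "\<forall>i<d. s1 i = s i" "s1 d = n s" "s1 (Suc d) = a s" using c by blast
    obtain s2 where s2: "big (Loop d ?body) s1 s2" "\<forall>i<d. s2 i = s i"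
      "s2 (Suc d) = down (\<lambda>k r. b (s(d := k, Suc d := r))) (n s) (a s)" using loop[OF s1(2)] s1 by metis
    let ?s3 = "s2(Suc d := 0, d := s2 (Suc d))"
    have "big (Seq c (Seq (Loop d ?body) (move (Suc d) d))) s ?s3"
      by (rule big.Seq[OF s1(1) big.Seq[OF s2(1) big_move]]) simp
    then show "\<exists>s'. big (Seq c (Seq (Loop d ?body) (move (Suc d) d))) s s' \<and> (\<forall>i<d. s' i = s i) \<and>
        s' d = down (\<lambda>k r. b (s(d := k, Suc d := r))) (n s) (a s)"
      using s2 by (intro exI[of _ ?s3]) auto
  next
    fix s s' :: "nat \<Rightarrow> nat" assume *: "\<forall>i<d. s i = s' i"
    have "b (s(d := k, Suc d := r)) = b (s'(d := k, Suc d := r))" for k r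
      by (rule ex_dep[OF b]) (use * in auto)
    then show "down (\<lambda>k r. b (s(d := k, Suc d := r))) (n s) (a s) =
        down (\<lambda>k r. b (s'(d := k, Suc d := r))) (n s') (a s')"
      using ex_dep[OF n, of s s'] ex_dep[OF a, of s s'] * by simp
  qed
qed

section \<open>Arithmetic and case distinctions as expressions\<close>

lemma ex_app2: "ex 2 (\<lambda>s. F (s 0) (s 1)) \<Longrightarrow> ex d f \<Longrightarrow> ex d g \<Longrightarrow> ex d (\<lambda>s. F (f s) (g s))"
  using ex_app[of "[f, g]" d "\<lambda>xs. F (xs ! 0) (xs ! 1)"] by (simp add: numeral_2_eq_2)

lemma ex_app3: "ex 3 (\<lambda>s. F (s 0) (s 1) (s 2)) \<Longrightarrow> ex d f \<Longrightarrow> ex d g \<Longrightarrow> ex d h \<Longrightarrow>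
    ex d (\<lambda>s. F (f s) (g s) (h s))"
  using ex_app[of "[f, g, h]" d "\<lambda>xs. F (xs ! 0) (xs ! 1) (xs ! 2)"] by (simp add: eval_nat_numeral)

lemma down_Suc: "down (\<lambda>k r. Suc r) n a = a + n"
  by (induction n arbitrary: a) auto

lemma down_pred: "down (\<lambda>k r. r - 1) n a = a - n"
  by (induction n arbitrary: a) auto

lemma down_add: "down (\<lambda>k r. r + x) n a = a + n * x"
  by (induction n arbitrary: a) auto

lemma down_mult: "down (\<lambda>k r. r * x) n a = a * x ^ n"
  by (induction n arbitrary: a) (auto simp: algebra_simps)

lemma down_sum: "down (\<lambda>k r. r + f k) n a = a + (\<Sum>k<n. f k)"
  by (induction n arbitrary: a) auto

lemma ex_add: assumes "ex d f" "ex d g" shows "ex d (\<lambda>s. f s + g s)"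
proof (rule ex_app2[of "(+)", OF _ assms])
  show "ex 2 (\<lambda>s. s 0 + s 1)"
    using ex_down[of 2 "\<lambda>s. s 1" "\<lambda>s. s 0" "\<lambda>s. Suc (s 3)", OF ex_var ex_var ex_Suc[OF ex_var]]
    by (simp add: down_Suc eval_nat_numeral)
qed

lemma ex_diff: assumes "ex d f" "ex d g" shows "ex d (\<lambda>s. f s - g s)"
proof (rule ex_app2[of "(-)", OF _ assms])
  show "ex 2 (\<lambda>s. s 0 - s 1)"
    using ex_down[of 2 "\<lambda>s. s 1" "\<lambda>s. s 0" "\<lambda>s. s 3 - 1", OF ex_var ex_var ex_pred[OF ex_var]]
    by (simp add: down_pred[unfolded One_nat_def] eval_nat_numeral)
qed

lemma ex_mult: assumes "ex d f" "ex d g" shows "ex d (\<lambda>s. f s * g s)"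
proof (rule ex_app2[of "(*)", OF _ assms])
  show "ex 2 (\<lambda>s. s 0 * s 1)"
    using ex_down[of 2 "\<lambda>s. s 0" "\<lambda>s. 0" "\<lambda>s. s 3 + s 1", OF ex_var ex_const ex_add[OF ex_var ex_var]]
    by (simp add: down_add eval_nat_numeral)
qed

lemma ex_power: assumes "ex d f" "ex d g" shows "ex d (\<lambda>s. f s ^ g s)"
proof (rule ex_app2[of "(^)", OF _ assms])
  show "ex 2 (\<lambda>s. s 0 ^ s 1)"
    using ex_down[of 2 "\<lambda>s. s 1" "\<lambda>s. 1" "\<lambda>s. s 3 * s 0", OF ex_var ex_const ex_mult[OF ex_var ex_var]]
    by (simp add: down_mult eval_nat_numeral)
qed

definition exb :: "nat \<Rightarrow> ((nat \<Rightarrow> nat) \<Rightarrow> bool) \<Rightarrow> bool" where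
  "exb d P \<longleftrightarrow> ex d (\<lambda>s. of_bool (P s))"

lemma ex_cong: "ex d f \<Longrightarrow> (\<And>s. f s = g s) \<Longrightarrow> ex d g"
  by (metis ext)

lemma exb_not: "exb d P \<Longrightarrow> exb d (\<lambda>s. \<not> P s)"
  unfolding exb_def by (rule ex_cong[OF ex_diff[OF ex_const[of d 1]]]) auto

lemma exb_conj: "exb d P \<Longrightarrow> exb d P' \<Longrightarrow> exb d (\<lambda>s. P s \<and> P' s)"
  unfolding exb_def by (rule ex_cong[OF ex_mult[of d "\<lambda>s. of_bool (P s)" "\<lambda>s. of_bool (P' s)"]]) auto

lemma exb_disj: "exb d P \<Longrightarrow> exb d P' \<Longrightarrow> exb d (\<lambda>s. P s \<or> P' s)"
  using exb_not[OF exb_conj[OF exb_not exb_not]] by simp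

lemma exb_le: "ex d f \<Longrightarrow> ex d g \<Longrightarrow> exb d (\<lambda>s. f s \<le> g s)"
  unfolding exb_def by (rule ex_cong[OF ex_diff[OF ex_const[of d 1] ex_diff[of d f g]]]) auto

lemma exb_less: "ex d f \<Longrightarrow> ex d g \<Longrightarrow> exb d (\<lambda>s. f s < g s)"
  using exb_not[OF exb_le[of d g f]] by (simp add: not_le)

lemma exb_eq: "ex d f \<Longrightarrow> ex d g \<Longrightarrow> exb d (\<lambda>s. f s = g s)"
  using exb_conj[OF exb_le[of d f g] exb_le[of d g f]] by (simp add: eq_iff)

lemma ex_if: "exb d P \<Longrightarrow> ex d f \<Longrightarrow> ex d g \<Longrightarrow> ex d (\<lambda>s. if P s then f s else g s)"
  by (rule ex_cong[OF ex_add[OF ex_mult[of d "\<lambda>s. of_bool (P s)" f] ex_mult[of d "\<lambda>s. of_bool (\<not> P s)" g]]])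
    (use exb_not[of d P] in \<open>auto simp: exb_def\<close>)

text \<open>The quotient counts the positive multiples of \<open>y\<close> that do not exceed
  \<open>x\<close>, which turns division into a bounded sum.\<close>

lemma sum_div:
  fixes x y :: nat assumes "y \<noteq> 0"
  shows "(\<Sum>k<x. if Suc k * y \<le> x then 1 else 0) = x div y"
proof -
  have "(\<Sum>k<x. if Suc k * y \<le> x then 1 else 0) = card {k \<in> {..<x}. Suc k * y \<le> x}"
    by (simp flip: sum.inter_filter)
  also have "{k \<in> {..<x}. Suc k * y \<le> x} = {..<x div y}"
  proof -
    have iff: "Suc k * y \<le> x \<longleftrightarrow> k < x div y" for k
      using assms by (metis Suc_le_eq bot_nat_0.not_eq_extremum less_eq_div_iff_mult_less_eq)
    have "x div y \<le> x" by simp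
    then show ?thesis unfolding iff by (auto intro: less_le_trans)
  qed
  finally show ?thesis by simp
qed

lemma ex_div: assumes "ex d f" "ex d g" shows "ex d (\<lambda>s. f s div g s)"
proof (rule ex_app2[of "(div)", OF _ assms])
  have "ex 4 (\<lambda>s. s 3 + (if Suc (s 2) * s 1 \<le> s 0 then 1 else 0))"
    by (intro ex_add ex_var ex_if exb_le ex_mult ex_Suc ex_const) simp_all
  then have "ex 2 (\<lambda>s. down (\<lambda>k r. r + (if Suc k * s 1 \<le> s 0 then 1 else 0)) (s 0) 0)"
    using ex_down[of 2 "\<lambda>s. s 0" "\<lambda>s. 0" "\<lambda>s. s 3 + (if Suc (s 2) * s 1 \<le> s 0 then 1 else 0)"]
      ex_var[of 0 2] ex_const[of 2 0] by (simp add: eval_nat_numeral)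
  \<comment> \<open>For divisor 0 the sum would be \<open>x\<close>, whereas the quotient is 0 by
    convention.\<close>
  then have "ex 2 (\<lambda>s. if s 1 = 0 then 0 else down (\<lambda>k r. r + (if Suc k * s 1 \<le> s 0 then 1 else 0)) (s 0) 0)"
    by (intro ex_if exb_eq ex_var ex_const) simp_all
  then show "ex 2 (\<lambda>s. s 0 div s 1)"
    by (rule ex_cong) (simp add: down_sum sum_div del: mult_Suc)
qed

lemma ex_mod: "ex d f \<Longrightarrow> ex d g \<Longrightarrow> ex d (\<lambda>s. f s mod g s)"
  by (rule ex_cong[OF ex_diff[of d f "\<lambda>s. f s div g s * g s", OF _ ex_mult[OF ex_div]]])
    (auto simp: minus_div_mult_eq_mod)

lemmas ex_intros = ex_var ex_const ex_Suc ex_add ex_diff ex_mult ex_power ex_div ex_mod ex_if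
  exb_not exb_conj exb_disj exb_le exb_less exb_eq

section \<open>Compiling loop programs to counter machines\<close>

datatype instr = INC nat nat | DJZ nat nat nat

fun size_com :: "com \<Rightarrow> nat" where
  "size_com (Inc r) = 1"
| "size_com (Dec r) = 1"
| "size_com (Seq c c') = size_com c + size_com c'"
| "size_com (Loop r c) = Suc (size_com c)"

text \<open>\<open>compile c l x\<close> is the code of \<open>c\<close> at address \<open>l\<close> that leaves to address \<open>x\<close>.\<close>

fun compile :: "com \<Rightarrow> nat \<Rightarrow> nat \<Rightarrow> instr list" where
  "compile (Inc r) l x = [INC r x]"
| "compile (Dec r) l x = [DJZ r x x]"
| "compile (Seq c c') l x = compile c l (l + size_com c) @ compile c' (l + size_com c) x"
| "compile (Loop r c) l x = DJZ r (Suc l) x # compile c (Suc l) l"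

lemma length_compile [simp]: "length (compile c l x) = size_com c"
  by (induction c arbitrary: l x) auto

fun istep :: "instr list \<Rightarrow> nat \<times> (nat \<Rightarrow> nat) \<Rightarrow> nat \<times> (nat \<Rightarrow> nat)" where
  "istep P (l, s) = (if l < length P then (case P ! l of
       INC r x \<Rightarrow> (x, s(r := Suc (s r)))
     | DJZ r x y \<Rightarrow> if 0 < s r then (x, s(r := s r - Suc 0)) else (y, s)) else (l, s))"

definition isteps :: "instr list \<Rightarrow> nat \<times> (nat \<Rightarrow> nat) \<Rightarrow> nat \<times> (nat \<Rightarrow> nat) \<Rightarrow> bool" where
  "isteps P a b \<longleftrightarrow> (\<exists>t. (istep P ^^ t) a = b)"

lemma isteps_trans: "isteps P a b \<Longrightarrow> isteps P b c \<Longrightarrow> isteps P a c"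
proof -
  assume "isteps P a b" "isteps P b c"
  then obtain t t' where "(istep P ^^ t) a = b" "(istep P ^^ t') b = c" by (auto simp: isteps_def)
  then have "(istep P ^^ (t' + t)) a = c" by (simp add: funpow_add)
  then show ?thesis unfolding isteps_def by blast
qed

lemma isteps_step: "istep P a = b \<Longrightarrow> isteps P a b"
  unfolding isteps_def by (intro exI[of _ 1]) simp

definition code_at :: "instr list \<Rightarrow> nat \<Rightarrow> instr list \<Rightarrow> bool" where
  "code_at P l Q \<longleftrightarrow> (\<exists>A B. P = A @ Q @ B \<and> length A = l)"

lemma code_at_append: "code_at P l (Q @ R) \<longleftrightarrow> code_at P l Q \<and> code_at P (l + length Q) R"
proof
  assume "code_at P l (Q @ R)"
  then obtain A B where "P = A @ (Q @ R) @ B" "length A = l" by (auto simp: code_at_def)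
  then have "P = A @ Q @ (R @ B)" "P = (A @ Q) @ R @ B" "length (A @ Q) = l + length Q" by simp_all
  then show "code_at P l Q \<and> code_at P (l + length Q) R" using \<open>length A = l\<close> unfolding code_at_def by blast
next
  assume "code_at P l Q \<and> code_at P (l + length Q) R"
  then obtain A B A' B' where P: "P = A @ Q @ B" "length A = l" "P = A' @ R @ B'" "length A' = l + length Q"
    unfolding code_at_def by blast
  have "A' = A @ Q" using P by (metis append_assoc append_eq_append_conv length_append)
  then have "P = A @ (Q @ R) @ B'" using P by simp
  then show "code_at P l (Q @ R)" using P unfolding code_at_def by blast
qed

lemma code_at_Cons: "code_at P l (i # Q) \<longleftrightarrow> l < length P \<and> P ! l = i \<and> code_at P (Suc l) Q"
proof -
  have "code_at P l [i] \<longleftrightarrow> l < length P \<and> P ! l = i"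
  proof
    assume "code_at P l [i]"
    then show "l < length P \<and> P ! l = i" by (auto simp: code_at_def nth_append)
  next
    assume "l < length P \<and> P ! l = i"
    then have "P = take l P @ [i] @ drop (Suc l) P" "length (take l P) = l" using id_take_nth_drop[of l P] by auto
    then show "code_at P l [i]" unfolding code_at_def by blast
  qed
  then show ?thesis using code_at_append[of P l "[i]" Q] by simp
qed

lemma compile_correct:
  assumes "big c s s'" "code_at P l (compile c l x)"
  shows "isteps P (l, s) (x, s')"
  using assms
proof (induction arbitrary: l x rule: big.induct)
  case (Inc r s)
  then show ?case by (intro isteps_step) (simp add: code_at_Cons fun_eq_iff)
next
  case (Dec r s)
  have "s(r := s r - Suc 0) = s" if "s r = 0" using that by auto
  then show ?case using Dec by (intro isteps_step) (auto simp: code_at_Cons)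
next
  case (Seq c s s' c' s'')
  then have "isteps P (l, s) (l + size_com c, s')" "isteps P (l + size_com c, s') (x, s'')"
    by (auto simp: code_at_append)
  then show ?case by (rule isteps_trans)
next
  case (Loop0 s r c)
  then show ?case by (intro isteps_step) (simp add: code_at_Cons)
next
  case (Loop1 s r c s' s'')
  have 1: "isteps P (l, s) (Suc l, s(r := s r - Suc 0))"
    using Loop1.hyps Loop1.prems by (intro isteps_step) (simp add: code_at_Cons)
  have 2: "isteps P (Suc l, s(r := s r - Suc 0)) (l, s')"
    using Loop1.prems by (intro Loop1.IH(1)) (simp add: code_at_Cons)
  have 3: "isteps P (l, s') (x, s'')" by (rule Loop1.IH(2)[OF Loop1.prems])
  show ?case by (rule isteps_trans[OF 1 isteps_trans[OF 2 3]])
qed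

text \<open>After \<open>c\<close> the machine stops if register \<open>f\<close> is zero and runs forever otherwise.\<close>

definition program :: "com \<Rightarrow> nat \<Rightarrow> instr list" where
  "program c f = (let n = size_com c in compile c 0 n @ [DJZ f (n + 1) (n + 2), INC f (n + 1)])"

lemma program_run:
  assumes "big c s s'"
  shows "isteps (program c f) (0, s) (size_com c, s')"
proof (rule compile_correct[OF assms])
  have "program c f = [] @ compile c 0 (size_com c) @ [DJZ f (size_com c + 1) (size_com c + 2), INC f (size_com c + 1)]"
    by (simp add: program_def Let_def)
  then show "code_at (program c f) 0 (compile c 0 (size_com c))" unfolding code_at_def by blast
qed

lemma program_stops:
  assumes "big c s s'"
  shows "(\<exists>t. length (program c f) \<le> fst ((istep (program c f) ^^ t) (0, s))) \<longleftrightarrow> s' f = 0"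
proof -
  let ?P = "program c f" and ?n = "size_com c"
  have nth: "?P ! ?n = DJZ f (?n + 1) (?n + 2)" "?P ! (?n + 1) = INC f (?n + 1)" "length ?P = ?n + 2"
    by (simp_all add: program_def Let_def nth_append)
  obtain t0 where t0: "(istep ?P ^^ t0) (0, s) = (?n, s')" using program_run[OF assms] by (auto simp: isteps_def)
  have halted: "fst ((istep ?P ^^ (i + t)) (0, s)) = fst ((istep ?P ^^ t) (0, s))"
    if "length ?P \<le> fst ((istep ?P ^^ t) (0, s))" for t i
  proof -
    obtain l v where lv: "(istep ?P ^^ t) (0, s) = (l, v)" by force
    have "(istep ?P ^^ i) (l, v) = (l, v)" using that lv by (induction i) simp_all
    then show ?thesis using lv by (simp add: funpow_add)
  qed
  show ?thesis
  proof
    assume "s' f = 0"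
    then have "istep ?P (?n, s') = (?n + 2, s')" using nth by simp
    then have "(istep ?P ^^ Suc t0) (0, s) = (?n + 2, s')" using t0 by simp
    then have "length ?P \<le> fst ((istep ?P ^^ Suc t0) (0, s))" using nth(3) by simp
    then show "\<exists>t. length ?P \<le> fst ((istep ?P ^^ t) (0, s))" by blast
  next
    assume "\<exists>t. length ?P \<le> fst ((istep ?P ^^ t) (0, s))"
    then obtain t where t: "length ?P \<le> fst ((istep ?P ^^ t) (0, s))" by blast
    show "s' f = 0"
    proof (rule ccontr)
      assume f: "s' f \<noteq> 0"
      have "\<exists>v. (istep ?P ^^ (Suc i + t0)) (0, s) = (?n + 1, v)" for i
      proof (induction i)
        case 0
        have "istep ?P (?n, s') = (?n + 1, s'(f := s' f - Suc 0))" using nth f by simp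
        then show ?case using t0 by simp
      next
        case (Suc i)
        then obtain v where "(istep ?P ^^ (Suc i + t0)) (0, s) = (?n + 1, v)" by blast
        moreover have "istep ?P (?n + 1, v) = (?n + 1, v(f := Suc (v f)))" using nth by simp
        ultimately show ?case by simp
      qed
      from this[of t] obtain v where v: "(istep ?P ^^ (Suc t + t0)) (0, s) = (?n + 1, v)" by blast
      have eq: "Suc t0 + t = Suc t + t0" by simp
      have "fst ((istep ?P ^^ (Suc t0 + t)) (0, s)) = ?n + 1" unfolding eq v by simp
      then show False using halted[OF t, of "Suc t0"] t nth(3) by simp
    qed
  qed
qed

section \<open>A program together with its code as input\<close>

definition dig :: "nat \<Rightarrow> nat \<Rightarrow> nat \<Rightarrow> nat" where
  "dig b e i = e div b ^ i mod b"

text \<open>Counter machine number \<open>(e, b)\<close>: the first \<open>e + b\<close> states load \<open>e\<close> and \<open>b\<close> into the first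
  two registers, the remaining \<open>b\<close> states run the program whose instructions are the digits of \<open>e\<close> in base \<open>b\<close>.\<close>

definition kd_of :: "nat \<Rightarrow> nat \<Rightarrow> nat \<Rightarrow> nat" where
  "kd_of e b q = (if q < e + b then 1 else dig b e (4 * (q - (e + b))))"
definition rg_of :: "nat \<Rightarrow> nat \<Rightarrow> nat \<Rightarrow> nat" where
  "rg_of e b q = (if q < e then 2 else if q < e + b then 3 else dig b e (4 * (q - (e + b)) + 1))"
definition na_of :: "nat \<Rightarrow> nat \<Rightarrow> nat \<Rightarrow> nat" where
  "na_of e b q = (if q < e + b then Suc q else e + b + dig b e (4 * (q - (e + b)) + 2))"
definition nb_of :: "nat \<Rightarrow> nat \<Rightarrow> nat \<Rightarrow> nat" where
  "nb_of e b q = e + b + dig b e (4 * (q - (e + b)) + 3)"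

text \<open>Registers are shifted by 2 because the contents 0 and 1 are reserved. The 0 after an
  increment only pads to four digits per instruction.\<close>

fun fields :: "instr \<Rightarrow> nat list" where
  "fields (INC r x) = [1, r + 2, x, 0]"
| "fields (DJZ r x y) = [2, r + 2, x, y]"

fun value_of :: "nat \<Rightarrow> nat list \<Rightarrow> nat" where
  "value_of b [] = 0"
| "value_of b (x # xs) = x + b * value_of b xs"

lemma dig_value_of:
  assumes "\<forall>x\<in>set xs. x < b"
  shows "dig b (value_of b xs) i = (if i < length xs then xs ! i else 0)"
  using assms
proof (induction xs arbitrary: i)
  case Nil
  then show ?case by (simp add: dig_def)
next
  case (Cons x xs)
  have x: "x < b" using Cons by simp
  show ?case
  proof (cases i)
    case 0
    then show ?thesis using x by (simp add: dig_def)
  next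
    case (Suc j)
    have "value_of b (x # xs) div b ^ i = (value_of b (x # xs) div b) div b ^ j"
      unfolding Suc power_Suc div_mult2_eq ..
    also have "value_of b (x # xs) div b = value_of b xs" using x by simp
    finally have "dig b (value_of b (x # xs)) i = dig b (value_of b xs) j" by (simp add: dig_def)
    then show ?thesis using Cons Suc by simp
  qed
qed

definition code_of :: "nat \<Rightarrow> instr list \<Rightarrow> nat" where
  "code_of b P = value_of b (concat (map fields P))"

lemma length_fields: "length (fields i) = 4"
  by (cases i) auto

lemma nth_fields:
  assumes "l < length P" "j < 4" shows "concat (map fields P) ! (4 * l + j) = fields (P ! l) ! j"
  using assms
proof (induction P arbitrary: l)
  case (Cons i P)
  then show ?case by (cases l) (simp_all add: nth_append length_fields algebra_simps)
qed simp

lemma length_concat_fields: "length (concat (map fields P)) = 4 * length P"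
  by (induction P) (simp_all add: length_fields)

text \<open>The base exceeds all fields, so that they are digits, and also the program length, so
  that the program fits into the last \<open>b\<close> states. \<open>3 < b\<close> makes room for
  the contents 2 and 3 that the loader uses.\<close>

locale coded_program =
  fixes P :: "instr list" and b :: nat
  assumes b_len: "length P < b" "3 < b" and b_fields: "\<And>i x. i \<in> set P \<Longrightarrow> x \<in> set (fields i) \<Longrightarrow> x < b"
begin

definition e where "e = code_of b P"

lemma dig_e: "dig b e (4 * l + j) = (if l < length P then fields (P ! l) ! j else 0)" if "j < 4"
proof -
  have "4 * l + j < 4 * length P \<longleftrightarrow> l < length P" using that by auto
  then show ?thesis
    unfolding e_def code_of_def using b_fields nth_fields[OF _ that, of l P]
    by (subst dig_value_of) (auto simp: length_concat_fields)
qed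

lemma dig_less: "dig b e' i < b"
  using b_len by (simp add: dig_def)

sublocale counter_machine b "e + 2 * b" "kd_of e b" "rg_of e b" "na_of e b" "nb_of e b"
proof
  show "1 < b" "0 < e + 2 * b" using b_len by auto
  fix q assume q: "q < e + 2 * b"
  show "rg_of e b q < b" using b_len dig_less by (auto simp: rg_of_def)
  show "na_of e b q < e + 2 * b" using dig_less b_len by (auto simp: na_of_def)
  show "nb_of e b q < e + 2 * b" using dig_less by (auto simp: nb_of_def)
  show "2 \<le> rg_of e b q" if "kd_of e b q = 1 \<or> kd_of e b q = 2"
  proof (cases "q < e + b")
    case False
    define l where "l = q - (e + b)"
    \<comment> \<open>A nonzero kind occurs only at addresses of the program, whose register fields
      are at least 2.\<close>
    have "dig b e (4 * l) \<noteq> 0" using that False by (auto simp: kd_of_def l_def)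
    then have "l < length P" using dig_e[of 0 l] by (auto split: if_splits)
    then have "dig b e (4 * l + 1) = fields (P ! l) ! 1" using dig_e[of 1 l] by simp
    then show ?thesis using False by (cases "P ! l") (auto simp: rg_of_def l_def)
  qed (simp add: rg_of_def)
qed

definition inp :: "nat \<Rightarrow> nat" where
  "inp = (\<lambda>_. 0)(0 := e, 1 := b)"

lemma cfg_load1: "t \<le> e \<Longrightarrow> cfg t = (t, (\<lambda>_. 0)(2 := t))"
proof (induction t)
  case 0
  then show ?case by (auto simp: cfg_def)
next
  case (Suc t)
  have "kd_of e b t = 1" "rg_of e b t = 2" "na_of e b t = Suc t"
    using Suc.prems by (simp_all add: kd_of_def rg_of_def na_of_def)
  then show ?case using Suc by (simp add: cfg_Suc fun_eq_iff)
qed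

lemma cfg_load2: "t \<le> b \<Longrightarrow> cfg (e + t) = (e + t, (\<lambda>_. 0)(2 := e, 3 := t))"
proof (induction t)
  case 0
  then show ?case using cfg_load1[of e] by auto
next
  case (Suc t)
  have "kd_of e b (e + t) = 1" "rg_of e b (e + t) = 3" "na_of e b (e + t) = Suc (e + t)"
    using Suc.prems by (simp_all add: kd_of_def rg_of_def na_of_def)
  then show ?case using Suc by (simp add: cfg_Suc fun_eq_iff)
qed

text \<open>Register \<open>r\<close> of the program is counted by the units with content
  \<open>r + 2\<close>.\<close>

definition shift :: "(nat \<Rightarrow> nat) \<Rightarrow> nat \<Rightarrow> nat" where
  "shift s r = (if r < 2 then 0 else s (r - 2))"

lemma shift_upd: "(shift s)(r + 2 := v) = shift (s(r := v))"
  by (auto simp: shift_def fun_eq_iff)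

lemma kd_prog: "kd_of e b (e + b + l) = (if l < length P then fields (P ! l) ! 0 else 0)"
  using dig_e[of 0 l] by (simp add: kd_of_def)

lemma cstep_prog:
  assumes "l < length P"
  shows "cstep (e + b + l, shift s) = (case istep P (l, s) of (l', s') \<Rightarrow> (e + b + l', shift s'))"
proof -
  have f: "dig b e (4 * l + j) = fields (P ! l) ! j" if "j < 4" for j using dig_e[OF that] assms by simp
  show ?thesis
  proof (cases "P ! l")
    case (INC r x)
    then show ?thesis using assms f[of 0] f[of 1] f[of 2]
      by (simp add: kd_of_def rg_of_def na_of_def shift_upd[symmetric] shift_def)
  next
    case (DJZ r x y)
    then show ?thesis using assms f[of 0] f[of 1] f[of 2] f[of 3]
      by (simp add: kd_of_def rg_of_def na_of_def nb_of_def shift_upd[symmetric] shift_def)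
  qed
qed

lemma cfg_prog:
  assumes "\<forall>t'<t. fst ((istep P ^^ t') (0, inp)) < length P"
  shows "cfg (e + b + t) = (case (istep P ^^ t) (0, inp) of (l, s) \<Rightarrow> (e + b + l, shift s))"
  using assms
proof (induction t)
  case 0
  have "(\<lambda>_. 0)(2 := e, 3 := b) = shift inp" by (auto simp: shift_def inp_def fun_eq_iff)
  then show ?case using cfg_load2[of b] by simp
next
  case (Suc t)
  obtain l s where ls: "(istep P ^^ t) (0, inp) = (l, s)" by force
  then have "cfg (e + b + t) = (e + b + l, shift s)" using Suc by simp
  moreover have "l < length P" using Suc.prems ls by force
  ultimately have "cfg (e + b + Suc t) = (case istep P (l, s) of (l', s') \<Rightarrow> (e + b + l', shift s'))"
    using cfg_Suc[of "e + b + t"] cstep_prog by simp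
  then show ?case using ls by simp
qed

text \<open>The loader always ends at the program with \<open>e\<close> and \<open>b\<close> in
  place. At addresses past the end of \<open>P\<close> the digits of \<open>e\<close> are 0, and
  kind 0 halts.\<close>

lemma stops_iff: "stops \<longleftrightarrow> (\<exists>t. length P \<le> fst ((istep P ^^ t) (0, inp)))"
proof
  assume "\<exists>t. length P \<le> fst ((istep P ^^ t) (0, inp))"
  then obtain t where t: "length P \<le> fst ((istep P ^^ t) (0, inp))"
    "\<forall>t'<t. \<not> length P \<le> fst ((istep P ^^ t') (0, inp))"
    using exists_least_iff[of "\<lambda>t. length P \<le> fst ((istep P ^^ t) (0, inp))"] by blast
  obtain l s where ls: "(istep P ^^ t) (0, inp) = (l, s)" by force
  have "cfg (e + b + t) = (e + b + l, shift s)" using cfg_prog[of t] t(2) ls by (simp add: not_le)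
  then have "kd_of e b (fst (cfg (e + b + t))) = 0" using kd_prog[of l] t(1) ls by simp
  then show stops unfolding stops_def by (intro exI[of _ "e + b + t"]) simp
next
  assume stops
  then obtain t where t: "kd_of e b (fst (cfg t)) \<notin> {1, 2}" by (auto simp: stops_def)
  show "\<exists>t. length P \<le> fst ((istep P ^^ t) (0, inp))"
  proof (rule ccontr)
    assume "\<not> ?thesis"
    then have run: "fst ((istep P ^^ t) (0, inp)) < length P" for t by (simp add: not_le)
    have "kd_of e b (fst (cfg t)) \<in> {1, 2}"
    proof (cases "t < e + b")
      case True
      have "fst (cfg t) = t"
      proof (cases "t \<le> e")
        case False
        then show ?thesis using cfg_load2[of "t - e"] True by simp
      qed (simp add: cfg_load1)
      then show ?thesis using True by (simp add: kd_of_def)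
    next
      case False
      obtain l s where ls: "(istep P ^^ (t - (e + b))) (0, inp) = (l, s)" by force
      have "cfg t = (e + b + l, shift s)" using cfg_prog[of "t - (e + b)"] run ls False by simp
      moreover have "l < length P" using run[of "t - (e + b)"] ls by simp
      ultimately show ?thesis using kd_prog[of l] by (cases "P ! l") simp_all
    qed
    then show False using t by blast
  qed
qed

end

section \<open>The presentation is computed by a loop program\<close>

text \<open>Words are numbers with the first letter as lowest digit. The terminator 2 goes in front
  of the word first, then \<open>x\<close> ones.\<close>

definition push :: "nat \<Rightarrow> nat \<Rightarrow> nat \<Rightarrow> nat" where
  "push B x r = down (\<lambda>_ r. 1 + B * r) x (2 + B * r)"

lemma down_ones: "down (\<lambda>_ r. 1 + B * r) x (value_of B w) = value_of B (replicate x 1 @ w)"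
proof (induction x arbitrary: w)
  case (Suc x)
  have "down (\<lambda>_ r. 1 + B * r) (Suc x) (value_of B w) = down (\<lambda>_ r. 1 + B * r) x (value_of B (1 # w))"
    by simp
  also have "\<dots> = value_of B (replicate x 1 @ 1 # w)" by (rule Suc)
  also have "replicate x 1 @ 1 # w = replicate (Suc x) 1 @ w" by (simp add: replicate_app_Cons_same)
  finally show ?case .
qed simp

lemma push_value_of: "push B x (value_of B w) = value_of B (unary x @ w)"
  using down_ones[of B x "2 # w"] by (simp add: push_def unary_def)

text \<open>The descending index and the prepending cancel, so the entries appear in increasing
  order.\<close>

lemma down_push:
  "down (\<lambda>i r. push B (g i) r) N (value_of B w) = value_of B (concat (map (\<lambda>i. unary (g i)) [0..<N]) @ w)"
proof (induction N arbitrary: w)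
  case (Suc N)
  have "down (\<lambda>i r. push B (g i) r) (Suc N) (value_of B w) =
      down (\<lambda>i r. push B (g i) r) N (value_of B (unary (g N) @ w))"
    by (simp add: push_value_of)
  then show ?case using Suc[of "unary (g N) @ w"] by simp
qed simp

definition dpres :: "nat \<Rightarrow> nat \<Rightarrow> nat \<Rightarrow> nat \<Rightarrow> nat \<Rightarrow> nat" where
  "dpres e b = delta b (kd_of e b) (rg_of e b) (na_of e b) (nb_of e b)"

definition npres :: "nat \<Rightarrow> nat \<Rightarrow> nat" where
  "npres e b = 9 + (e + 2 * b) * b"

definition the_pres :: "nat \<Rightarrow> nat \<Rightarrow> presentation" where
  "the_pres e b = mach_pres (npres e b) (dpres e b) (used b)"

definition entry :: "nat \<Rightarrow> nat \<Rightarrow> nat \<Rightarrow> nat \<Rightarrow> nat" where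
  "entry s e b i = mach_op (dpres e b) (used b) s (digits (npres e b) (mach_rank s) i)"

definition add_table :: "nat \<Rightarrow> nat \<Rightarrow> nat \<Rightarrow> nat \<Rightarrow> nat \<Rightarrow> nat" where
  "add_table B s e b r = push B (mach_rank s) (down (\<lambda>i r. push B (entry s e b i) r) (npres e b ^ mach_rank s) r)"

text \<open>The word is built from its end, so the last table comes first and the size of the
  universe last.\<close>

definition tape :: "nat \<Rightarrow> nat \<Rightarrow> nat \<Rightarrow> nat" where
  "tape B e b = push B (npres e b) (add_table B 0 e b (add_table B 1 e b (add_table B 2 e b
     (add_table B 3 e b (add_table B 4 e b 0)))))"

lemma add_table_value_of:
  "add_table B s e b (value_of B w) = value_of B (unary (mach_rank s) @
     concat (map unary (map (entry s e b) [0..<npres e b ^ mach_rank s])) @ w)"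
  unfolding add_table_def down_push push_value_of by (simp add: o_def)

lemma tape_eq: "tape B e b = value_of B (encode (the_pres e b))"
proof -
  have "[0..<5] = [0, 1, 2, 3, 4::nat]" by (simp add: upt_rec)
  then have enc: "encode (the_pres e b) = concat (map unary (npres e b # concat (map (\<lambda>s. mach_rank s #
      map (entry s e b) [0..<npres e b ^ mach_rank s]) [0, 1, 2, 3, 4])))"
    by (simp add: the_pres_def mach_pres_def entry_def o_def)
  have 0: "0 = value_of B []" by simp
  have "tape B e b = value_of B (concat (map unary (npres e b # concat (map (\<lambda>s. mach_rank s #
      map (entry s e b) [0..<npres e b ^ mach_rank s]) [0, 1, 2, 3, 4]))))"
    unfolding tape_def
    by (subst 0) (simp only: add_table_value_of push_value_of, simp)
  then show ?thesis using enc by simp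
qed

lemma ex_push: "ex d f \<Longrightarrow> ex d g \<Longrightarrow> ex d (\<lambda>s. push B (f s) (g s))"
proof (rule ex_app2[of "push B"])
  have "ex (2 + 2) (\<lambda>s. 1 + B * s 3)" by (intro ex_intros) simp
  from ex_down[OF ex_var[of 0 2] ex_add[OF ex_const[of 2 2] ex_mult[OF ex_const[of 2 B] ex_var[of 1 2]]] this]
  show "ex 2 (\<lambda>s. push B (s 0) (s 1))" by (simp add: push_def)
qed

lemma ex_dig: "ex d f \<Longrightarrow> ex d g \<Longrightarrow> ex d h \<Longrightarrow> ex d (\<lambda>s. dig (f s) (g s) (h s))"
  unfolding dig_def by (intro ex_intros)

lemma ex_kd: "ex d f \<Longrightarrow> ex d g \<Longrightarrow> ex d h \<Longrightarrow> ex d (\<lambda>s. kd_of (f s) (g s) (h s))"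
  unfolding kd_of_def by (intro ex_intros ex_dig)

lemma ex_rg: "ex d f \<Longrightarrow> ex d g \<Longrightarrow> ex d h \<Longrightarrow> ex d (\<lambda>s. rg_of (f s) (g s) (h s))"
  unfolding rg_of_def by (intro ex_intros ex_dig)

lemma ex_na: "ex d f \<Longrightarrow> ex d g \<Longrightarrow> ex d h \<Longrightarrow> ex d (\<lambda>s. na_of (f s) (g s) (h s))"
  unfolding na_of_def by (intro ex_intros ex_dig)

lemma ex_nb: "ex d f \<Longrightarrow> ex d g \<Longrightarrow> ex d h \<Longrightarrow> ex d (\<lambda>s. nb_of (f s) (g s) (h s))"
  unfolding nb_of_def by (intro ex_intros ex_dig)

lemma ex_sym: "ex d f \<Longrightarrow> ex d g \<Longrightarrow> ex d h \<Longrightarrow> ex d (\<lambda>s. sym (f s) (g s) (h s))"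
  unfolding sym_def by (intro ex_intros)

lemma ex_delta:
  assumes "ex d e" "ex d b" "ex d g" "ex d y"
  shows "ex d (\<lambda>s. dpres (e s) (b s) k (g s) (y s))"
proof (cases "k = 0")
  case True
  show ?thesis unfolding dpres_def delta_def Let_def True
    by (simp only: simp_thms if_True) (intro ex_intros ex_kd ex_rg ex_na ex_nb ex_sym assms)
next
  case False
  then show ?thesis unfolding dpres_def delta_def Let_def
    by (simp only: simp_thms if_False) (intro ex_intros ex_kd ex_rg ex_na ex_nb ex_sym assms)
qed

lemma ex_u: "ex d y \<Longrightarrow> ex d (\<lambda>s. u_op (y s))"
  unfolding u_op_def by (intro ex_intros)

lemma ex_f:
  assumes "ex d e" "ex d b" "ex d g" "ex d y"
  shows "ex d (\<lambda>s. f_op (dpres (e s) (b s)) k (y s) (g s))"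
proof (cases "k = 0")
  case True
  show ?thesis unfolding f_op_def True
    by (simp only: simp_thms if_True) (intro ex_intros ex_delta assms)
next
  case False
  then show ?thesis unfolding f_op_def
    by (simp only: simp_thms if_False) (intro ex_intros ex_delta assms)
qed

lemma ex_s:
  assumes "ex d x" "ex d y" "ex d v"
  shows "ex d (\<lambda>s. s_op (x s) (y s) (v s))"
proof -
  have "s_op x y v = (if (x = 3 \<or> x = 4) \<and> (y = 3 \<or> y = 4) \<and> (v = 3 \<or> v = 4) then
      if v = 4 \<or> x = 4 \<and> y = 4 then 6 else 5 else 0)" for x y v
    by (simp add: s_op_def)
  then show ?thesis by (simp only:) (intro ex_intros assms)
qed

lemma ex_tv: "ex d f \<Longrightarrow> ex d (\<lambda>s. tv (f s))"
  unfolding tv_def by (intro ex_intros)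

lemma ex_c:
  assumes "ex d b" "ex d x" "ex d y" "ex d v" "ex d h"
  shows "ex d (\<lambda>s. c_op (used (b s)) (x s) (y s) (v s) (h s))"
  unfolding c_op_def used_def Let_def by (intro ex_intros ex_tv assms)

lemma ex_npres: "ex d e \<Longrightarrow> ex d b \<Longrightarrow> ex d (\<lambda>s. npres (e s) (b s))"
  unfolding npres_def by (intro ex_intros)

lemma digits_nth: "j < k \<Longrightarrow> digits n k i ! j = i div n ^ (k - 1 - j) mod n"
  by (simp add: digits_def)

text \<open>Registers hold numbers and not lists, so the arguments of each operation are written out
  as digits of the table index.\<close>

lemma ex_entry:
  assumes "s < 5" "ex d e" "ex d b" "ex d i"
  shows "ex d (\<lambda>t. entry s (e t) (b t) (i t))"
proof -
  have n: "ex d (\<lambda>t. i t div npres (e t) (b t) ^ j mod npres (e t) (b t))" for j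
    by (intro ex_intros ex_npres assms)
  consider "s = 0" | "s = 1" | "s = 2" | "s = 3" | "s = 4" using assms(1) by linarith
  then show ?thesis
  proof cases
    case 1
    then have "entry s e b i = u_op (i div npres e b ^ 0 mod npres e b)" for e b i
      by (simp add: entry_def mach_op_def mach_rank_def digits_nth)
    then show ?thesis by (simp only:) (intro ex_u n)
  next
    case 2
    then have "entry s e b i = f_op (dpres e b) 0 (i div npres e b ^ 1 mod npres e b) (i div npres e b ^ 0 mod npres e b)" for e b i
      by (simp add: entry_def mach_op_def mach_rank_def digits_nth)
    then show ?thesis by (simp only:) (intro ex_f n assms)
  next
    case 3
    then have "entry s e b i = f_op (dpres e b) 1 (i div npres e b ^ 1 mod npres e b) (i div npres e b ^ 0 mod npres e b)" for e b i
      by (simp add: entry_def mach_op_def mach_rank_def digits_nth eval_nat_numeral)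
    then show ?thesis by (simp only:) (intro ex_f n assms)
  next
    case 4
    then have "entry s e b i = s_op (i div npres e b ^ 2 mod npres e b) (i div npres e b ^ 1 mod npres e b)
        (i div npres e b ^ 0 mod npres e b)" for e b i
      by (simp add: entry_def mach_op_def mach_rank_def digits_nth eval_nat_numeral)
    then show ?thesis by (simp only:) (intro ex_s n)
  next
    case 5
    then have "entry s e b i = c_op (used b) (i div npres e b ^ 3 mod npres e b) (i div npres e b ^ 2 mod npres e b)
        (i div npres e b ^ 1 mod npres e b) (i div npres e b ^ 0 mod npres e b)" for e b i
      by (simp add: entry_def mach_op_def mach_rank_def digits_nth eval_nat_numeral)
    then show ?thesis by (simp only:) (intro ex_c n assms)
  qed
qed

lemma ex_add_table:
  assumes s: "s < 5" and ebr: "ex d e" "ex d b" "ex d r"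
  shows "ex d (\<lambda>t. add_table B s (e t) (b t) (r t))"
proof -
  \<comment> \<open>Registers 0 and 1 hold \<open>e\<close> and \<open>b\<close>, 2 the rest of the
    word, 3 is the table index and 4 the accumulator.\<close>
  have "ex (3 + 2) (\<lambda>t. push B (entry s (t 0) (t 1) (t 3)) (t 4))"
    by (intro ex_push ex_entry s ex_var) simp_all
  from ex_down[OF ex_power[OF ex_npres[OF ex_var[of 0 3] ex_var[of 1 3]] ex_const[of 3 "mach_rank s"]] ex_var[of 2 3] this]
  have "ex 3 (\<lambda>t. down (\<lambda>k r. push B (entry s (t 0) (t 1) k) r) (npres (t 0) (t 1) ^ mach_rank s) (t 2))"
    by simp
  then have "ex 3 (\<lambda>t. add_table B s (t 0) (t 1) (t 2))"
    unfolding add_table_def by (intro ex_push ex_const)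
  then show ?thesis by (rule ex_app3[of "\<lambda>x y z. add_table B s x y z", OF _ ebr])
qed

lemma ex_tape: "ex 2 (\<lambda>t. tape B (t 0) (t 1))"
  unfolding tape_def by (intro ex_push ex_npres ex_add_table ex_var ex_const) simp_all

section \<open>Simulating a Turing machine\<close>

text \<open>Results are shifted by one, so that 0 signals that no instruction applies.\<close>

fun lookup :: "(nat \<times> nat \<times> move \<Rightarrow> nat) \<Rightarrow> tm \<Rightarrow> nat \<Rightarrow> nat \<Rightarrow> nat" where
  "lookup g [] q a = 0"
| "lookup g (x # M) q a = (if q = fst (fst x) \<and> a = snd (fst x) then Suc (g (snd x)) else lookup g M q a)"

lemma lookup_eq: "lookup g M q a = (case map_of M (q, a) of None \<Rightarrow> 0 | Some v \<Rightarrow> Suc (g v))"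
  by (induction M) (auto simp: prod_eq_iff)

lemma ex_lookup: "ex d f \<Longrightarrow> ex d h \<Longrightarrow> ex d (\<lambda>s. lookup g M (f s) (h s))"
proof (induction M)
  case Nil
  show ?case by (simp add: ex_const)
next
  case (Cons x M)
  then show ?case unfolding lookup.simps by (intro ex_intros)
qed

fun move_code :: "nat \<times> nat \<times> move \<Rightarrow> nat" where
  "move_code (q, a, Stay) = 0"
| "move_code (q, a, Move_right) = 1"
| "move_code (q, a, Move_left) = 2"

text \<open>The tape is kept as two numbers in base \<open>B\<close>: the digits of \<open>r\<close> are the symbols from the head
  to the right, those of \<open>l\<close> the symbols to the left of the head.\<close>

definition codes :: "nat \<Rightarrow> config \<Rightarrow> nat \<Rightarrow> nat \<Rightarrow> nat \<Rightarrow> bool" where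
  "codes B c q l r \<longleftrightarrow> (case c of (q', p, T) \<Rightarrow> q' = q \<and>
     (\<forall>j. dig B l j = T (p - 1 - int j)) \<and> (\<forall>j. dig B r j = T (p + int j)))"

definition new_q :: "tm \<Rightarrow> nat \<Rightarrow> nat \<Rightarrow> nat \<Rightarrow> nat \<Rightarrow> nat" where
  "new_q M B q l r = (if lookup fst M q (r mod B) = 0 then q else lookup fst M q (r mod B) - 1)"

text \<open>Owing to the shift in \<open>lookup\<close>, \<open>m\<close> is 1 for staying, 2 for
  right, 3 for left and 0 for a halted machine.\<close>

definition new_l :: "tm \<Rightarrow> nat \<Rightarrow> nat \<Rightarrow> nat \<Rightarrow> nat \<Rightarrow> nat" where
  "new_l M B q l r = (let m = lookup move_code M q (r mod B); a = lookup (fst \<circ> snd) M q (r mod B) - 1 in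
     if m = 2 then a + B * l else if m = 3 then l div B else l)"

definition new_r :: "tm \<Rightarrow> nat \<Rightarrow> nat \<Rightarrow> nat \<Rightarrow> nat \<Rightarrow> nat" where
  "new_r M B q l r = (let m = lookup move_code M q (r mod B); a = lookup (fst \<circ> snd) M q (r mod B) - 1 in
     if m = 0 then r else if m = 1 then a + B * (r div B) else if m = 2 then r div B
     else l mod B + B * (a + B * (r div B)))"

definition running :: "tm \<Rightarrow> nat \<Rightarrow> nat \<Rightarrow> nat \<Rightarrow> nat" where
  "running M B q r = (if lookup fst M q (r mod B) = 0 then 0 else 1)"

lemma dig_cons: "a < B \<Longrightarrow> dig B (a + B * x) j = (case j of 0 \<Rightarrow> a | Suc i \<Rightarrow> dig B x i)"
  by (cases j) (simp_all add: dig_def div_mult2_eq)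

lemma dig_div: "dig B (x div B) j = dig B x (Suc j)"
  by (simp add: dig_def div_mult2_eq)

lemma dig_0: "dig B x 0 = x mod B"
  by (simp add: dig_def)

lemma codes_halted:
  assumes c: "codes B c q l r" and none: "tm_step M c = None"
  shows "running M B q r = 0" "new_q M B q l r = q"
proof -
  obtain p T where cq: "c = (q, p, T)" using c by (cases c) (auto simp: codes_def)
  have "r mod B = T p" using c cq by (auto simp: codes_def dig_0[symmetric])
  then have "map_of M (q, r mod B) = None" using none cq by (auto split: option.splits)
  then show "running M B q r = 0" "new_q M B q l r = q"
    by (simp_all add: running_def new_q_def lookup_eq)
qed

lemma codes_step:
  assumes c: "codes B c q l r" and some: "tm_step M c = Some c'"
    and B: "\<And>x. x \<in> set M \<Longrightarrow> fst (snd (snd x)) < B"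
  shows "running M B q r = 1" "codes B c' (new_q M B q l r) (new_l M B q l r) (new_r M B q l r)"
proof -
  obtain p T where cq: "c = (q, p, T)" using c by (cases c) (auto simp: codes_def)
  have l: "dig B l j = T (p - 1 - int j)" and r: "dig B r j = T (p + int j)" for j
    using c cq by (auto simp: codes_def)
  have sc: "r mod B = T p" using r[of 0] by (simp add: dig_0)
  have "map_of M (q, r mod B) \<noteq> None" using some cq sc by (auto split: option.splits)
  then obtain q' a m where m: "map_of M (q, r mod B) = Some (q', a, m)" by (metis not_None_eq prod_cases3)
  have "((q, r mod B), (q', a, m)) \<in> set M" using m by (rule map_of_SomeD)
  from B[OF this] have a: "a < B" by simp
  have c': "c' = (q', p + offset m, T(p := a))" using some cq sc m by simp
  show "running M B q r = 1" using m by (simp add: running_def lookup_eq)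
  have nq: "new_q M B q l r = q'" using m by (simp add: new_q_def lookup_eq)
  have l': "l mod B < B" using a by simp
  have r0: "dig B (r div B) j = T (p + 1 + int j)" for j using r[of "Suc j"] by (simp add: dig_div algebra_simps)
  have ar: "dig B (a + B * (r div B)) j = (T(p := a)) (p + int j)" for j
    by (cases j) (simp_all add: dig_cons[OF a] r0 add.assoc)
  show "codes B c' (new_q M B q l r) (new_l M B q l r) (new_r M B q l r)"
  proof (cases m)
    case Stay
    then show ?thesis using m nq c' ar l
      by (simp add: codes_def new_l_def new_r_def lookup_eq)
  next
    case Move_right
    have "dig B (a + B * l) j = (T(p := a)) (p - int j)" for j
      by (cases j) (simp_all add: dig_cons[OF a] l diff_diff_eq)
    then show ?thesis using m nq c' Move_right r0
      by (simp add: codes_def new_l_def new_r_def lookup_eq)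
  next
    case Move_left
    have "dig B (l mod B + B * (a + B * (r div B))) j = (T(p := a)) (p - 1 + int j)" for j
    proof (cases j)
      case 0
      then show ?thesis using l[of 0] unfolding dig_cons[OF l'] by (simp add: dig_0)
    next
      case (Suc i)
      have p: "p - 1 + int j = p + int i" using Suc by simp
      show ?thesis unfolding dig_cons[OF l'] p unfolding Suc by (simp only: nat.case ar)
    qed
    moreover have "dig B (l div B) j = (T(p := a)) (p - 2 - int j)" for j
      using l[of "Suc j"] by (simp add: dig_div algebra_simps)
    ultimately show ?thesis using m nq c' Move_left
      by (simp add: codes_def new_l_def new_r_def lookup_eq algebra_simps)
  qed
qed

lemma ex_new:
  "ex d q \<Longrightarrow> ex d l \<Longrightarrow> ex d r \<Longrightarrow> ex d (\<lambda>s. new_q M B (q s) (l s) (r s))"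
  "ex d q \<Longrightarrow> ex d l \<Longrightarrow> ex d r \<Longrightarrow> ex d (\<lambda>s. new_l M B (q s) (l s) (r s))"
  "ex d q \<Longrightarrow> ex d l \<Longrightarrow> ex d r \<Longrightarrow> ex d (\<lambda>s. new_r M B (q s) (l s) (r s))"
  "ex d q \<Longrightarrow> ex d r \<Longrightarrow> ex d (\<lambda>s. running M B (q s) (r s))"
  unfolding new_q_def new_l_def new_r_def running_def Let_def by (intro ex_intros ex_lookup; assumption)+

text \<open>A simultaneous assignment: all four values are computed above register 5 before any
  target is overwritten.\<close>

lemma assign4:
  assumes "ex 6 f2" "ex 6 f3" "ex 6 f4" "ex 6 f5"
  shows "\<exists>c. \<forall>s. \<exists>s'. big c s s' \<and> s' 2 = f2 s \<and> s' 3 = f3 s \<and> s' 4 = f4 s \<and> s' 5 = f5 s"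
proof -
  let ?fs = "[f2, f3, f4, f5]"
  obtain c where c: "\<forall>s. \<exists>s'. big c s s' \<and> (\<forall>i<6. s' i = s i) \<and> (\<forall>j<length ?fs. s' (6 + j) = (?fs ! j) s)"
    using ex_args[of ?fs 6] assms by auto
  let ?c = "Seq c (Seq (move 6 2) (Seq (move 7 3) (Seq (move 8 4) (move 9 5))))"
  have "\<exists>s'. big ?c s s' \<and> s' 2 = f2 s \<and> s' 3 = f3 s \<and> s' 4 = f4 s \<and> s' 5 = f5 s" for s
  proof -
    obtain s1 where s1: "big c s s1" and v: "\<forall>j<length ?fs. s1 (6 + j) = (?fs ! j) s" using c by blast
    let ?s2 = "s1(6 := 0, 2 := s1 6)"
    let ?s3 = "?s2(7 := 0, 3 := ?s2 7)"
    let ?s4 = "?s3(8 := 0, 4 := ?s3 8)"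
    let ?s5 = "?s4(9 := 0, 5 := ?s4 9)"
    have "big ?c s ?s5"
      by (rule big.Seq[OF s1 big.Seq[OF big_move big.Seq[OF big_move big.Seq[OF big_move big_move]]]]) simp_all
    moreover have "s1 6 = f2 s" "s1 7 = f3 s" "s1 8 = f4 s" "s1 9 = f5 s"
      using v[rule_format, of 0] v[rule_format, of 1] v[rule_format, of 2] v[rule_format, of 3] by simp_all
    then have "?s5 2 = f2 s" "?s5 3 = f3 s" "?s5 4 = f4 s" "?s5 5 = f5 s" by simp_all
    ultimately show ?thesis by blast
  qed
  then show ?thesis by blast
qed

text \<open>Register 5 is the loop counter used as a flag: each pass consumes it, and the body sets
  it again exactly if an instruction was executed.\<close>

lemma simulation:
  assumes B: "\<And>x. x \<in> set M \<Longrightarrow> fst (snd (snd x)) < B"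
  shows "\<exists>c. \<forall>s cf cf'. codes B cf (s 2) (s 3) (s 4) \<longrightarrow> s 5 = 1 \<longrightarrow>
    (cf, cf') \<in> {(c, c'). tm_step M c = Some c'}\<^sup>* \<longrightarrow> tm_step M cf' = None \<longrightarrow>
    (\<exists>s'. big c s s' \<and> s' 2 = fst cf')"
proof -
  have "\<exists>c. \<forall>s. \<exists>s'. big c s s' \<and> s' 2 = new_q M B (s 2) (s 3) (s 4) \<and> s' 3 = new_l M B (s 2) (s 3) (s 4) \<and>
      s' 4 = new_r M B (s 2) (s 3) (s 4) \<and> s' 5 = running M B (s 2) (s 4)"
    by (intro assign4 ex_new ex_var) simp_all
  then obtain c where c: "\<And>s. \<exists>s'. big c s s' \<and> s' 2 = new_q M B (s 2) (s 3) (s 4) \<and>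
      s' 3 = new_l M B (s 2) (s 3) (s 4) \<and> s' 4 = new_r M B (s 2) (s 3) (s 4) \<and> s' 5 = running M B (s 2) (s 4)"
    by blast
  have "\<exists>s'. big (Loop 5 c) s s' \<and> s' 2 = fst cf'"
    if "(cf, cf') \<in> {(c, c'). tm_step M c = Some c'}\<^sup>*" "tm_step M cf' = None"
      "codes B cf (s 2) (s 3) (s 4)" "s 5 = 1" for s cf cf'
    using that
  proof (induction arbitrary: s rule: converse_rtrancl_induct)
    \<comment> \<open>One last pass runs in the halting configuration; it preserves the state and
      leaves the flag at 0.\<close>
    case base
    obtain s' where s': "big c (s(5 := s 5 - Suc 0)) s'" "s' 2 = new_q M B (s 2) (s 3) (s 4)"
      "s' 5 = running M B (s 2) (s 4)" using c[of "s(5 := s 5 - Suc 0)"] by auto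
    have "s' 5 = 0" "s' 2 = s 2" using codes_halted[OF base(2) base(1)] s' by simp_all
    moreover have "fst cf' = s 2" using base(2) by (auto simp: codes_def split: prod.splits)
    moreover have "big (Loop 5 c) s s'"
      by (rule big.Loop1[OF _ s'(1) big.Loop0]) (use base \<open>s' 5 = 0\<close> in simp_all)
    ultimately show ?case by auto
  next
    case (step cf1 cf2)
    obtain s' where s': "big c (s(5 := s 5 - Suc 0)) s'" "s' 2 = new_q M B (s 2) (s 3) (s 4)"
      "s' 3 = new_l M B (s 2) (s 3) (s 4)" "s' 4 = new_r M B (s 2) (s 3) (s 4)"
      "s' 5 = running M B (s 2) (s 4)" using c[of "s(5 := s 5 - Suc 0)"] by auto
    have st: "tm_step M cf1 = Some cf2" using step.hyps(1) by simp
    have "s' 5 = 1" "codes B cf2 (s' 2) (s' 3) (s' 4)"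
      using codes_step[OF step.prems(2) st B] s' by simp_all
    then obtain s'' where s'': "big (Loop 5 c) s' s''" "s'' 2 = fst cf'"
      using step.IH[OF step.prems(1)] by blast
    have "big (Loop 5 c) s s''"
      by (rule big.Loop1[OF _ s'(1) s''(1)]) (use step.prems in simp)
    then show ?case using s''(2) by blast
  qed
  then show ?thesis by (intro exI[of _ "Loop 5 c"]) blast
qed

lemma initial_codes:
  assumes "\<forall>x\<in>set v. x < B"
  shows "codes B (initial_config v) start_state 0 (value_of B v)"
proof -
  have "dig B 0 j = 0" for j by (simp add: dig_def)
  then show ?thesis by (auto simp: codes_def initial_config_def dig_value_of[OF assms])
qed

lemma encode_letters: "x \<in> set (encode P) \<Longrightarrow> x < 3"
proof -
  have "set (unary y) \<subseteq> {1, 2}" for y by (auto simp: unary_def)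
  then have "set (concat (map unary ys)) \<subseteq> {1, 2}" for ys by (induction ys) simp_all
  then have "set (encode P) \<subseteq> {1, 2}" by (cases P) (simp only: encode.simps)
  then show "x \<in> set (encode P) \<Longrightarrow> x < 3" by auto
qed

text \<open>Registers 0 and 1 hold \<open>e\<close> and \<open>b\<close>, registers 2 to 5 the
  simulated machine, and register 6 its answer.\<close>

lemma decider_program:
  "\<exists>c. \<forall>s q. halts_in M (encode (the_pres (s 0) (s 1))) q \<longrightarrow>
    (\<exists>s'. big c s s' \<and> s' 6 = of_bool (q = accept_state))"
proof -
  \<comment> \<open>The base must exceed the letters 1 and 2 of the input and every symbol that
    \<open>M\<close> writes, so that tape symbols are digits.\<close>
  define B where "B = 3 + (\<Sum>x\<leftarrow>M. fst (snd (snd x)))"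
  have B: "fst (snd (snd x)) < B" if "x \<in> set M" for x
  proof -
    have "fst (snd (snd x)) \<le> (\<Sum>x\<leftarrow>M. fst (snd (snd x)))"
      using that by (intro member_le_sum_list) auto
    then show ?thesis by (simp add: B_def)
  qed
  have "\<exists>c. \<forall>s. \<exists>s'. big c s s' \<and> s' 2 = start_state \<and> s' 3 = 0 \<and> s' 4 = tape B (s 0) (s 1) \<and> s' 5 = 1"
    by (intro assign4 ex_const ex_weaken[OF ex_tape]) simp
  then obtain c1 where c1: "\<And>s. \<exists>s'. big c1 s s' \<and> s' 2 = start_state \<and> s' 3 = 0 \<and>
      s' 4 = tape B (s 0) (s 1) \<and> s' 5 = 1" by blast
  obtain c2 where c2: "\<forall>s cf cf'. codes B cf (s 2) (s 3) (s 4) \<longrightarrow> s 5 = 1 \<longrightarrow>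
    (cf, cf') \<in> {(c, c'). tm_step M c = Some c'}\<^sup>* \<longrightarrow> tm_step M cf' = None \<longrightarrow>
    (\<exists>s'. big c2 s s' \<and> s' 2 = fst cf')"
    by (rule exE[OF simulation[OF B] that])
  have "ex 6 (\<lambda>s. if s 2 = accept_state then 1 else 0)" by (intro ex_intros) simp
  then obtain c3 where c3: "\<And>s. \<exists>s'. big c3 s s' \<and> (\<forall>i<6. s' i = s i) \<and> s' 6 = (if s 2 = accept_state then 1 else 0)"
    using ex_prog by blast
  have "\<exists>s'. big (Seq c1 (Seq c2 c3)) s s' \<and> s' 6 = of_bool (q = accept_state)"
    if halts: "halts_in M (encode (the_pres (s 0) (s 1))) q" for s q
  proof -
    let ?v = "encode (the_pres (s 0) (s 1))"
    obtain p T where h: "(initial_config ?v, (q, p, T)) \<in> {(c, c'). tm_step M c = Some c'}\<^sup>*"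
      "tm_step M (q, p, T) = None" using halts unfolding halts_in_def by blast
    obtain s1 where s1: "big c1 s s1" "s1 2 = start_state" "s1 3 = 0" "s1 4 = tape B (s 0) (s 1)" "s1 5 = 1"
      using c1[of s] by blast
    have "3 \<le> B" by (simp add: B_def)
    then have "\<forall>x\<in>set ?v. x < B" by (intro ballI less_le_trans[OF encode_letters])
    then have "codes B (initial_config ?v) (s1 2) (s1 3) (s1 4)"
      using initial_codes s1 by (simp add: tape_eq)
    from c2[rule_format, OF this s1(5) h] obtain s2 where s2: "big c2 s1 s2" "s2 2 = q" unfolding fst_conv by blast
    obtain s3 where s3: "big c3 s2 s3" "s3 6 = (if s2 2 = accept_state then 1 else 0)" using c3[of s2] by blast
    have "big (Seq c1 (Seq c2 c3)) s s3" by (rule big.Seq[OF s1(1) big.Seq[OF s2(1) s3(1)]])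
    then show ?thesis using s3(2) s2(2) by auto
  qed
  then show ?thesis by blast
qed

lemma coded_program_exists: "\<exists>b. coded_program P b"
proof -
  define b where "b = 4 + length P + (\<Sum>x\<leftarrow>concat (map fields P). x)"
  have "x < b" if "i \<in> set P" "x \<in> set (fields i)" for i x
  proof -
    have "x \<in> set (concat (map fields P))" using that by auto
    then have "x \<le> sum_list (concat (map fields P))" by (intro member_le_sum_list) simp_all
    then show ?thesis by (simp add: b_def)
  qed
  then have "coded_program P b" by unfold_locales (auto simp: b_def)
  then show ?thesis by blast
qed

theorem mainTheorem1:
  shows "undecidable encode {P. valid_presentation P}
    (\<lambda>P. Type4_lattice \<in> typ_variety (table_alg P))"
  unfolding undecidable_def decides_def
proof
  let ?Q = "\<lambda>P. Type4_lattice \<in> typ_variety (table_alg P)"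
  assume "\<exists>M. \<forall>x\<in>{P. valid_presentation P}.
    halts_in M (encode x) (if ?Q x then accept_state else reject_state)"
  then obtain M where M: "\<And>x. valid_presentation x \<Longrightarrow>
    halts_in M (encode x) (if ?Q x then accept_state else reject_state)" by blast
  obtain c where c: "\<forall>s q. halts_in M (encode (the_pres (s 0) (s 1))) q \<longrightarrow>
    (\<exists>s'. big c s s' \<and> s' 6 = of_bool (q = accept_state))"
    by (rule exE[OF decider_program that])
  obtain b where "coded_program (program c 6) b" using coded_program_exists by (rule exE)
  then interpret coded_program "program c 6" b .
  let ?P = "the_pres e b"
  have pres: "?P = mach_pres (9 + (e + 2 * b) * b) d (used b)"
    unfolding the_pres_def npres_def dpres_def ..
  have "valid_presentation ?P" unfolding pres by (rule valid_mach_pres)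
  \<comment> \<open>\<open>inp\<close> consists of \<open>e\<close> and \<open>b\<close> themselves,
    so the word given to \<open>M\<close> presents the very algebra that this program
    defines.\<close>
  then have h: "halts_in M (encode (the_pres (inp 0) (inp 1))) (if ?Q ?P then accept_state else reject_state)"
    using M by (simp add: inp_def)
  obtain s' where s': "big c inp s'" "s' 6 = of_bool ((if ?Q ?P then accept_state else reject_state) = accept_state)"
    using c[rule_format, OF h] by blast
  \<comment> \<open>Type 4 occurs iff the runs are bounded, iff the counter machine stops, iff the
    flag in register 6 is zero, that is, iff \<open>M\<close> does not accept.\<close>
  have "?Q ?P \<longleftrightarrow> s' 6 = 0"
    unfolding pres A_def[symmetric] type4_iff bounded_iff_stops stops_iff by (rule program_stops[OF s'(1)])
  then show False unfolding s'(2) by (simp add: accept_state_def reject_state_def split: if_splits)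
qed

end
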